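(* Let $L$ be a Banach function space, let $m\in\mathbb N$, let $\Psi_1,\ldots,\Psi_m$ be bounded sets of positive kernel operators on $L$, and let $\alpha_1,\ldots,\alpha_m$ be positive numbers with $\sum_{j=1}^m\alpha_j=1$. For $i=1,\ldots,m$ define $$\Sigma_i=\Psi_i^{(\alpha_1)}\circ\Psi_{i+1}^{(\alpha_2)}\circ\cdots\circ\Psi_m^{(\alpha_{m-i+1})}\circ\Psi_1^{(\alpha_{m-i+2})}\circ\cdots\circ\Psi_{i-1}^{(\alpha_m)} .$$ Then for each $r\in\{\rho,\hat\rho\}$, $$r(\Sigma_1\Sigma_2\cdots\Sigma_m)\le r(\Psi_1\Psi_2\cdots\Psi_m).$$ If, in addition, $L$ and its dual $L^*$ have order continuous norms, then this inequality holds also for each $r\in\{\rho_{ess},\hat\rho_{ess}\}$.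
   Context: $(X,\mathfrak M,\mu)$ is a nonempty set with a $\sigma$-finite positive measure; $M(\mu)$ is the space of measurable complex functions on $X$ modulo a.e. equality. A Banach function space $L$ is a Banach space $L\subseteq M(\mu)$ such that $f\in L$, $g\in M(\mu)$, $|g|\le|f|$ imply $g\in L$ and $\|g\|\le\|f\|$; $X$ is assumed to be the carrier of $L$, i.e. there is no measurable $Y$ with $\mu(Y)>0$ such that $f\chi_Y=0$ a.e. for all $f\in L$. A norm is order continuous if $\|f_n\|\to0$ for every decreasing sequence $(f_n)$ of positive elements of the space with infimum $0$. A linear operator $A$ on $L$ is positive if it maps a.e. nonnegative functions to a.e. nonnegative functions (then it is bounded). It is a kernel operator if there is a $\mu\times\mu$-measurable $a$ on $X\times X$ such that for all $f\in L$ and almost all $x$, $\int_X|a(x,y)f(y)|\,d\mu(y)<\infty$ and $(Af)(x)=\int_X a(x,y)f(y)\,d\mu(y)$. For positive kernel operators $A_1,\ldots,A_m$ with kernels $a_1,\ldots,a_m$ and positive $\alpha_j$ with $\sum_j\alpha_j=1$, the Hadamard weighted geometric mean $A_1^{(\alpha_1)}\circ\cdots\circ A_m^{(\alpha_m)}$ is the positive kernel operator on $L$ with kernel $a_1(x,y)^{\alpha_1}\cdots a_m(x,y)^{\alpha_m}$. For bounded sets of operators: $\Psi_1\cdots\Psi_k=\{A_1\cdots A_k: A_i\in\Psi_i\}$, $\Sigma^k=\{A_1\cdots A_k:A_i\in\Sigma\}$, and $\Psi_1^{(\alpha_1)}\circ\cdots\circ\Psi_m^{(\alpha_m)}=\{A_1^{(\alpha_1)}\circ\cdots\circ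 A_m^{(\alpha_m)}:A_j\in\Psi_j\}$ (elements chosen independently from each factor). With $\rho(A)$ the spectral radius of an operator, $D_L$ the closed unit ball of $L$, $\gamma(A)=\inf\{\delta>0:\text{there is a finite }M\subset L\text{ with }A(D_L)\subset M+\delta D_L\}$ the Hausdorff measure of noncompactness, and $\rho_{ess}(A)=\lim_{j\to\infty}\gamma(A^j)^{1/j}$ the essential spectral radius, for a bounded set $\Sigma$ of bounded operators put $\rho(\Sigma)=\limsup_{k\to\infty}[\sup_{A\in\Sigma^k}\rho(A)]^{1/k}$, $\hat\rho(\Sigma)=\lim_{k\to\infty}[\sup_{A\in\Sigma^k}\|A\|]^{1/k}$, $\rho_{ess}(\Sigma)=\limsup_{k\to\infty}[\sup_{A\in\Sigma^k}\rho_{ess}(A)]^{1/k}$, $\hat\rho_{ess}(\Sigma)=\lim_{k\to\infty}[\sup_{A\in\Sigma^k}\gamma(A)]^{1/k}$. *)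

theory Defs
  imports "HOL-Analysis.Analysis"
begin

text \<open>
  HOL-Analysis only has the real class \<open>banach\<close>; complex scalars are added to it compatibly
  with the real ones.  Operators are taken from the library type
  \<open>'l \<Rightarrow>\<^sub>L 'l\<close> of bounded real-linear maps, and complex linearity is required explicitly.
\<close>

class complex_banach = banach +
  fixes scaleC :: "complex \<Rightarrow> 'a \<Rightarrow> 'a"  (infixr \<open>*\<^sub>C\<close> 75)
  assumes scaleC_add_right: "c *\<^sub>C (x + y) = c *\<^sub>C x + c *\<^sub>C y"
    and scaleC_add_left: "(c + d) *\<^sub>C x = c *\<^sub>C x + d *\<^sub>C x"
    and scaleC_scaleC: "c *\<^sub>C d *\<^sub>C x = (c * d) *\<^sub>C x"
    and scaleC_of_real: "complex_of_real r *\<^sub>C x = r *\<^sub>R x"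
    and norm_scaleC: "norm (c *\<^sub>C x) = cmod c * norm x"

text \<open>
  The Banach space \<open>L \<subseteq> M(\<mu>)\<close> is the type \<open>'l\<close>; \<open>rep f\<close> is a representative of the
  a.e.-equality class of \<open>f\<close>.  The four assumptions after \<open>nonempty\<close> say that
  \<open>rep\<close> induces an injective linear map from \<open>L\<close> into \<open>M(\<mu>)\<close>.
\<close>

locale banach_function_space = sigma_finite_measure M
  for M :: "'a measure" +
  fixes rep :: "'l::complex_banach \<Rightarrow> 'a \<Rightarrow> complex"
  assumes nonempty: "space M \<noteq> {}"
    and rep_measurable: "rep f \<in> borel_measurable M"
    and rep_add: "AE x in M. rep (f + g) x = rep f x + rep g x"
    and rep_scaleC: "AE x in M. rep (c *\<^sub>C f) x = c * rep f x"
    and rep_inject: "(AE x in M. rep f x = rep g x) \<Longrightarrow> f = g"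
    and solid: "\<lbrakk>u \<in> borel_measurable M; AE x in M. cmod (u x) \<le> cmod (rep f x)\<rbrakk>
      \<Longrightarrow> \<exists>h. (AE x in M. rep h x = u x) \<and> norm h \<le> norm f"
    and carrier: "\<not> (\<exists>Y\<in>sets M. emeasure M Y > 0 \<and>
      (\<forall>f. AE x in M. rep f x * indicator Y x = 0))"

definition positive_cone :: "'a measure \<Rightarrow> ('l \<Rightarrow> 'a \<Rightarrow> complex) \<Rightarrow> 'l set" where
  "positive_cone M rep = {f. AE x in M. rep f x \<in> nonneg_Reals}"

definition dual_positive_cone ::
  "'a measure \<Rightarrow> ('l::complex_banach \<Rightarrow> 'a \<Rightarrow> complex) \<Rightarrow> ('l \<Rightarrow>\<^sub>L complex) set" where
  "dual_positive_cone M rep =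
    {\<phi> :: 'l \<Rightarrow>\<^sub>L complex.
      (\<forall>c f. \<phi> (c *\<^sub>C f) = c * \<phi> f) \<and>
      (\<forall>f\<in>positive_cone M rep. \<phi> f \<in> nonneg_Reals)}"

text \<open>
  The order is the one given by the cone \<open>P\<close>: \<open>f \<le> g\<close> iff \<open>g - f \<in> P\<close>.  For
  \<open>P = dual_positive_cone M rep\<close> every lower bound \<open>g\<close> below is again complex linear,
  so the infimum is the one in the complex dual \<open>L\<^sup>*\<close>.
\<close>

definition order_continuous_norm :: "'v::real_normed_vector set \<Rightarrow> bool" where
  "order_continuous_norm P \<longleftrightarrow>
    (\<forall>f :: nat \<Rightarrow> 'v.
       (\<forall>n. f n \<in> P) \<and> (\<forall>n. f n - f (Suc n) \<in> P) \<and>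
       (\<forall>g. (\<forall>n. f n - g \<in> P) \<longrightarrow> 0 - g \<in> P)
       \<longrightarrow> (\<lambda>n. norm (f n)) \<longlonglongrightarrow> 0)"

definition positive_operator ::
  "'a measure \<Rightarrow> ('l::complex_banach \<Rightarrow> 'a \<Rightarrow> complex) \<Rightarrow> ('l \<Rightarrow>\<^sub>L 'l) \<Rightarrow> bool" where
  "positive_operator M rep A \<longleftrightarrow>
    (\<forall>c f. A (c *\<^sub>C f) = c *\<^sub>C A f) \<and> (\<forall>f\<in>positive_cone M rep. A f \<in> positive_cone M rep)"

definition has_kernel ::
  "'a measure \<Rightarrow> ('l::complex_banach \<Rightarrow> 'a \<Rightarrow> complex) \<Rightarrow> ('l \<Rightarrow>\<^sub>L 'l) \<Rightarrow>
    ('a \<times> 'a \<Rightarrow> complex) \<Rightarrow> bool" where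
  "has_kernel M rep A a \<longleftrightarrow>
    a \<in> borel_measurable (M \<Otimes>\<^sub>M M) \<and>
    (\<forall>f. AE x in M. integrable M (\<lambda>y. a (x, y) * rep f y) \<and>
                    rep (A f) x = (\<integral>y. a (x, y) * rep f y \<partial>M))"

definition positive_kernel_operator ::
  "'a measure \<Rightarrow> ('l::complex_banach \<Rightarrow> 'a \<Rightarrow> complex) \<Rightarrow> ('l \<Rightarrow>\<^sub>L 'l) \<Rightarrow> bool" where
  "positive_kernel_operator M rep A \<longleftrightarrow> positive_operator M rep A \<and> (\<exists>a. has_kernel M rep A a)"

text \<open>
  \<open>hadamard_mean M rep \<alpha>s As B\<close> says that \<open>B\<close> is the Hadamard weighted geometric mean of
  the operators \<open>As\<close> with exponents \<open>\<alpha>s\<close>.  The kernel of a positive kernel operator is a.e.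
  unique and a.e. nonnegative, so it has a version that is nonnegative everywhere; thus
  \<open>B\<close> is determined by \<open>As\<close>, and it exists because the kernel of \<open>B\<close> is dominated by
  a convex combination of the kernels of \<open>As\<close>.
\<close>

definition hadamard_mean ::
  "'a measure \<Rightarrow> ('l::complex_banach \<Rightarrow> 'a \<Rightarrow> complex) \<Rightarrow> real list \<Rightarrow>
    ('l \<Rightarrow>\<^sub>L 'l) list \<Rightarrow> ('l \<Rightarrow>\<^sub>L 'l) \<Rightarrow> bool" where
  "hadamard_mean M rep \<alpha>s As B \<longleftrightarrow>
    positive_kernel_operator M rep B \<and>
    (\<exists>a :: nat \<Rightarrow> 'a \<times> 'a \<Rightarrow> real.
       (\<forall>j<length As. has_kernel M rep (As ! j) (\<lambda>z. complex_of_real (a j z)) \<and>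
                      (\<forall>z. 0 \<le> a j z)) \<and>
       has_kernel M rep B (\<lambda>z. complex_of_real (\<Prod>j<length As. a j z powr (\<alpha>s ! j))))"

definition comp_list :: "('l::real_normed_vector \<Rightarrow>\<^sub>L 'l) list \<Rightarrow> 'l \<Rightarrow>\<^sub>L 'l" where
  "comp_list As = foldr (o\<^sub>L) As id_blinfun"

definition set_product :: "('l::real_normed_vector \<Rightarrow>\<^sub>L 'l) set list \<Rightarrow> ('l \<Rightarrow>\<^sub>L 'l) set" where
  "set_product \<Psi>s = comp_list ` listset \<Psi>s"

definition set_power :: "('l::real_normed_vector \<Rightarrow>\<^sub>L 'l) set \<Rightarrow> nat \<Rightarrow> ('l \<Rightarrow>\<^sub>L 'l) set" where
  "set_power \<Sigma> k = set_product (replicate k \<Sigma>)"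

definition hadamard_set ::
  "'a measure \<Rightarrow> ('l::complex_banach \<Rightarrow> 'a \<Rightarrow> complex) \<Rightarrow> real list \<Rightarrow>
    ('l \<Rightarrow>\<^sub>L 'l) set list \<Rightarrow> ('l \<Rightarrow>\<^sub>L 'l) set" where
  "hadamard_set M rep \<alpha>s \<Psi>s = {B. \<exists>As\<in>listset \<Psi>s. hadamard_mean M rep \<alpha>s As B}"

text \<open>
  Supremum in \<open>[0, \<infinity>)\<close>: inserting \<open>0\<close> changes nothing for nonempty sets of nonnegative
  numbers and gives \<open>sup \<emptyset> = 0\<close>.
\<close>

definition nonneg_Sup :: "real set \<Rightarrow> real" where
  "nonneg_Sup S = Sup (insert 0 S)"

definition spectrum :: "('l::complex_banach \<Rightarrow>\<^sub>L 'l) \<Rightarrow> complex set" where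
  "spectrum A = {c. \<not> (\<exists>R :: 'l \<Rightarrow>\<^sub>L 'l.
     (\<forall>f. R (c *\<^sub>C f - A f) = f) \<and> (\<forall>f. c *\<^sub>C R f - A (R f) = f))}"

definition spectral_radius :: "('l::complex_banach \<Rightarrow>\<^sub>L 'l) \<Rightarrow> real" where
  "spectral_radius A = nonneg_Sup (cmod ` spectrum A)"

definition hausdorff_mnc :: "('l::real_normed_vector \<Rightarrow>\<^sub>L 'l) \<Rightarrow> real" where
  "hausdorff_mnc A =
    Inf {\<delta>. \<delta> > 0 \<and>
      (\<exists>F. finite F \<and> A ` cball 0 1 \<subseteq> {g + \<delta> *\<^sub>R d | g d. g \<in> F \<and> d \<in> cball 0 1})}"

definition ess_spectral_radius :: "('l::real_normed_vector \<Rightarrow>\<^sub>L 'l) \<Rightarrow> real" where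
  "ess_spectral_radius A = lim (\<lambda>j. root j (hausdorff_mnc (comp_list (replicate j A))))"

definition generalized_radius :: "('l::complex_banach \<Rightarrow>\<^sub>L 'l) set \<Rightarrow> ereal" where
  "generalized_radius \<Sigma> =
    limsup (\<lambda>k. ereal (root k (nonneg_Sup (spectral_radius ` set_power \<Sigma> k))))"

definition joint_radius :: "('l::complex_banach \<Rightarrow>\<^sub>L 'l) set \<Rightarrow> ereal" where
  "joint_radius \<Sigma> = lim (\<lambda>k. ereal (root k (nonneg_Sup (norm ` set_power \<Sigma> k))))"

definition generalized_ess_radius :: "('l::complex_banach \<Rightarrow>\<^sub>L 'l) set \<Rightarrow> ereal" where
  "generalized_ess_radius \<Sigma> =
    limsup (\<lambda>k. ereal (root k (nonneg_Sup (ess_spectral_radius ` set_power \<Sigma> k))))"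

definition joint_ess_radius :: "('l::complex_banach \<Rightarrow>\<^sub>L 'l) set \<Rightarrow> ereal" where
  "joint_ess_radius \<Sigma> = lim (\<lambda>k. ereal (root k (nonneg_Sup (hausdorff_mnc ` set_power \<Sigma> k))))"

end

(*
A Hadamard mean B of operators A_1, ..., A_m satisfies, by Hoelder's inequality,
|B f| <= prod_j (A_j g_j)^(a_j) whenever |f| <= prod_j g_j^(a_j).  This pointwise estimate is stable
under composition, so a product of Hadamard means is controlled by the products C_j of the columns.
The scaled inequality of the arithmetic and geometric means turns it into
||B|| <= prod_j ||C_j||^(a_j).  In the cyclic situation of the theorem, each C_j lies in a power of
a cyclic rotation of Psi_1 ... Psi_m; rotations change norms by a bounded factor only and do not
change spectral radii, and Gelfand's formula transfers the norm estimate to spectral radii.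

For the measure of noncompactness, finite nets of the C_j give a w with ||(B p - w)^+|| at most
prod_j t_j^(a_j) for all p >= 0 in the unit ball, where t_j exceeds the measure of noncompactness of
C_j.  Order continuity of the norms of L and its dual makes min(B ((p - v)^+), w) uniformly small for a
suitable v, and a kernel operator maps the order interval [-v, v] to a totally bounded set.
*)
theory Submission
  imports Defs
begin

section \<open>Submultiplicative sequences and weighted geometric means\<close>

text \<open>The obstacle is that the column estimate concerns moduli only. For the norm this
  suffices, because the norm is monotone; but nets for the images of the C_j give no net for the
  image of B. What lies above w is small in norm, whereas what lies below w need not be compact, and
  the truncation at v deals with that part. The order of choices matters: w comes from the nets, a
  positive functional detects the functions in [0, w] of norm at least \<epsilon>, and v is chosen
  for the composition of that functional with B, hence uniformly over the unit ball. The functional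
  comes from a Hahn-Banach separation. It is available because on [0, w] the norm is small exactly
  when a weighted integral is small, and a lower bound on an integral is a convex condition. Norm
  and measure of noncompactness are both nonnegative, submultiplicative and at most the norm, so the
  passage from operators to radii of sets is made once for both. Gelfand's formula is obtained by
  averaging inverses over roots of unity, without vector-valued complex analysis.\<close>

lemma root_const_times_tendsto:
  fixes c t :: real
  assumes "c > 0" "t \<ge> 0"
  shows "(\<lambda>k. root k (c * t ^ k)) \<longlonglongrightarrow> t"
proof -
  have "(\<lambda>k. root k c * t) \<longlonglongrightarrow> 1 * t"
    by (intro tendsto_intros LIMSEQ_root_const assms)
  moreover have "\<forall>\<^sub>F k in sequentially. root k c * t = root k (c * t ^ k)"
    using eventually_gt_at_top[of 0]
    by eventually_elim (simp add: real_root_mult real_root_power_cancel assms)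
  ultimately show ?thesis
    by (auto dest: Lim_transform_eventually)
qed

text \<open>The gap between \<open>t\<close> and \<open>s\<close> absorbs the constant
  \<open>c\<close>, whose k-th roots tend to 1; bounds on powers up to a constant thus become bounds
  on radii.\<close>

lemma eventually_root_le:
  fixes a :: "nat \<Rightarrow> real"
  assumes "c > 0" "0 \<le> t" "t < s" and a: "\<forall>\<^sub>F k in sequentially. a k \<le> c * t ^ k"
  shows "\<forall>\<^sub>F k in sequentially. root k (a k) < s"
proof -
  have "\<forall>\<^sub>F k in sequentially. root k (c * t ^ k) < s"
    using order_tendstoD(2)[OF root_const_times_tendsto[OF assms(1,2)] assms(3)] .
  then show ?thesis
    using a eventually_gt_at_top[of 0]
  proof eventually_elim
    case (elim k)
    then have "root k (a k) \<le> root k (c * t ^ k)" by simp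
    then show ?case using elim by linarith
  qed
qed

lemma submultiplicative_power_le:
  fixes a :: "nat \<Rightarrow> real"
  assumes nonneg: "\<And>n. 0 \<le> a n" and sub: "\<And>m n. a (m + n) \<le> a m * a n"
  shows "a (n * q + r) \<le> a n ^ q * a r"
proof (induction q)
  case (Suc q)
  have "a (n * Suc q + r) \<le> a n * a (n * q + r)"
    using sub[of n "n * q + r"] by (simp add: algebra_simps)
  also have "\<dots> \<le> a n * (a n ^ q * a r)"
    using Suc nonneg by (intro mult_left_mono)
  finally show ?case by (simp add: algebra_simps)
qed simp

text \<open>Fekete's argument: divide k by n with remainder. The full blocks contribute powers of
  \<open>a n\<close>, the remainder only a bounded factor.\<close>

lemma submultiplicative_eventually_root_less:
  fixes a :: "nat \<Rightarrow> real"
  assumes nonneg: "\<And>n. 0 \<le> a n" and sub: "\<And>m n. a (m + n) \<le> a m * a n"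
    and n: "n > 0" and s: "root n (a n) < s"
  shows "\<forall>\<^sub>F k in sequentially. root k (a k) < s"
proof -
  have "0 \<le> root n (a n)" using nonneg n by (simp add: real_root_ge_zero)
  then obtain t where t: "root n (a n) < t" "t < s" "0 < t"
    using s dense[of "root n (a n)" s] by auto
  have ant: "a n \<le> t ^ n"
  proof -
    have "root n (a n) ^ n \<le> t ^ n" using t \<open>0 \<le> root n (a n)\<close> by (intro power_mono) auto
    then show ?thesis using n nonneg by simp
  qed
  \<comment> \<open>The sum dominates each of the finitely many remainder quotients; the summand 1
    makes \<open>c\<close> positive.\<close>
  define c where "c = 1 + (\<Sum>r<n. a r / t ^ r)"
  have c: "c > 0" unfolding c_def using nonneg t by (intro add_pos_nonneg sum_nonneg) auto
  have "a k \<le> c * t ^ k" for k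
  proof -
    define q r where "q = k div n" and "r = k mod n"
    have k: "k = n * q + r" and r: "r < n" using n by (auto simp: q_def r_def)
    have "a k \<le> a n ^ q * a r" unfolding k using nonneg sub by (rule submultiplicative_power_le[of a])
    also have "\<dots> \<le> (t ^ n) ^ q * a r"
      using ant nonneg by (intro mult_right_mono power_mono) auto
    also have "\<dots> = t ^ k * (a r / t ^ r)"
      unfolding k using t by (simp add: power_add power_mult)
    also have "\<dots> \<le> t ^ k * c"
    proof (rule mult_left_mono)
      have "a r / t ^ r \<le> (\<Sum>r<n. a r / t ^ r)"
        using r nonneg t by (intro member_le_sum) auto
      then show "a r / t ^ r \<le> c" by (simp add: c_def)
    qed (use t in auto)
    finally show ?thesis by (simp add: mult.commute)
  qed
  then show ?thesis
    using eventually_root_le[of c t s a] c t by simp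
qed

text \<open>The limit is the infimum of the roots with positive index, so it bounds each of them
  from below. Index 0 is left out because \<open>root 0\<close> is constantly 0.\<close>

lemma submultiplicative_root_convergent:
  fixes a :: "nat \<Rightarrow> real"
  assumes nonneg: "\<And>n. 0 \<le> a n" and sub: "\<And>m n. a (m + n) \<le> a m * a n"
  obtains l where "(\<lambda>n. root n (a n)) \<longlonglongrightarrow> l" "0 \<le> l" "\<And>n. n > 0 \<Longrightarrow> l \<le> root n (a n)"
proof -
  define X where "X = (\<lambda>n. root n (a n)) ` {0<..}"
  have X: "X \<noteq> {}" "bdd_below X"
    unfolding X_def using nonneg by (auto intro!: bdd_belowI[of _ 0] simp: real_root_ge_zero)
  have lower: "Inf X \<le> root n (a n)" if "n > 0" for n
    using that X by (intro cInf_lower) (auto simp: X_def)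
  have pos: "0 \<le> Inf X"
    using X nonneg by (intro cInf_greatest) (auto simp: X_def real_root_ge_zero)
  have "(\<lambda>n. root n (a n)) \<longlonglongrightarrow> Inf X"
  proof (rule order_tendstoI)
    fix s assume s: "s < Inf X"
    show "\<forall>\<^sub>F n in sequentially. s < root n (a n)"
      using eventually_gt_at_top[of 0]
    proof eventually_elim
      case (elim n)
      then show ?case using lower[of n] s by linarith
    qed
  next
    fix s assume "Inf X < s"
    then obtain n where "n > 0" "root n (a n) < s"
      using cInf_lessD[OF X(1)] by (auto simp: X_def)
    with nonneg sub show "\<forall>\<^sub>F n in sequentially. root n (a n) < s"
      by (rule submultiplicative_eventually_root_less[of a])
  qed
  then show ?thesis using that pos lower by blast
qed

section \<open>Weighted means of nonnegative numbers\<close>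

lemma powr_le_exp_weighted:
  fixes y :: real
  assumes "y \<ge> 0" "c > 0"
  shows "y powr c \<le> exp (c * (y - 1))"
proof (cases "y = 0")
  case False
  then have "y > 0" using assms by simp
  then have "c * ln y \<le> c * (y - 1)" using assms ln_le_minus_one[of y] by (intro mult_left_mono) auto
  then show ?thesis using \<open>y > 0\<close> by (simp add: powr_def)
qed (use assms in simp)

text \<open>Dividing by the arithmetic mean \<open>s\<close> reduces to mean 1, where the exponents
  \<open>\<alpha> j * (x j / s - 1)\<close> of the exponential bounds add up to 0.\<close>

lemma weighted_geometric_le_arithmetic:
  fixes x \<alpha> :: "'i \<Rightarrow> real"
  assumes fin: "finite J" and \<alpha>: "\<And>j. j \<in> J \<Longrightarrow> \<alpha> j > 0" and sum: "(\<Sum>j\<in>J. \<alpha> j) = 1"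
    and x: "\<And>j. j \<in> J \<Longrightarrow> 0 \<le> x j"
  shows "(\<Prod>j\<in>J. x j powr \<alpha> j) \<le> (\<Sum>j\<in>J. \<alpha> j * x j)"
proof -
  define s where "s = (\<Sum>j\<in>J. \<alpha> j * x j)"
  have \<alpha>0: "0 \<le> \<alpha> j" if "j \<in> J" for j using \<alpha>[OF that] by simp
  have s0: "s \<ge> 0" unfolding s_def using \<alpha>0 x by (intro sum_nonneg) simp
  show ?thesis
  proof (cases "s = 0")
    case True
    have "\<forall>j\<in>J. \<alpha> j * x j = 0"
      using True sum_nonneg_eq_0_iff[OF fin, of "\<lambda>j. \<alpha> j * x j"] \<alpha>0 x
      unfolding s_def by simp
    then have "\<forall>j\<in>J. x j = 0" using \<alpha> by force
    moreover have "J \<noteq> {}" using sum by auto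
    ultimately have "(\<Prod>j\<in>J. x j powr \<alpha> j) = 0" using fin by auto
    then show ?thesis using s0 s_def by simp
  next
    case False
    then have s: "s > 0" using s0 by simp
    have "(\<Prod>j\<in>J. (x j / s) powr \<alpha> j) \<le> (\<Prod>j\<in>J. exp (\<alpha> j * (x j / s - 1)))"
      using \<alpha> x s by (intro prod_mono conjI powr_le_exp_weighted) auto
    also have "\<dots> = exp (\<Sum>j\<in>J. \<alpha> j * (x j / s - 1))" using fin by (simp add: exp_sum)
    also have "(\<Sum>j\<in>J. \<alpha> j * (x j / s - 1)) = (\<Sum>j\<in>J. \<alpha> j * x j) / s - (\<Sum>j\<in>J. \<alpha> j)"
      by (simp add: sum_subtractf algebra_simps sum_divide_distrib)
    also have "\<dots> = 0" using s sum by (simp add: s_def)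
    finally have "(\<Prod>j\<in>J. (x j / s) powr \<alpha> j) \<le> 1" by simp
    moreover have "(\<Prod>j\<in>J. (x j / s) powr \<alpha> j) = (\<Prod>j\<in>J. x j powr \<alpha> j) / (\<Prod>j\<in>J. s powr \<alpha> j)"
      using x s by (simp add: powr_divide prod_dividef)
    moreover have "(\<Prod>j\<in>J. s powr \<alpha> j) = s"
      using s sum powr_sum[of s \<alpha> J] fin by simp
    ultimately show ?thesis using s by (simp add: s_def)
  qed
qed

text \<open>The free scales \<open>t j\<close> matter: the right-hand side is linear in
  \<open>x\<close>, hence compatible with norms and integrals, and nothing is lost when all
  quotients \<open>x j / t j\<close> coincide. Scales close to the size of the \<open>x j\<close>
  turn it into a Hoelder inequality.\<close>

lemma weighted_geometric_le_scaled_arithmetic: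
  fixes x t \<alpha> :: "'i \<Rightarrow> real"
  assumes fin: "finite J" and \<alpha>: "\<And>j. j \<in> J \<Longrightarrow> \<alpha> j > 0" and sum: "(\<Sum>j\<in>J. \<alpha> j) = 1"
    and x: "\<And>j. j \<in> J \<Longrightarrow> 0 \<le> x j" and t: "\<And>j. j \<in> J \<Longrightarrow> 0 < t j"
  shows "(\<Prod>j\<in>J. x j powr \<alpha> j) \<le> (\<Prod>j\<in>J. t j powr \<alpha> j) * (\<Sum>j\<in>J. \<alpha> j * (x j / t j))"
proof -
  have "(\<Prod>j\<in>J. x j powr \<alpha> j) = (\<Prod>j\<in>J. t j powr \<alpha> j * (x j / t j) powr \<alpha> j)"
  proof (intro prod.cong refl)
    fix j assume "j \<in> J"
    then show "x j powr \<alpha> j = t j powr \<alpha> j * (x j / t j) powr \<alpha> j"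
      using x[of j] t[of j] by (simp add: powr_divide)
  qed
  also have "\<dots> = (\<Prod>j\<in>J. t j powr \<alpha> j) * (\<Prod>j\<in>J. (x j / t j) powr \<alpha> j)"
    by (rule prod.distrib)
  also have "\<dots> \<le> (\<Prod>j\<in>J. t j powr \<alpha> j) * (\<Sum>j\<in>J. \<alpha> j * (x j / t j))"
  proof (intro mult_left_mono weighted_geometric_le_arithmetic fin \<alpha> sum prod_nonneg)
    show "0 \<le> x j / t j" if "j \<in> J" for j using x[OF that] t[OF that] by simp
  qed auto
  finally show ?thesis .
qed

text \<open>Scaling divides by \<open>t j\<close>, so a vanishing \<open>x j\<close> cannot be its
  own scale. Estimates are therefore proved for all strictly larger scales, and
  \<open>x j + e\<close> with e decreasing to 0 yields the sharp bound; positive exponents make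
  \<open>powr\<close> continuous at 0.\<close>

lemma le_weighted_geometric_limit:
  fixes x \<alpha> :: "'i \<Rightarrow> real"
  assumes fin: "finite J" and \<alpha>: "\<And>j. j \<in> J \<Longrightarrow> \<alpha> j > 0" and x: "\<And>j. j \<in> J \<Longrightarrow> 0 \<le> x j"
    and le: "\<And>t. (\<And>j. j \<in> J \<Longrightarrow> x j < t j) \<Longrightarrow> y \<le> (\<Prod>j\<in>J. t j powr \<alpha> j)"
  shows "y \<le> (\<Prod>j\<in>J. x j powr \<alpha> j)"
proof (rule tendsto_lowerbound)
  show "((\<lambda>e. \<Prod>j\<in>J. (x j + e) powr \<alpha> j) \<longlongrightarrow> (\<Prod>j\<in>J. x j powr \<alpha> j)) (at_right 0)"
  proof (rule tendsto_prod)
    fix j assume j: "j \<in> J"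
    have "((\<lambda>e. x j + e) \<longlongrightarrow> x j + 0) (at_right 0)" by (intro tendsto_intros)
    moreover have "\<forall>\<^sub>F e in at_right 0. 0 \<le> x j + e"
      using x[OF j] by (auto simp: eventually_at_right_field intro: exI[of _ 1])
    ultimately show "((\<lambda>e. (x j + e) powr \<alpha> j) \<longlongrightarrow> x j powr \<alpha> j) (at_right 0)"
      using \<alpha>[OF j] by (intro tendsto_powr') auto
  qed
  show "\<forall>\<^sub>F e in at_right 0. y \<le> (\<Prod>j\<in>J. (x j + e) powr \<alpha> j)"
    unfolding eventually_at_right_field by (intro exI[of _ 1]) (auto intro!: le)
qed simp

section \<open>Radii of sets of operators for a submultiplicative functional\<close>

lemma blinfun_compose_assoc: "(A o\<^sub>L B) o\<^sub>L C = A o\<^sub>L (B o\<^sub>L C)"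
  by (rule blinfun_eqI) simp

lemma blinfun_compose_id [simp]: "id_blinfun o\<^sub>L A = A" "A o\<^sub>L id_blinfun = A"
  by (rule blinfun_eqI, simp)+

lemma comp_list_simps [simp]:
  "comp_list [] = id_blinfun" "comp_list (A # As) = A o\<^sub>L comp_list As"
  by (simp_all add: comp_list_def)

lemma comp_list_append [simp]: "comp_list (As @ Bs) = comp_list As o\<^sub>L comp_list Bs"
  by (induction As) (simp_all add: blinfun_compose_assoc)

abbreviation blinfun_pow :: "('l::real_normed_vector \<Rightarrow>\<^sub>L 'l) \<Rightarrow> nat \<Rightarrow> 'l \<Rightarrow>\<^sub>L 'l" where
  "blinfun_pow A n \<equiv> comp_list (replicate n A)"

lemma blinfun_pow_Suc2: "blinfun_pow A (Suc n) = blinfun_pow A n o\<^sub>L A"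
  by (simp flip: replicate_append_same del: replicate_Suc add: replicate_Suc)

text \<open>The brackets in (AB)(AB)...(AB) are shifted by one factor; this is the source of the
  invariance of radii under cyclic rotation.\<close>

lemma blinfun_pow_compose_Suc:
  "blinfun_pow (A o\<^sub>L B) (Suc n) = A o\<^sub>L (blinfun_pow (B o\<^sub>L A) n o\<^sub>L B)"
proof (induction n)
  case (Suc n)
  have "blinfun_pow (A o\<^sub>L B) (Suc (Suc n)) = (A o\<^sub>L B) o\<^sub>L blinfun_pow (A o\<^sub>L B) (Suc n)"
    by simp
  also have "\<dots> = A o\<^sub>L (blinfun_pow (B o\<^sub>L A) (Suc n) o\<^sub>L B)"
    unfolding Suc by (simp add: blinfun_compose_assoc)
  finally show ?case .
qed simp

lemma listset_append: "listset (Xs @ Ys) = {xs @ ys |xs ys. xs \<in> listset Xs \<and> ys \<in> listset Ys}"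
proof (induction Xs)
  case (Cons X Xs)
  show ?case unfolding append_Cons listset.simps set_Cons_def Cons by (auto simp: Cons_eq_append_conv) (blast | metis append_Cons)+
qed simp

lemma listset_conv: "xs \<in> listset Xs \<longleftrightarrow> length xs = length Xs \<and> (\<forall>i<length Xs. xs ! i \<in> Xs ! i)"
proof (induction Xs arbitrary: xs)
  case (Cons X Xs)
  show ?case
    by (cases xs) (auto simp: set_Cons_def Cons nth_Cons split: nat.splits)
qed auto

lemma set_product_Nil [simp]: "set_product [] = {id_blinfun}"
  by (simp add: set_product_def)

lemma set_product_append:
  "set_product (Xs @ Ys) = {A o\<^sub>L B |A B. A \<in> set_product Xs \<and> B \<in> set_product Ys}"
  unfolding set_product_def listset_append by (auto simp: image_iff) (metis comp_list_append)+

lemma set_product_single [simp]: "set_product [X] = X"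
  by (force simp: set_product_def set_Cons_def image_iff)

lemma set_product_Cons:
  "set_product (X # Xs) = {A o\<^sub>L B |A B. A \<in> X \<and> B \<in> set_product Xs}"
  using set_product_append[of "[X]" Xs] by simp

lemma set_power_0 [simp]: "set_power \<Sigma> 0 = {id_blinfun}"
  by (simp add: set_power_def)

lemma set_power_add:
  "set_power \<Sigma> (m + n) = {A o\<^sub>L B |A B. A \<in> set_power \<Sigma> m \<and> B \<in> set_power \<Sigma> n}"
  by (simp add: set_power_def replicate_add set_product_append)

lemma set_power_Suc:
  "set_power \<Sigma> (Suc n) = {A o\<^sub>L B |A B. A \<in> \<Sigma> \<and> B \<in> set_power \<Sigma> n}"
  by (simp add: set_power_def set_product_Cons)

lemma set_power_Suc2:
  "set_power \<Sigma> (Suc n) = {A o\<^sub>L B |A B. A \<in> set_power \<Sigma> n \<and> B \<in> \<Sigma>}"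
  using set_power_add[of \<Sigma> n 1] by (simp add: set_power_def)

lemma set_product_appendI:
  "A \<in> set_product Xs \<Longrightarrow> B \<in> set_product Ys \<Longrightarrow> A o\<^sub>L B \<in> set_product (Xs @ Ys)"
  by (auto simp: set_product_append)

lemma set_power_SucI:
  "A \<in> \<Sigma> \<Longrightarrow> B \<in> set_power \<Sigma> n \<Longrightarrow> A o\<^sub>L B \<in> set_power \<Sigma> (Suc n)"
  by (auto simp: set_power_Suc)

lemma set_power_SucI2:
  "A \<in> set_power \<Sigma> n \<Longrightarrow> B \<in> \<Sigma> \<Longrightarrow> A o\<^sub>L B \<in> set_power \<Sigma> (Suc n)"
  by (auto simp: set_power_Suc2)

text \<open>Shift the brackets: (Q0 P0)(Q1 P1)...(Qk Pk) = Q0 ((P0 Q1)...(P(k-1) Qk)) Pk. The inner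
  word serves norm estimates, at the price of the two ends; moving Q0 to the right end gives a full
  power of the rotated product, which serves spectral radii.\<close>

lemma set_power_rotate:
  assumes "C \<in> set_power (set_product (Xs @ Ys)) (Suc k)"
  obtains Q P X where "Q \<in> set_product Xs" "P \<in> set_product Ys"
    "X \<in> set_power (set_product (Ys @ Xs)) k" "C = Q o\<^sub>L (X o\<^sub>L P)"
    "(X o\<^sub>L P) o\<^sub>L Q \<in> set_power (set_product (Ys @ Xs)) (Suc k)"
proof -
  have "\<exists>Q P X. Q \<in> set_product Xs \<and> P \<in> set_product Ys \<and>
      X \<in> set_power (set_product (Ys @ Xs)) k \<and> C = Q o\<^sub>L (X o\<^sub>L P)"
    using assms
  proof (induction k arbitrary: C)
    case 0
    then obtain Q P where "Q \<in> set_product Xs" "P \<in> set_product Ys" "C = Q o\<^sub>L P"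
      by (auto simp: set_power_Suc set_product_append)
    then show ?case by (intro exI[of _ Q] exI[of _ P] exI[of _ id_blinfun]) simp
  next
    case (Suc k)
    obtain Q1 P1 C' where C: "Q1 \<in> set_product Xs" "P1 \<in> set_product Ys"
      "C' \<in> set_power (set_product (Xs @ Ys)) (Suc k)" "C = Q1 o\<^sub>L P1 o\<^sub>L C'"
      using Suc.prems unfolding set_power_Suc[of _ "Suc k"] set_product_append by blast
    obtain Q P X where IH: "Q \<in> set_product Xs" "P \<in> set_product Ys"
      "X \<in> set_power (set_product (Ys @ Xs)) k" "C' = Q o\<^sub>L (X o\<^sub>L P)"
      using Suc.IH[OF C(3)] by blast
    have "(P1 o\<^sub>L Q) o\<^sub>L X \<in> set_power (set_product (Ys @ Xs)) (Suc k)"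
      using C IH by (intro set_power_SucI set_product_appendI)
    moreover have "C = Q1 o\<^sub>L (((P1 o\<^sub>L Q) o\<^sub>L X) o\<^sub>L P)"
      using C IH by (simp add: blinfun_compose_assoc)
    ultimately show ?case using C(1) IH(2) by blast
  qed
  then obtain Q P X where QPX: "Q \<in> set_product Xs" "P \<in> set_product Ys"
      "X \<in> set_power (set_product (Ys @ Xs)) k" "C = Q o\<^sub>L (X o\<^sub>L P)"
    by blast
  then have "X o\<^sub>L (P o\<^sub>L Q) \<in> set_power (set_product (Ys @ Xs)) (Suc k)"
    by (intro set_power_SucI2 set_product_appendI)
  then show ?thesis using that QPX by (simp add: blinfun_compose_assoc)
qed

lemma norm_set_product_le:
  assumes "\<And>X A. X \<in> set Xs \<Longrightarrow> A \<in> X \<Longrightarrow> norm A \<le> K" "K \<ge> 0" "A \<in> set_product Xs"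
  shows "norm A \<le> K ^ length Xs"
  using assms
proof (induction Xs arbitrary: A)
  case Nil
  then show ?case by (simp add: norm_blinfun_id_le)
next
  case (Cons X Xs)
  then obtain A1 A2 where A: "A1 \<in> X" "A2 \<in> set_product Xs" "A = A1 o\<^sub>L A2"
    by (auto simp: set_product_Cons)
  have "norm A \<le> norm A1 * norm A2" unfolding A by (rule norm_blinfun_compose)
  also have "\<dots> \<le> K * K ^ length Xs"
    using Cons A by (intro mult_mono Cons.IH) auto
  finally show ?case by simp
qed

section \<open>Suprema, weighted products and roots of nonnegative reals\<close>

lemma nonneg_Sup_nonneg: "bdd_above S \<Longrightarrow> 0 \<le> nonneg_Sup S"
  unfolding nonneg_Sup_def by (intro cSup_upper) auto

lemma nonneg_Sup_upper: "bdd_above S \<Longrightarrow> x \<in> S \<Longrightarrow> x \<le> nonneg_Sup S"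
  unfolding nonneg_Sup_def by (intro cSup_upper) auto

lemma nonneg_Sup_least: "(\<And>x. x \<in> S \<Longrightarrow> x \<le> c) \<Longrightarrow> 0 \<le> c \<Longrightarrow> nonneg_Sup S \<le> c"
  unfolding nonneg_Sup_def by (intro cSup_least) auto

lemma prod_powr_const:
  fixes x :: real and \<alpha> :: "'i \<Rightarrow> real"
  assumes "finite J" "(\<Sum>j\<in>J. \<alpha> j) = 1" "x \<ge> 0"
  shows "(\<Prod>j\<in>J. x powr \<alpha> j) = x"
proof (cases "x = 0")
  case True
  moreover have "J \<noteq> {}" using assms by auto
  ultimately show ?thesis using assms by (simp add: card_gt_0_iff)
next
  case False
  then show ?thesis using powr_sum[of x \<alpha> J] assms by simp
qed

lemma prod_powr_le_const:
  fixes x :: "'i \<Rightarrow> real" and \<alpha> :: "'i \<Rightarrow> real"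
  assumes "finite J" "\<And>j. j \<in> J \<Longrightarrow> \<alpha> j > 0" "(\<Sum>j\<in>J. \<alpha> j) = 1"
    and "\<And>j. j \<in> J \<Longrightarrow> 0 \<le> x j" "\<And>j. j \<in> J \<Longrightarrow> x j \<le> c"
  shows "(\<Prod>j\<in>J. x j powr \<alpha> j) \<le> c"
proof -
  have "J \<noteq> {}" using assms(3) by auto
  then have c: "c \<ge> 0" using assms(4,5) by (meson all_not_in_conv order_trans)
  have "(\<Prod>j\<in>J. x j powr \<alpha> j) \<le> (\<Prod>j\<in>J. c powr \<alpha> j)"
  proof (intro prod_mono conjI powr_mono2)
    show "0 \<le> \<alpha> j" if "j \<in> J" for j using assms(2)[OF that] by simp
  qed (use assms(4,5) in auto)
  then show ?thesis using prod_powr_const[of J \<alpha> c] assms(1,3) c by simp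
qed

lemma root_powr_commute:
  assumes "n > 0" "x \<ge> 0"
  shows "root n (x powr a) = root n x powr a"
proof (cases "x = 0")
  case False
  then show ?thesis using assms by (simp add: root_powr_inverse powr_powr mult.commute)
qed (use assms in simp)

lemma real_root_prod:
  fixes f :: "'i \<Rightarrow> real"
  assumes "n > 0"
  shows "root n (\<Prod>j\<in>J. f j) = (\<Prod>j\<in>J. root n (f j))"
  using assms by (induction J rule: infinite_finite_induct) (simp_all add: real_root_mult)

text \<open>For \<open>N\<close> the norm this is the spectral radius of a complex linear operator,
  by Gelfand's formula; for the measure of noncompactness it is the essential spectral radius by
  definition.\<close>

definition limit_radius :: "(('l::real_normed_vector \<Rightarrow>\<^sub>L 'l) \<Rightarrow> real) \<Rightarrow> ('l \<Rightarrow>\<^sub>L 'l) \<Rightarrow> real" where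
  "limit_radius N A = lim (\<lambda>n. root n (N (blinfun_pow A n)))"

text \<open>The common ground of the operator norm and the Hausdorff measure of noncompactness. The
  comparison with the norm bounds the factors left over at the ends when a product is
  rotated.\<close>

locale submultiplicative_functional =
  fixes N :: "('l::real_normed_vector \<Rightarrow>\<^sub>L 'l) \<Rightarrow> real"
  assumes nonneg: "0 \<le> N A"
    and compose: "N (A o\<^sub>L B) \<le> N A * N B"
    and le_norm: "N A \<le> norm A"
begin

lemma compose3: "N (A o\<^sub>L (B o\<^sub>L C)) \<le> norm A * N B * norm C"
proof -
  have "N (A o\<^sub>L (B o\<^sub>L C)) \<le> N A * (N B * N C)"
    using compose[of A "B o\<^sub>L C"] compose[of B C] nonneg[of A]
    by (meson mult_left_mono order_trans)
  also have "\<dots> \<le> norm A * (N B * norm C)"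
    by (intro mult_mono le_norm nonneg mult_nonneg_nonneg norm_ge_zero order_refl)
  finally show ?thesis by (simp add: mult.assoc)
qed

lemma limit_radius:
  shows limit_radius_tendsto: "(\<lambda>n. root n (N (blinfun_pow A n))) \<longlonglongrightarrow> limit_radius N A"
    and limit_radius_nonneg: "0 \<le> limit_radius N A"
    and limit_radius_le: "limit_radius N A \<le> N A"
proof -
  have sub: "N (blinfun_pow A (m + n)) \<le> N (blinfun_pow A m) * N (blinfun_pow A n)" for m n
    by (simp add: replicate_add compose)
  obtain l where l: "(\<lambda>n. root n (N (blinfun_pow A n))) \<longlonglongrightarrow> l" "0 \<le> l"
      "\<And>n. n > 0 \<Longrightarrow> l \<le> root n (N (blinfun_pow A n))"
    using submultiplicative_root_convergent[of "\<lambda>n. N (blinfun_pow A n)"] nonneg sub by metis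
  have [simp]: "limit_radius N A = l" unfolding limit_radius_def using l(1) by (rule limI)
  show "(\<lambda>n. root n (N (blinfun_pow A n))) \<longlonglongrightarrow> limit_radius N A" "0 \<le> limit_radius N A"
    using l by simp_all
  show "limit_radius N A \<le> N A" using l(3)[of 1] by simp
qed

lemma eventually_less_power:
  assumes "limit_radius N A < t"
  shows "\<forall>\<^sub>F n in sequentially. N (blinfun_pow A n) < t ^ n"
  using order_tendstoD(2)[OF limit_radius_tendsto assms] eventually_gt_at_top[of 0]
proof eventually_elim
  case (elim n)
  then have "root n (N (blinfun_pow A n)) ^ n < t ^ n"
    using nonneg by (intro power_strict_mono) auto
  then show ?case using elim nonneg by simp
qed

text \<open>By the shifted brackets, (AB)^(n+1) costs only the fixed factors \<open>norm A\<close>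
  and \<open>norm B\<close> compared with (BA)^n, and roots forget them.\<close>

lemma limit_radius_commute: "limit_radius N (A o\<^sub>L B) \<le> limit_radius N (B o\<^sub>L A)"
proof (rule dense_ge)
  fix s assume "limit_radius N (B o\<^sub>L A) < s"
  then obtain t where t: "limit_radius N (B o\<^sub>L A) < t" "t < s" using dense by blast
  then have t0: "t > 0" using limit_radius_nonneg[of "B o\<^sub>L A"] by linarith
  \<comment> \<open>The division by \<open>t\<close> compensates for comparing the power n + 1 with
    \<open>t ^ n\<close>; the added 1 keeps \<open>c\<close> positive even for zero
    operators.\<close>
  define c where "c = (norm A * norm B + 1) / t"
  have c: "c > 0" using t0 by (simp add: c_def add_nonneg_pos)
  have "\<forall>\<^sub>F n in sequentially. N (blinfun_pow (A o\<^sub>L B) (Suc n)) \<le> c * t ^ Suc n"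
    using eventually_less_power[OF t(1)]
  proof eventually_elim
    case (elim n)
    have "N (blinfun_pow (A o\<^sub>L B) (Suc n)) \<le> norm A * N (blinfun_pow (B o\<^sub>L A) n) * norm B"
      unfolding blinfun_pow_compose_Suc by (rule compose3)
    also have "\<dots> \<le> norm A * t ^ n * norm B"
      using elim by (intro mult_right_mono mult_left_mono) auto
    also have "\<dots> \<le> c * t ^ Suc n"
      using t0 by (simp add: c_def algebra_simps add_divide_distrib)
    finally show ?case .
  qed
  then have "\<forall>\<^sub>F n in sequentially. N (blinfun_pow (A o\<^sub>L B) n) \<le> c * t ^ n"
    by (rule iffD1[OF eventually_sequentially_Suc[of "\<lambda>n. N (blinfun_pow (A o\<^sub>L B) n) \<le> c * t ^ n"]])
  then have "\<forall>\<^sub>F n in sequentially. root n (N (blinfun_pow (A o\<^sub>L B) n)) < s"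
    using eventually_root_le[of c t s] c t0 t(2) by simp
  then have "\<forall>\<^sub>F n in sequentially. root n (N (blinfun_pow (A o\<^sub>L B) n)) \<le> s"
    by eventually_elim simp
  then show "limit_radius N (A o\<^sub>L B) \<le> s"
    by (intro tendsto_upperbound[OF limit_radius_tendsto]) auto
qed

lemma set_power_le:
  assumes "\<And>A. A \<in> \<Sigma> \<Longrightarrow> N A \<le> K" "K \<ge> 0" "A \<in> set_power \<Sigma> k"
  shows "N A \<le> K ^ k"
  using assms(3)
proof (induction k arbitrary: A)
  case 0
  then show ?case using le_norm[of id_blinfun] norm_blinfun_id_le by (auto intro: order_trans)
next
  case (Suc k)
  then obtain A1 A2 where A: "A1 \<in> \<Sigma>" "A2 \<in> set_power \<Sigma> k" "A = A1 o\<^sub>L A2"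
    by (auto simp: set_power_Suc)
  have "N A \<le> N A1 * N A2" unfolding A by (rule compose)
  also have "\<dots> \<le> K * K ^ k" using assms(1,2) A Suc nonneg by (intro mult_mono) auto
  finally show ?case by simp
qed

lemma bdd_above_set_power:
  assumes "bdd_above (N ` \<Sigma>)"
  shows "bdd_above (N ` set_power \<Sigma> k)"
proof -
  obtain K where K: "\<And>A. A \<in> \<Sigma> \<Longrightarrow> N A \<le> K" using assms by (auto simp: bdd_above_def)
  then have "N A \<le> max K 0 ^ k" if "A \<in> set_power \<Sigma> k" for A
    using set_power_le[of \<Sigma> "max K 0" A k] that by (auto simp: le_max_iff_disj)
  then show ?thesis by (rule bdd_aboveI2)
qed

text \<open>Fekete's lemma for the suprema. Convergence has to be known before anything can be said
  about \<open>lim\<close>, which is an unspecified value for a divergent sequence.\<close>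

lemma joint_limit:
  assumes bdd: "bdd_above (N ` \<Sigma>)"
  obtains l where "(\<lambda>k. root k (nonneg_Sup (N ` set_power \<Sigma> k))) \<longlonglongrightarrow> l" "0 \<le> l"
    "lim (\<lambda>k. ereal (root k (nonneg_Sup (N ` set_power \<Sigma> k)))) = ereal l"
proof -
  let ?a = "\<lambda>k. nonneg_Sup (N ` set_power \<Sigma> k)"
  note B = bdd_above_set_power[OF bdd]
  have pos: "0 \<le> ?a k" for k by (rule nonneg_Sup_nonneg[OF B])
  have sub: "?a (m + n) \<le> ?a m * ?a n" for m n
  proof (rule nonneg_Sup_least)
    fix x assume "x \<in> N ` set_power \<Sigma> (m + n)"
    then obtain A B where AB: "A \<in> set_power \<Sigma> m" "B \<in> set_power \<Sigma> n" "x = N (A o\<^sub>L B)"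
      by (auto simp: set_power_add)
    have "x \<le> N A * N B" unfolding AB by (rule compose)
    also have "\<dots> \<le> ?a m * ?a n"
      using AB by (intro mult_mono nonneg_Sup_upper B pos nonneg) auto
    finally show "x \<le> ?a m * ?a n" .
  qed (use pos in simp)
  obtain l where l: "(\<lambda>k. root k (?a k)) \<longlonglongrightarrow> l" "0 \<le> l"
    using submultiplicative_root_convergent[of ?a] pos sub by metis
  moreover have "lim (\<lambda>k. ereal (root k (?a k))) = ereal l"
    using l(1) by (intro limI) simp
  ultimately show ?thesis using that by blast
qed


text \<open>The bound is asked for positive powers, because the relation between \<open>B\<close>
  and the \<open>C j\<close> that is used for noncompactness need not hold for the identity; the
  limit does not see the power 0.\<close>

lemma limit_radius_geometric_mean_le:
  fixes \<alpha> :: "'i \<Rightarrow> real"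
  assumes fin: "finite J" and \<alpha>: "\<And>j. j \<in> J \<Longrightarrow> \<alpha> j > 0"
    and le: "\<And>n. N (blinfun_pow B (Suc n)) \<le> (\<Prod>j\<in>J. N (blinfun_pow (C j) (Suc n)) powr \<alpha> j)"
  shows "limit_radius N B \<le> (\<Prod>j\<in>J. limit_radius N (C j) powr \<alpha> j)"
proof (rule tendsto_le[OF trivial_limit_sequentially _ limit_radius_tendsto])
  show "(\<lambda>n. \<Prod>j\<in>J. root n (N (blinfun_pow (C j) n)) powr \<alpha> j)
      \<longlonglongrightarrow> (\<Prod>j\<in>J. limit_radius N (C j) powr \<alpha> j)"
  proof (rule tendsto_prod)
    fix j assume j: "j \<in> J"
    have "\<forall>\<^sub>F n in sequentially. 0 \<le> root n (N (blinfun_pow (C j) n))"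
      using nonneg by (auto intro!: always_eventually real_root_ge_zero)
    then show "(\<lambda>n. root n (N (blinfun_pow (C j) n)) powr \<alpha> j)
        \<longlonglongrightarrow> limit_radius N (C j) powr \<alpha> j"
      using \<alpha>[OF j] by (intro tendsto_powr' limit_radius_tendsto tendsto_const) auto
  qed
  show "\<forall>\<^sub>F n in sequentially. root n (N (blinfun_pow B n))
      \<le> (\<Prod>j\<in>J. root n (N (blinfun_pow (C j) n)) powr \<alpha> j)"
    using eventually_gt_at_top[of 0]
  proof eventually_elim
    case (elim n)
    then obtain n' where n: "n = Suc n'" using gr0_implies_Suc by blast
    have "root n (N (blinfun_pow B n)) \<le> root n (\<Prod>j\<in>J. N (blinfun_pow (C j) n) powr \<alpha> j)"
      using le[of n'] elim unfolding n by (intro real_root_le_mono)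
    also have "\<dots> = (\<Prod>j\<in>J. root n (N (blinfun_pow (C j) n)) powr \<alpha> j)"
      using elim nonneg by (simp add: real_root_prod root_powr_commute)
    finally show ?case .
  qed
qed

text \<open>The relation \<open>D\<close> stands for any certificate, stable under composition, that
  the \<open>C j\<close> control \<open>B\<close>. The index list in the last assumption is the
  rotation of 1, ..., m that starts at j + 1, so powers of \<open>S\<close> are controlled by powers
  of rotated products. Rotating back to \<open>\<Phi>\<close> is exact for
  \<open>limit_radius\<close> and costs a constant factor for \<open>N\<close>.\<close>

lemma radius_product_comparison:
  fixes m :: nat and \<Psi> :: "nat \<Rightarrow> ('l \<Rightarrow>\<^sub>L 'l) set" and \<alpha> :: "nat \<Rightarrow> real"
    and S :: "('l \<Rightarrow>\<^sub>L 'l) set" and D :: "(nat \<Rightarrow> 'l \<Rightarrow>\<^sub>L 'l) \<Rightarrow> ('l \<Rightarrow>\<^sub>L 'l) \<Rightarrow> bool"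
  assumes bounded: "\<And>j. j \<in> {1..m} \<Longrightarrow> bounded (\<Psi> j)"
    and \<alpha>: "\<And>j. j < m \<Longrightarrow> \<alpha> j > 0" and sum: "(\<Sum>j<m. \<alpha> j) = 1"
    and D_compose: "\<And>B B' C C'. D C B \<Longrightarrow> D C' B' \<Longrightarrow> D (\<lambda>j. C j o\<^sub>L C' j) (B o\<^sub>L B')"
    and D_le: "\<And>B C. D C B \<Longrightarrow> N B \<le> (\<Prod>j<m. N (C j) powr \<alpha> j)"
    and S: "\<And>B. B \<in> S \<Longrightarrow> \<exists>C. D C B \<and>
      (\<forall>j<m. C j \<in> set_product (map \<Psi> ([Suc j..<Suc m] @ [1..<Suc j])))"
  defines "\<Phi> \<equiv> set_product (map \<Psi> [1..<Suc m])"
  shows "lim (\<lambda>k. ereal (root k (nonneg_Sup (N ` set_power S k)))) \<le>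
      lim (\<lambda>k. ereal (root k (nonneg_Sup (N ` set_power \<Phi> k))))" (is ?joint)
    and "limsup (\<lambda>k. ereal (root k (nonneg_Sup (limit_radius N ` set_power S k)))) \<le>
      limsup (\<lambda>k. ereal (root k (nonneg_Sup (limit_radius N ` set_power \<Phi> k))))" (is ?generalized)
proof -
  \<comment> \<open>Cut the list at j: \<open>\<Phi>\<close> is the product over
    \<open>Ys j @ Xs j\<close>, while \<open>C j\<close> lies in the product over
    \<open>Xs j @ Ys j\<close>.\<close>
  define Xs Ys where "Xs j = map \<Psi> [Suc j..<Suc m]" and "Ys j = map \<Psi> [1..<Suc j]" for j
  have split: "\<Phi> = set_product (Ys j @ Xs j)" if "j < m" for j
  proof -
    have "[1..<Suc m] = [1..<Suc j] @ [Suc j..<Suc m]"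
      using upt_add_eq_append[of 1 "Suc j" "m - j"] that by simp
    then show ?thesis by (simp add: \<Phi>_def Xs_def Ys_def del: upt_Suc)
  qed
  have "bounded (\<Union>j\<in>{1..m}. \<Psi> j)" using bounded by (intro bounded_UN) auto
  \<comment> \<open>With \<open>K \<ge> 1\<close>, the bound \<open>K ^ m\<close> also covers the
    shorter products over \<open>Xs j\<close> and \<open>Ys j\<close>.\<close>
  then obtain K where K: "K \<ge> 1" "\<And>j A. j \<in> {1..m} \<Longrightarrow> A \<in> \<Psi> j \<Longrightarrow> norm A \<le> K"
    unfolding bounded_pos by (metis UN_I max.bounded_iff max.cobounded2 nle_le order_trans)
  have Kpow: "norm A \<le> K ^ m" if "A \<in> set_product (map \<Psi> js)" "set js \<subseteq> {1..m}" "length js \<le> m" for A js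
  proof -
    have "norm A \<le> K ^ length (map \<Psi> js)"
      using that K by (intro norm_set_product_le) auto
    also have "\<dots> \<le> K ^ m" using that K by (intro power_increasing) auto
    finally show ?thesis .
  qed
  have bX: "norm A \<le> K ^ m" if "A \<in> set_product (Xs j)" for A j
    using that unfolding Xs_def by (rule Kpow) auto
  have bY: "norm A \<le> K ^ m" if "A \<in> set_product (Ys j)" "j < m" for A j
    using that(1) unfolding Ys_def by (rule Kpow) (use that(2) in auto)
  have bXY: "norm A \<le> K ^ m" if "A \<in> set_product (Xs j @ Ys j)" "j < m" for A j
    using that(1) unfolding Xs_def Ys_def map_append[symmetric] by (rule Kpow) (use that(2) in auto)
  have "norm A \<le> K ^ m" if "A \<in> \<Phi>" for A
    using that unfolding \<Phi>_def by (rule Kpow) auto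
  then have bdd: "bdd_above (N ` \<Phi>)"
    using le_norm by (intro bdd_aboveI2[of _ _ "K ^ m"]) (meson order_trans)
  note bddk = bdd_above_set_power[OF bdd]
  have power: "\<exists>C. D C B \<and> (\<forall>j<m. C j \<in> set_power (set_product (Xs j @ Ys j)) (Suc k))"
    if "B \<in> set_power S (Suc k)" for B k
    using that
  proof (induction k arbitrary: B)
    case 0
    then have "B \<in> S" by (simp add: set_power_def)
    then show ?case using S by (simp add: set_power_def Xs_def Ys_def del: upt_Suc)
  next
    case (Suc k)
    obtain B1 B2 where B: "B1 \<in> S" "B2 \<in> set_power S (Suc k)" "B = B1 o\<^sub>L B2"
      using Suc.prems unfolding set_power_Suc[of _ "Suc k"] by blast
    obtain C1 where C1: "D C1 B1" "\<forall>j<m. C1 j \<in> set_product (Xs j @ Ys j)"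
      using S[OF B(1)] by (auto simp: Xs_def Ys_def simp del: upt_Suc)
    obtain C2 where C2: "D C2 B2" "\<forall>j<m. C2 j \<in> set_power (set_product (Xs j @ Ys j)) (Suc k)"
      using Suc.IH[OF B(2)] by blast
    show ?case
      using D_compose[OF C1(1) C2(1)] C1(2) C2(2) unfolding B(3)
      by (intro exI[of _ "\<lambda>j. C1 j o\<^sub>L C2 j"]) (auto intro!: set_power_SucI)
  qed

  have D_N: "D (\<lambda>j. blinfun_pow (C j) (Suc n)) (blinfun_pow B (Suc n))" if "D C B" for B C n
  proof (induction n)
    case (Suc n)
    then show ?case using D_compose[OF that Suc] by simp
  qed (use that in simp)

  \<comment> \<open>Here the suprema compare for every positive k, before any limit is taken: the
    radius of \<open>C j\<close> is at most that of its rotated word, which lies in the same power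
    of \<open>\<Phi>\<close>.\<close>
  show ?generalized
  proof (rule Limsup_mono)
    show "\<forall>\<^sub>F k in sequentially. ereal (root k (nonneg_Sup (limit_radius N ` set_power S k)))
        \<le> ereal (root k (nonneg_Sup (limit_radius N ` set_power \<Phi> k)))"
      using eventually_gt_at_top[of 0]
    proof eventually_elim
      case (elim k)
      then obtain k' where k: "k = Suc k'" using gr0_implies_Suc by blast
      obtain c where "\<And>A. A \<in> set_power \<Phi> k \<Longrightarrow> N A \<le> c"
        using bddk[of k] by (auto simp: bdd_above_def)
      then have bddr: "bdd_above (limit_radius N ` set_power \<Phi> k)"
        using limit_radius_le by (intro bdd_aboveI2[of _ _ c]) (meson order_trans)
      have "nonneg_Sup (limit_radius N ` set_power S k) \<le> nonneg_Sup (limit_radius N ` set_power \<Phi> k)"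
      proof (rule nonneg_Sup_least; (elim imageE)?)
        fix x B assume x: "x = limit_radius N B" and "B \<in> set_power S k"
        then obtain C where C: "D C B" "\<And>j. j < m \<Longrightarrow> C j \<in> set_power (set_product (Xs j @ Ys j)) k"
          using power unfolding k by blast
        have "limit_radius N B \<le> (\<Prod>j<m. limit_radius N (C j) powr \<alpha> j)"
          using \<alpha> D_le[OF D_N[OF C(1)]] by (intro limit_radius_geometric_mean_le) auto
        also have "\<dots> \<le> nonneg_Sup (limit_radius N ` set_power \<Phi> k)"
        proof (rule prod_powr_le_const)
          fix j assume "j \<in> {..<m}"
          then have j: "j < m" by simp
          obtain Q P X where "Q \<in> set_product (Xs j)" "P \<in> set_product (Ys j)"
            "X \<in> set_power (set_product (Ys j @ Xs j)) k'"
            and QPX: "C j = Q o\<^sub>L (X o\<^sub>L P)"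
            "(X o\<^sub>L P) o\<^sub>L Q \<in> set_power (set_product (Ys j @ Xs j)) (Suc k')"
            using C(2)[OF j] unfolding k by (rule set_power_rotate)
          have "limit_radius N (C j) \<le> limit_radius N ((X o\<^sub>L P) o\<^sub>L Q)"
            unfolding QPX by (rule limit_radius_commute)
          also have "\<dots> \<le> nonneg_Sup (limit_radius N ` set_power \<Phi> k)"
            using QPX(2) unfolding split[OF j, symmetric] k[symmetric]
            by (intro nonneg_Sup_upper bddr imageI)
          finally show "limit_radius N (C j) \<le> nonneg_Sup (limit_radius N ` set_power \<Phi> k)" .
        qed (use \<alpha> sum limit_radius_nonneg in auto)
        finally show "x \<le> nonneg_Sup (limit_radius N ` set_power \<Phi> k)" by (simp add: x)
      qed (rule nonneg_Sup_nonneg[OF bddr])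
      then show ?case using elim by simp
    qed
  qed

  \<comment> \<open>To apply \<open>joint_limit\<close> to \<open>S\<close> a bound on
    \<open>S\<close> is required; the certificates of single elements provide it.\<close>
  have "N B \<le> K ^ m" if B: "B \<in> S" for B
  proof -
    obtain C where C: "D C B" "\<And>j. j < m \<Longrightarrow> C j \<in> set_product (Xs j @ Ys j)"
      using S[OF B] by (auto simp: Xs_def Ys_def simp del: upt_Suc)
    have "N B \<le> (\<Prod>j<m. N (C j) powr \<alpha> j)" by (rule D_le[OF C(1)])
    also have "\<dots> \<le> K ^ m"
    proof (rule prod_powr_le_const)
      show "N (C j) \<le> K ^ m" if "j \<in> {..<m}" for j
        using order_trans[OF le_norm bXY[OF C(2)]] that by simp
    qed (use \<alpha> sum nonneg in auto)
    finally show ?thesis .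
  qed
  then have bddS: "bdd_above (N ` S)" by (rule bdd_aboveI2)
  obtain l where l: "(\<lambda>k. root k (nonneg_Sup (N ` set_power \<Phi> k))) \<longlonglongrightarrow> l" "0 \<le> l"
    "lim (\<lambda>k. ereal (root k (nonneg_Sup (N ` set_power \<Phi> k)))) = ereal l"
    using joint_limit[OF bdd] .
  obtain l' where l': "(\<lambda>k. root k (nonneg_Sup (N ` set_power S k))) \<longlonglongrightarrow> l'"
    "lim (\<lambda>k. ereal (root k (nonneg_Sup (N ` set_power S k)))) = ereal l'"
    using joint_limit[OF bddS] .
  have "l' \<le> l"
  proof (rule dense_ge)
    fix s assume "l < s"
    then obtain t where t: "l < t" "t < s" using dense by blast
    then have t0: "t > 0" using l(2) by linarith
    \<comment> \<open>The end factors \<open>Q\<close> and \<open>P\<close> cost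
      \<open>K ^ m\<close> each; the division by \<open>t\<close> compensates for \<open>X\<close>
      having k factors while \<open>B\<close> has k + 1.\<close>
    define c where "c = K ^ m * K ^ m / t"
    have c: "c > 0" using t0 K by (simp add: c_def)
    have "\<forall>\<^sub>F k in sequentially. nonneg_Sup (N ` set_power S (Suc k)) \<le> c * t ^ Suc k"
      using order_tendstoD(2)[OF l(1) t(1)] eventually_gt_at_top[of 0]
    proof eventually_elim
      case (elim k)
      let ?s = "nonneg_Sup (N ` set_power \<Phi> k)"
      have s0: "0 \<le> ?s" by (rule nonneg_Sup_nonneg[OF bddk])
      have "root k ?s ^ k \<le> t ^ k" using elim s0 by (intro power_mono) auto
      then have s: "?s \<le> t ^ k" using elim s0 by simp
      show ?case
      proof (rule nonneg_Sup_least; (elim imageE)?)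
        fix x B assume x: "x = N B" and B: "B \<in> set_power S (Suc k)"
        obtain C where C: "D C B" "\<And>j. j < m \<Longrightarrow> C j \<in> set_power (set_product (Xs j @ Ys j)) (Suc k)"
          using power[OF B] by blast
        have "N B \<le> (\<Prod>j<m. N (C j) powr \<alpha> j)" by (rule D_le[OF C(1)])
        also have "\<dots> \<le> c * t ^ Suc k"
        proof (rule prod_powr_le_const)
          fix j assume "j \<in> {..<m}"
          then have j: "j < m" by simp
          obtain Q P X where QPX: "Q \<in> set_product (Xs j)" "P \<in> set_product (Ys j)"
            "X \<in> set_power (set_product (Ys j @ Xs j)) k" "C j = Q o\<^sub>L (X o\<^sub>L P)"
            "(X o\<^sub>L P) o\<^sub>L Q \<in> set_power (set_product (Ys j @ Xs j)) (Suc k)"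
            using C(2)[OF j] by (rule set_power_rotate)
          have NX: "N X \<le> t ^ k"
            using QPX(3) nonneg_Sup_upper[OF bddk[of k], of "N X"] s
            unfolding split[OF j, symmetric] by auto
          have "N (C j) \<le> norm Q * N X * norm P" unfolding QPX(4) by (rule compose3)
          also have "\<dots> \<le> K ^ m * t ^ k * K ^ m"
            using bX[OF QPX(1)] bY[OF QPX(2) j] NX nonneg K t0 by (intro mult_mono) auto
          also have "\<dots> = c * t ^ Suc k" using t0 by (simp add: c_def)
          finally show "N (C j) \<le> c * t ^ Suc k" .
        qed (use \<alpha> sum nonneg in auto)
        finally show "x \<le> c * t ^ Suc k" by (simp add: x)
      qed (use c t0 in simp)
    qed
    then have "\<forall>\<^sub>F k in sequentially. nonneg_Sup (N ` set_power S k) \<le> c * t ^ k"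
      by (rule iffD1[OF eventually_sequentially_Suc[of "\<lambda>k. nonneg_Sup (N ` set_power S k) \<le> c * t ^ k"]])
    then have "\<forall>\<^sub>F k in sequentially. root k (nonneg_Sup (N ` set_power S k)) < s"
      using eventually_root_le[of c t s] c t0 t(2) by simp
    then have "\<forall>\<^sub>F k in sequentially. root k (nonneg_Sup (N ` set_power S k)) \<le> s"
      by eventually_elim simp
    then show "l' \<le> s" by (intro tendsto_upperbound[OF l'(1)]) auto
  qed
  then show ?joint using l(3) l'(2) by simp
qed

end

section \<open>Gelfand's formula\<close>

definition complex_linear :: "('l::complex_banach \<Rightarrow>\<^sub>L 'l) \<Rightarrow> bool" where
  "complex_linear A \<longleftrightarrow> (\<forall>c f. A (c *\<^sub>C f) = c *\<^sub>C A f)"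

lemma complex_linearD: "complex_linear A \<Longrightarrow> A (c *\<^sub>C f) = c *\<^sub>C A f"
  by (simp add: complex_linear_def)

lemma scaleC_scaleR: "c *\<^sub>C (r *\<^sub>R f) = r *\<^sub>R (c *\<^sub>C (f::'l::complex_banach))"
  by (metis mult.commute scaleC_of_real scaleC_scaleC)

lemma bounded_linear_scaleC: "bounded_linear (\<lambda>f::'l::complex_banach. c *\<^sub>C f)"
  by (rule bounded_linear_intro[of _ "cmod c"])
    (simp_all add: scaleC_add_right scaleC_scaleR norm_scaleC)

lemma scaleC_one [simp]: "1 *\<^sub>C (f::'l::complex_banach) = f"
  using scaleC_of_real[of 1 f] by simp

lemma scaleC_zero_left [simp]: "0 *\<^sub>C (f::'l::complex_banach) = 0"
  using scaleC_of_real[of 0 f] by simp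

lemma scaleC_zero_right [simp]: "c *\<^sub>C (0::'l::complex_banach) = 0"
  using linear_0[OF bounded_linear.linear[OF bounded_linear_scaleC]] .

lemma scaleC_diff_right: "c *\<^sub>C (f - g) = c *\<^sub>C f - c *\<^sub>C (g::'l::complex_banach)"
  using linear_diff[OF bounded_linear.linear[OF bounded_linear_scaleC]] .

lemma scaleC_sum_left: "(\<Sum>i\<in>I. c i) *\<^sub>C (f::'l::complex_banach) = (\<Sum>i\<in>I. c i *\<^sub>C f)"
  by (induction I rule: infinite_finite_induct) (simp_all add: scaleC_add_left)

lemma scaleC_diff_left: "(c - d) *\<^sub>C (f::'l::complex_banach) = c *\<^sub>C f - d *\<^sub>C f"
  using scaleC_add_left[of "c - d" d f] by simp

definition scaleC_blinfun :: "complex \<Rightarrow> 'l::complex_banach \<Rightarrow>\<^sub>L 'l" where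
  "scaleC_blinfun c = Blinfun (\<lambda>f. c *\<^sub>C f)"

lemma scaleC_blinfun_apply [simp]: "scaleC_blinfun c f = c *\<^sub>C f"
  unfolding scaleC_blinfun_def by (simp add: bounded_linear_Blinfun_apply bounded_linear_scaleC)

lemma norm_scaleC_blinfun_compose_le: "norm (scaleC_blinfun c o\<^sub>L A) \<le> cmod c * norm A"
proof (rule norm_blinfun_bound)
  show "norm ((scaleC_blinfun c o\<^sub>L A) f) \<le> cmod c * norm A * norm f" for f
    by (simp add: norm_scaleC mult.assoc mult_left_mono norm_blinfun)
qed simp

lemma complex_linear_compose:
  "complex_linear A \<Longrightarrow> complex_linear B \<Longrightarrow> complex_linear (A o\<^sub>L B)"
  by (simp add: complex_linear_def)

lemma complex_linear_comp_list:
  "(\<And>A. A \<in> set As \<Longrightarrow> complex_linear A) \<Longrightarrow> complex_linear (comp_list As)"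
  by (induction As) (simp_all add: complex_linear_def)

lemma complex_linear_pow: "complex_linear A \<Longrightarrow> complex_linear (blinfun_pow A n)"
  by (auto intro: complex_linear_comp_list)

interpretation norm_functional: submultiplicative_functional
  "norm :: ('l::real_normed_vector \<Rightarrow>\<^sub>L 'l) \<Rightarrow> real"
  by standard (simp_all add: norm_blinfun_compose)

text \<open>The Neumann series of A^n / c^(n+1) is a two-sided inverse of c - A; for
  \<open>t\<close> strictly between the radius and \<open>cmod c\<close>, a geometric series of
  ratio \<open>t / cmod c\<close> dominates it eventually.\<close>

lemma not_in_spectrum_if_limit_radius_less:
  fixes A :: "'l::complex_banach \<Rightarrow>\<^sub>L 'l"
  assumes A: "complex_linear A" and c: "limit_radius norm A < cmod c"
  shows "c \<notin> spectrum A"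
proof -
  obtain t where t: "limit_radius norm A < t" "t < cmod c" using c dense by blast
  have t0: "0 < t" using t(1) norm_functional.limit_radius_nonneg[of A] by linarith
  have c0: "c \<noteq> 0" using t t0 by auto
  define T where "T n = scaleC_blinfun (1 / c ^ Suc n) o\<^sub>L blinfun_pow A n" for n
  have "summable T"
  proof (rule summable_comparison_test_ev)
    show "\<forall>\<^sub>F n in sequentially. norm (T n) \<le> (1 / cmod c) * (t / cmod c) ^ n"
      using norm_functional.eventually_less_power[OF t(1)]
    proof eventually_elim
      case (elim n)
      have "norm (T n) \<le> cmod (1 / c ^ Suc n) * norm (blinfun_pow A n)"
        unfolding T_def by (rule norm_scaleC_blinfun_compose_le)
      also have "\<dots> \<le> cmod (1 / c ^ Suc n) * t ^ n"
        using elim by (intro mult_left_mono) auto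
      also have "\<dots> = (1 / cmod c) * (t / cmod c) ^ n"
        by (simp add: norm_divide norm_mult norm_power power_divide)
      finally show ?case .
    qed
    show "summable (\<lambda>n. (1 / cmod c) * (t / cmod c) ^ n)"
      using t t0 by (intro summable_mult summable_geometric) (auto simp: divide_less_eq)
  qed
  then obtain R where R: "T sums R" by (auto simp: summable_def)
  have Rf: "(\<lambda>n. T n f) sums R f" for f
    using bounded_linear.sums[OF blinfun.bounded_linear_left R] .
  \<comment> \<open>Both c T - A T and T (c - A) reduce to differences of consecutive values
    \<open>u f n\<close>, so the two inverse identities are the same telescoping sum.\<close>
  define u where "u f n = (1 / c ^ n) *\<^sub>C blinfun_pow A n f" for f n
  have cT: "c *\<^sub>C T n f = u f n" for f n
    using c0 by (simp add: T_def u_def scaleC_scaleC)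
  have AT: "A (T n f) = u f (Suc n)" for f n
    by (simp add: T_def u_def complex_linearD[OF A])
  have TA: "T n (c *\<^sub>C f - A f) = u f n - u f (Suc n)" for f n
  proof -
    have "blinfun_pow A n (A f) = blinfun_pow A (Suc n) f"
      unfolding blinfun_pow_Suc2 by simp
    then show ?thesis
      using c0 by (simp add: T_def u_def blinfun.diff_right scaleC_diff_right scaleC_scaleC
          complex_linearD[OF complex_linear_pow[OF A]] del: replicate_Suc)
  qed
  have tele: "(\<lambda>n. u f n - u f (Suc n)) sums f" for f
  proof -
    have "(\<lambda>n. c *\<^sub>C T n f) \<longlonglongrightarrow> c *\<^sub>C 0"
      using summable_LIMSEQ_zero[OF sums_summable[OF Rf]]
      by (rule bounded_linear.tendsto[OF bounded_linear_scaleC])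
    then have "u f \<longlonglongrightarrow> 0" by (simp add: cT)
    then have "(\<lambda>n. u f n - u f (Suc n)) sums (u f 0 - 0)" by (rule telescope_sums')
    then show ?thesis by (simp add: u_def)
  qed
  have "R (c *\<^sub>C f - A f) = f" for f
    using sums_unique2[OF Rf[of "c *\<^sub>C f - A f"]] tele[of f] by (simp add: TA)
  moreover have "c *\<^sub>C R f - A (R f) = f" for f
  proof -
    have "(\<lambda>n. c *\<^sub>C T n f - A (T n f)) sums (c *\<^sub>C R f - A (R f))"
      by (intro sums_diff bounded_linear.sums[OF bounded_linear_scaleC Rf]
          bounded_linear.sums[OF blinfun.bounded_linear_right Rf])
    then have "(\<lambda>n. u f n - u f (Suc n)) sums (c *\<^sub>C R f - A (R f))" by (simp add: cT AT)
    then show ?thesis using tele[of f] by (rule sums_unique2)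
  qed
  ultimately show ?thesis unfolding spectrum_def by blast
qed

lemma cmod_le_limit_radius:
  assumes "complex_linear A" "c \<in> spectrum A"
  shows "cmod c \<le> limit_radius norm A"
  using not_in_spectrum_if_limit_radius_less[OF assms(1)] assms(2) by force

text \<open>The i-th powers of the n-th roots of unity are the powers of the single root
  \<open>z\<close>, which differs from 1 for 0 < i < n; their geometric sum vanishes.\<close>

lemma sum_roots_of_unity_power:
  fixes n i :: nat
  assumes "0 < i" "i < n"
  shows "(\<Sum>k<n. exp (2 * of_real pi * \<i> * of_nat k / of_nat n) ^ i :: complex) = 0"
proof -
  define z :: complex where "z = exp (2 * of_real pi * \<i> * of_nat i / of_nat n)"
  have "z ^ n = 1" unfolding z_def using assms by (intro complex_root_unity) simp
  moreover have "z \<noteq> 1"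
    unfolding z_def using assms complex_root_unity_eq_1[of n i] by (auto dest: dvd_imp_le)
  ultimately have "(\<Sum>k<n. z ^ k) = 0" by (simp add: sum_gp_strict)
  moreover have "exp (2 * of_real pi * \<i> * of_nat k / of_nat n) ^ i = z ^ k" for k
    unfolding z_def by (simp flip: exp_of_nat_mult add: mult_ac)
  ultimately show ?thesis by simp
qed

text \<open>If the limit l exceeded the spectral radius, I - z A would be invertible on a disc of
  radius 1 / r > 1 / l. Averaging these inverses over the points z = \<omega> t, with \<omega> the
  n-th roots of unity, gives a left inverse of I - t^n A^n that is Lipschitz in t uniformly in n.
  Just below 1 / l it is close to the identity, since t^n A^n tends to 0; by uniformity it is still
  close at some s just above 1 / l, so s^n A^n stays bounded, contradicting the meaning of
  l.\<close>

lemma limit_radius_le_spectral_radius: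
  fixes A :: "'l::complex_banach \<Rightarrow>\<^sub>L 'l"
  assumes A: "complex_linear A"
  shows "limit_radius norm A \<le> spectral_radius A"
proof (rule ccontr)
  define l where "l = limit_radius norm A"
  assume "\<not> ?thesis"
  then have "spectral_radius A < l" by (simp add: l_def)
  then obtain r where r: "spectral_radius A < r" "r < l" using dense by blast
  have bdd: "bdd_above (cmod ` spectrum A)"
    using cmod_le_limit_radius[OF A] by (rule bdd_aboveI2)
  have r0: "0 < r" using r(1) nonneg_Sup_nonneg[OF bdd] by (simp add: spectral_radius_def)
  then have l0: "0 < l" using r by simp
  \<comment> \<open>The variable z = 1 / c turns the exterior of a disc that contains the spectrum
    into a disc around 0, on which compactness bounds the inverses uniformly.\<close>
  define E where "E z = id_blinfun - (scaleC_blinfun z o\<^sub>L A)" for z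
  have E_apply: "E z f = f - z *\<^sub>C A f" for z f
    by (simp add: E_def blinfun.diff_left)
  have "\<exists>U :: 'l \<Rightarrow>\<^sub>L 'l. \<forall>f. U (E z f) = f \<and> E z (U f) = f" if z: "cmod z \<le> 1 / r" for z
  proof (cases "z = 0")
    case True
    then show ?thesis by (intro exI[of _ id_blinfun]) (simp add: E_apply)
  next
    case False
    define c where "c = 1 / z"
    have "r \<le> cmod c" using z False r0 by (simp add: c_def norm_divide field_simps)
    then have "c \<notin> spectrum A"
      using nonneg_Sup_upper[OF bdd, of "cmod c"] r(1) by (auto simp: spectral_radius_def)
    then obtain R :: "'l \<Rightarrow>\<^sub>L 'l" where R: "\<And>f. R (c *\<^sub>C f - A f) = f" "\<And>f. c *\<^sub>C R f - A (R f) = f"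
      unfolding spectrum_def by blast
    have Ec: "E z f = z *\<^sub>C (c *\<^sub>C f - A f)" for f
      using False by (simp add: E_apply c_def scaleC_diff_right scaleC_scaleC)
    show ?thesis
    proof (intro exI[of _ "R o\<^sub>L scaleC_blinfun c"] allI conjI)
      show "(R o\<^sub>L scaleC_blinfun c) (E z f) = f" for f
      proof -
        have "(R o\<^sub>L scaleC_blinfun c) (E z f) = R ((c * z) *\<^sub>C (c *\<^sub>C f - A f))"
          unfolding Ec by (simp add: scaleC_scaleC)
        then show ?thesis using False R(1) by (simp add: c_def)
      qed
      show "E z ((R o\<^sub>L scaleC_blinfun c) f) = f" for f
        using False by (simp add: Ec R(2)) (simp add: c_def scaleC_scaleC)
    qed
  qed
  then obtain U :: "complex \<Rightarrow> 'l \<Rightarrow>\<^sub>L 'l" where UE: "\<And>z f. cmod z \<le> 1 / r \<Longrightarrow> U z (E z f) = f"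
    and EU: "\<And>z f. cmod z \<le> 1 / r \<Longrightarrow> E z (U z f) = f"
    by metis
  have resolvent: "norm (U z - U w) \<le> norm (U z) * (cmod (z - w) * norm A * norm (U w))"
    if "cmod z \<le> 1 / r" "cmod w \<le> 1 / r" for z w
  proof -
    have "U z - U w = U z o\<^sub>L ((scaleC_blinfun (z - w) o\<^sub>L A) o\<^sub>L U w)"
    proof (rule blinfun_eqI)
      fix f
      have "U z f - U w f = U z (E w (U w f)) - U z (E z (U w f))"
        using UE EU that by simp
      also have "\<dots> = U z ((z - w) *\<^sub>C A (U w f))"
        by (simp flip: blinfun.diff_right add: E_apply scaleC_diff_left)
      finally show "(U z - U w) f = (U z o\<^sub>L ((scaleC_blinfun (z - w) o\<^sub>L A) o\<^sub>L U w)) f"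
        by (simp add: blinfun.diff_left)
    qed
    then have "norm (U z - U w) \<le> norm (U z) * norm ((scaleC_blinfun (z - w) o\<^sub>L A) o\<^sub>L U w)"
      by (metis norm_blinfun_compose)
    also have "\<dots> \<le> norm (U z) * (norm (scaleC_blinfun (z - w) o\<^sub>L A) * norm (U w))"
      by (intro mult_left_mono norm_blinfun_compose) simp
    also have "\<dots> \<le> norm (U z) * (cmod (z - w) * norm A * norm (U w))"
      by (intro mult_left_mono mult_right_mono norm_scaleC_blinfun_compose_le) simp_all
    finally show ?thesis .
  qed
  have "continuous_on (cball 0 (1 / r)) U"
    unfolding continuous_on_iff
  proof (intro ballI allI impI)
    fix w :: complex and e :: real
    assume w: "w \<in> cball 0 (1 / r)" and e: "0 < e"
    define q where "q = norm A * norm (U w)"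
    have q0: "q \<ge> 0" by (simp add: q_def)
    \<comment> \<open>The first bound gives \<open>norm (U z) \<le> 2 * norm (U w)\<close>, the
      second then makes the difference less than \<open>e\<close>; the added 1 avoids division by
      0.\<close>
    define d where "d = min (1 / (2 * (q + 1))) (e / (2 * (norm (U w) * q + 1)))"
    have d: "d > 0" unfolding d_def q_def using e
      by (intro min_less_iff_conj[THEN iffD2] conjI divide_pos_pos) (auto intro!: add_nonneg_pos mult_nonneg_nonneg)
    show "\<exists>d>0. \<forall>z\<in>cball 0 (1 / r). dist z w < d \<longrightarrow> dist (U z) (U w) < e"
    proof (intro exI[of _ d] conjI d ballI impI)
      fix z assume z: "z \<in> cball 0 (1 / r)" "dist z w < d"
      have zw: "cmod (z - w) < d" using z(2) by (simp add: dist_norm)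
      have res: "norm (U z - U w) \<le> norm (U z) * (cmod (z - w) * q)"
        using resolvent[of z w] z w by (simp add: q_def mult.assoc)
      have "cmod (z - w) * q \<le> 1 / (2 * (q + 1)) * q"
        using zw q0 by (intro mult_right_mono) (auto simp: d_def)
      also have "\<dots> \<le> 1 / 2" using q0 by (simp add: field_simps)
      finally have "norm (U z) * (cmod (z - w) * q) \<le> norm (U z) * (1 / 2)"
        by (intro mult_left_mono) auto
      moreover have "norm (U z) \<le> norm (U w) + norm (U z - U w)"
        using norm_triangle_ineq[of "U w" "U z - U w"] by simp
      ultimately have Uz: "norm (U z) \<le> 2 * norm (U w)" using res by linarith
      have "norm (U z - U w) \<le> 2 * norm (U w) * (cmod (z - w) * q)"
        using res Uz q0 by (meson mult_right_mono mult_nonneg_nonneg norm_ge_zero order_trans)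
      also have "\<dots> = 2 * (norm (U w) * q) * cmod (z - w)" by simp
      also have "\<dots> \<le> 2 * (norm (U w) * q) * (e / (2 * (norm (U w) * q + 1)))"
        using zw q0 by (intro mult_left_mono) (auto simp: d_def)
      also have "\<dots> < e"
      proof -
        have "0 \<le> norm (U w) * q" using q0 by simp
        then show ?thesis using e by (simp add: field_simps)
      qed
      finally show "dist (U z) (U w) < e" by (simp add: dist_norm)
    qed
  qed
  then have "bounded (U ` cball 0 (1 / r))"
    by (intro compact_imp_bounded compact_continuous_image compact_cball)
  then obtain K where K: "K > 0" "\<And>z. cmod z \<le> 1 / r \<Longrightarrow> norm (U z) \<le> K"
    unfolding bounded_pos by auto
  \<comment> \<open>One Lipschitz constant for the whole disc; averaging preserves it, so it does
    not depend on n.\<close>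
  define \<Lambda> where "\<Lambda> = K * (norm A * K) + 1"
  have \<Lambda>0: "\<Lambda> > 0" unfolding \<Lambda>_def using K(1) by (intro add_nonneg_pos) auto
  have lip: "norm (U z - U w) \<le> \<Lambda> * cmod (z - w)" if "cmod z \<le> 1 / r" "cmod w \<le> 1 / r" for z w
  proof -
    have "norm (U z - U w) \<le> norm (U z) * (cmod (z - w) * norm A * norm (U w))"
      by (rule resolvent[OF that])
    also have "\<dots> \<le> K * (cmod (z - w) * norm A * K)"
      using K that by (intro mult_mono mult_left_mono mult_nonneg_nonneg) auto
    also have "\<dots> \<le> \<Lambda> * cmod (z - w)" by (simp add: \<Lambda>_def algebra_simps)
    finally show ?thesis .
  qed
  define \<omega> where "\<omega> n k = (exp (2 * of_real pi * \<i> * of_nat k / of_nat n) :: complex)" for n k :: nat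
  have \<omega>1: "cmod (\<omega> n k) = 1" for n k
    by (simp add: \<omega>_def norm_exp_eq_Re)
  have \<omega>n: "\<omega> n k ^ n = 1" if "n > 0" for n k
    unfolding \<omega>_def using that by (intro complex_root_unity) simp
  define S where "S n t f = (1 / real n) *\<^sub>R (\<Sum>k<n. U (\<omega> n k * of_real t) f)" for n t f
  define P where "P n t f = t ^ n *\<^sub>R blinfun_pow A n f" for n t f
  have pow_lin: "blinfun_pow A i (c *\<^sub>C f) = c *\<^sub>C blinfun_pow A i f" for i c f
    using complex_linearD[OF complex_linear_pow[OF A]] .
  have U_geometric: "U z (f - z ^ n *\<^sub>C blinfun_pow A n f) = (\<Sum>i<n. z ^ i *\<^sub>C blinfun_pow A i f)"
    if "cmod z \<le> 1 / r" for z n f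
  proof -
    have "E z (\<Sum>i<n. z ^ i *\<^sub>C blinfun_pow A i f) = f - z ^ n *\<^sub>C blinfun_pow A n f"
    proof (induction n)
      case (Suc n)
      have "E z (z ^ n *\<^sub>C blinfun_pow A n f) = z ^ n *\<^sub>C blinfun_pow A n f - z ^ Suc n *\<^sub>C blinfun_pow A (Suc n) f"
        by (simp add: E_apply complex_linearD[OF A] scaleC_scaleC)
      then show ?case using Suc by (simp add: blinfun.add_right del: replicate_Suc)
    qed simp
    then show ?thesis using UE[OF that, of "\<Sum>i<n. z ^ i *\<^sub>C blinfun_pow A i f"] by simp
  qed
  \<comment> \<open>All points \<open>\<omega> n k * t\<close> have the same n-th power, so each
    inverse turns the same vector into a finite geometric sum; summation over k leaves only the term
    i = 0.\<close>
  have S_inverse: "S n t (f - P n t f) = f" if n: "n > 0" and t: "0 \<le> t" "t \<le> 1 / r" for n t f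
  proof -
    have "(\<Sum>k<n. U (\<omega> n k * of_real t) (f - P n t f)) =
      (\<Sum>k<n. \<Sum>i<n. (\<omega> n k * of_real t) ^ i *\<^sub>C blinfun_pow A i f)"
    proof (rule sum.cong[OF refl])
      fix k
      have P: "P n t f = (\<omega> n k * of_real t) ^ n *\<^sub>C blinfun_pow A n f"
        using \<omega>n[OF n] by (simp add: P_def power_mult_distrib flip: of_real_power scaleC_of_real)
      have "cmod (\<omega> n k * of_real t) \<le> 1 / r" using t \<omega>1 by (simp add: norm_mult)
      then show "U (\<omega> n k * of_real t) (f - P n t f) =
          (\<Sum>i<n. (\<omega> n k * of_real t) ^ i *\<^sub>C blinfun_pow A i f)"
        unfolding P by (rule U_geometric)
    qed
    also have "\<dots> = (\<Sum>i<n. \<Sum>k<n. (\<omega> n k * of_real t) ^ i *\<^sub>C blinfun_pow A i f)"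
      by (rule sum.swap)
    also have "\<dots> = (\<Sum>i<n. (if i = 0 then real n *\<^sub>R f else 0))"
    proof (rule sum.cong[OF refl])
      fix i assume i: "i \<in> {..<n}"
      show "(\<Sum>k<n. (\<omega> n k * of_real t) ^ i *\<^sub>C blinfun_pow A i f) = (if i = 0 then real n *\<^sub>R f else 0)"
      proof (cases "i = 0")
        case True
        then show ?thesis by (simp add: scaleR_conv_of_real sum_constant_scaleR)
      next
        case False
        have "(\<Sum>k<n. (\<omega> n k * of_real t) ^ i) = (\<Sum>k<n. \<omega> n k ^ i) * of_real t ^ i"
          by (simp add: power_mult_distrib sum_distrib_right)
        also have "\<dots> = 0"
          using sum_roots_of_unity_power[of i n] False i by (simp add: \<omega>_def)
        finally show ?thesis using False by (simp flip: scaleC_sum_left)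
      qed
    qed
    also have "\<dots> = real n *\<^sub>R f" using n by (simp add: sum.delta)
    finally show ?thesis using n by (simp add: S_def)
  qed
  have S_bound: "norm (S n t f) \<le> K * norm f" if n: "n > 0" and t: "0 \<le> t" "t \<le> 1 / r" for n t f
  proof -
    have "norm (\<Sum>k<n. U (\<omega> n k * of_real t) f) \<le> (\<Sum>k<n. K * norm f)"
    proof (rule sum_norm_le)
      fix k
      have "cmod (\<omega> n k * of_real t) \<le> 1 / r" using t \<omega>1 by (simp add: norm_mult)
      then show "norm (U (\<omega> n k * of_real t) f) \<le> K * norm f"
        using K(2) by (meson mult_right_mono norm_blinfun norm_ge_zero order_trans)
    qed
    then show ?thesis using n by (simp add: S_def field_simps)
  qed
  have S_lip: "norm (S n s f - S n t f) \<le> \<Lambda> * \<bar>s - t\<bar> * norm f"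
    if n: "n > 0" and t: "0 \<le> t" "t \<le> 1 / r" "0 \<le> s" "s \<le> 1 / r" for n s t f
  proof -
    have "norm (\<Sum>k<n. U (\<omega> n k * of_real s) f - U (\<omega> n k * of_real t) f) \<le> (\<Sum>k<n. \<Lambda> * \<bar>s - t\<bar> * norm f)"
    proof (rule sum_norm_le)
      fix k
      have "norm ((U (\<omega> n k * of_real s) - U (\<omega> n k * of_real t)) f)
          \<le> norm (U (\<omega> n k * of_real s) - U (\<omega> n k * of_real t)) * norm f"
        by (rule norm_blinfun)
      also have "\<dots> \<le> \<Lambda> * cmod (\<omega> n k * of_real s - \<omega> n k * of_real t) * norm f"
        using t \<omega>1 by (intro mult_right_mono lip) (auto simp: norm_mult)
      also have "cmod (\<omega> n k * of_real s - \<omega> n k * of_real t) = \<bar>s - t\<bar>"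
        by (simp add: \<omega>1 norm_mult flip: right_diff_distrib of_real_diff)
      finally show "norm (U (\<omega> n k * of_real s) f - U (\<omega> n k * of_real t) f) \<le> \<Lambda> * \<bar>s - t\<bar> * norm f"
        by (simp add: blinfun.diff_left)
    qed
    then have "real n * norm (S n s f - S n t f) \<le> real n * (\<Lambda> * \<bar>s - t\<bar> * norm f)"
      using n by (simp add: S_def sum_subtractf flip: scaleR_diff_right)
    then show ?thesis using n by simp
  qed
  \<comment> \<open>The first bound limits the change of \<open>S n\<close> between \<open>t\<close>
    and \<open>s\<close> to 1/4, the second keeps \<open>s\<close> inside the disc.\<close>
  define \<delta> where "\<delta> = min (1 / (4 * \<Lambda>)) (1 / r - 1 / l)"
  have \<delta>: "\<delta> > 0" "\<Lambda> * \<delta> \<le> 1 / 4" "1 / l + \<delta> \<le> 1 / r"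
  proof -
    have "1 / l < 1 / r" using r r0 by (simp add: frac_less2)
    then show "\<delta> > 0" using \<Lambda>0 by (simp add: \<delta>_def)
    have "\<Lambda> * \<delta> \<le> \<Lambda> * (1 / (4 * \<Lambda>))" using \<Lambda>0 by (intro mult_left_mono) (auto simp: \<delta>_def)
    then show "\<Lambda> * \<delta> \<le> 1 / 4" using \<Lambda>0 by simp
    show "1 / l + \<delta> \<le> 1 / r" by (simp add: \<delta>_def)
  qed
  define s t where "s = 1 / l + \<delta> / 2" and "t = max 0 (1 / l - \<delta> / 2)"
  have st: "0 \<le> t" "t < 1 / l" "1 / l < s" "s \<le> 1 / r" "t \<le> 1 / r" "\<bar>s - t\<bar> \<le> \<delta>" "0 < s"
    using \<delta> l0 r0 by (auto simp: s_def t_def max_def add_pos_pos)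
  \<comment> \<open>A number \<open>l'\<close> above l with \<open>t * l' < 1\<close> makes t^n A^n
    decay geometrically.\<close>
  obtain l' where l': "l < l'" "t * l' < 1"
  proof (cases "t = 0")
    case True
    then show ?thesis using that[of "l + 1"] by simp
  next
    case False
    then have "l < 1 / t" using st l0 by (simp add: field_simps)
    then obtain l' where "l < l'" "l' < 1 / t" using dense by blast
    then show ?thesis using that[of l'] False st by (simp add: field_simps)
  qed
  have "(\<lambda>n. K * (t * l') ^ n) \<longlonglongrightarrow> K * 0"
    using l' st l0 by (intro tendsto_intros LIMSEQ_realpow_zero) auto
  then have "\<forall>\<^sub>F n in sequentially. K * (t * l') ^ n < 1 / 4"
    by (intro order_tendstoD) auto
  then have "\<forall>\<^sub>F n in sequentially. norm (blinfun_pow A n) \<le> 3 * (1 / s) ^ n"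
    using norm_functional.eventually_less_power[OF l'(1)[unfolded l_def]] eventually_gt_at_top[of 0]
  proof eventually_elim
    case (elim n)
    have PK: "norm (P n t f) \<le> (t * l') ^ n * norm f" for f
    proof -
      have "norm (P n t f) = t ^ n * norm (blinfun_pow A n f)" using st by (simp add: P_def)
      also have "\<dots> \<le> t ^ n * (l' ^ n * norm f)"
        using elim(2) st
        by (intro mult_left_mono order_trans[OF norm_blinfun] mult_right_mono) auto
      finally show ?thesis by (simp add: power_mult_distrib mult.assoc)
    qed
    have S_diff: "S n t (f - g) = S n t f - S n t g" for f g t
      by (simp add: S_def blinfun.diff_right sum_subtractf scaleR_diff_right)
    have St: "norm (S n t f - f) \<le> 1 / 4 * norm f" for f
    proof -
      have "S n t f - f = S n t (P n t f)"
        using S_inverse[OF elim(3) st(1,5), of f] by (simp add: S_diff algebra_simps)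
      then have "norm (S n t f - f) \<le> K * norm (P n t f)"
        using S_bound[OF elim(3) st(1,5)] by simp
      also have "\<dots> \<le> K * ((t * l') ^ n * norm f)" using PK K by (intro mult_left_mono) auto
      also have "\<dots> = (K * (t * l') ^ n) * norm f" by simp
      also have "\<dots> \<le> 1 / 4 * norm f" using elim(1) by (intro mult_right_mono) auto
      finally show ?thesis .
    qed
    have Ss: "norm (S n s f - f) \<le> 1 / 2 * norm f" for f
    proof -
      have "norm (S n s f - S n t f) \<le> \<Lambda> * \<bar>s - t\<bar> * norm f"
        using st by (intro S_lip elim(3)) auto
      also have "\<dots> \<le> \<Lambda> * \<delta> * norm f"
        using st \<Lambda>0 by (intro mult_right_mono mult_left_mono) auto
      also have "\<dots> \<le> 1 / 4 * norm f" using \<delta> by (intro mult_right_mono) auto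
      finally have "norm (S n s f - S n t f) \<le> 1 / 4 * norm f" .
      then show ?thesis
        using St[of f] norm_triangle_ineq[of "S n s f - S n t f" "S n t f - f"] by simp
    qed
    have "norm (blinfun_pow A n f) \<le> 3 * (1 / s) ^ n * norm f" for f
    proof -
      \<comment> \<open>As \<open>S n s g = f\<close>, closeness within 1/2 gives
        \<open>norm g \<le> 2 * norm f\<close>, and f - g = s^n A^n f yields the constant 3.\<close>
      define g where "g = f - P n s f"
      have "S n s g = f" unfolding g_def using st by (intro S_inverse elim(3)) auto
      then have "norm (f - g) \<le> 1 / 2 * norm g" using Ss[of g] by simp
      moreover have "norm g \<le> norm f + norm (f - g)"
        using norm_triangle_ineq4[of f "f - g"] by simp
      ultimately have "norm g \<le> 2 * norm f" by linarith
      moreover have "norm (P n s f) \<le> norm f + norm g"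
        using norm_triangle_ineq4[of f g] by (simp add: g_def)
      ultimately have "norm (P n s f) \<le> 3 * norm f" by linarith
      then have "s ^ n * norm (blinfun_pow A n f) \<le> 3 * norm f" using st by (simp add: P_def)
      then show ?thesis using st by (simp add: field_simps)
    qed
    then show ?case using st by (intro norm_blinfun_bound) auto
  qed
  moreover obtain l1 where l1: "1 / s < l1" "l1 < l"
    using dense[of "1 / s" l] st l0 by (auto simp: field_simps)
  ultimately have "\<forall>\<^sub>F n in sequentially. root n (norm (blinfun_pow A n)) < l1"
    using eventually_root_le[of 3 "1 / s" l1] st by simp
  then have "\<forall>\<^sub>F n in sequentially. root n (norm (blinfun_pow A n)) \<le> l1"
    by eventually_elim simp
  then have "l \<le> l1" unfolding l_def
    by (intro tendsto_upperbound[OF norm_functional.limit_radius_tendsto]) auto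
  then show False using l1 by simp
qed

theorem spectral_radius_eq_limit_radius:
  fixes A :: "'l::complex_banach \<Rightarrow>\<^sub>L 'l"
  assumes "complex_linear A"
  shows "spectral_radius A = limit_radius norm A"
proof (rule antisym)
  show "spectral_radius A \<le> limit_radius norm A"
    unfolding spectral_radius_def using cmod_le_limit_radius[OF assms]
      norm_functional.limit_radius_nonneg
    by (intro nonneg_Sup_least) auto
qed (rule limit_radius_le_spectral_radius[OF assms])

section \<open>The Hausdorff measure of noncompactness\<close>

text \<open>The set whose infimum is \<open>hausdorff_mnc\<close>, with coverings by balls written
  as distances to the centres.\<close>

definition mnc_bounds :: "('l::real_normed_vector \<Rightarrow>\<^sub>L 'l) \<Rightarrow> real set" where
  "mnc_bounds A = {\<delta>. \<delta> > 0 \<and> (\<exists>F. finite F \<and> (\<forall>f. norm f \<le> 1 \<longrightarrow> (\<exists>g\<in>F. norm (A f - g) \<le> \<delta>)))}"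

lemma hausdorff_mnc_eq: "hausdorff_mnc A = Inf (mnc_bounds A)"
proof -
  have *: "(h \<in> {g + \<delta> *\<^sub>R d |g d. g \<in> F \<and> d \<in> cball 0 1}) \<longleftrightarrow> (\<exists>g\<in>F. norm (h - g) \<le> \<delta>)"
    if "\<delta> > 0" for h :: 'a and \<delta> F
  proof
    assume "\<exists>g\<in>F. norm (h - g) \<le> \<delta>"
    then obtain g where g: "g \<in> F" "norm (h - g) \<le> \<delta>" by blast
    have "h = g + \<delta> *\<^sub>R ((1 / \<delta>) *\<^sub>R (h - g))" using that by simp
    moreover have "(1 / \<delta>) *\<^sub>R (h - g) \<in> cball 0 1"
      using that g unfolding mem_cball_0 norm_scaleR by simp
    ultimately show "h \<in> {g + \<delta> *\<^sub>R d |g d. g \<in> F \<and> d \<in> cball 0 1}" using g(1) by blast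
  next
    assume "h \<in> {g + \<delta> *\<^sub>R d |g d. g \<in> F \<and> d \<in> cball 0 1}"
    then show "\<exists>g\<in>F. norm (h - g) \<le> \<delta>" using that by (force simp: mult_left_le)
  qed
  have "A ` cball 0 1 \<subseteq> {g + \<delta> *\<^sub>R d |g d. g \<in> F \<and> d \<in> cball 0 1} \<longleftrightarrow>
      (\<forall>f. norm f \<le> 1 \<longrightarrow> (\<exists>g\<in>F. norm (A f - g) \<le> \<delta>))" if "\<delta> > 0" for \<delta> F
    unfolding image_subset_iff *[OF that] by (simp add: Ball_def)
  then show ?thesis
    unfolding hausdorff_mnc_def mnc_bounds_def
    by (intro arg_cong[where f = Inf] Collect_cong conj_cong refl) simp
qed

lemma mnc_bounds_norm: "\<delta> > norm A \<Longrightarrow> \<delta> \<in> mnc_bounds A"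
proof -
  assume d: "\<delta> > norm A"
  have "norm (A f) \<le> \<delta>" if "norm f \<le> 1" for f
    using norm_blinfun[of A f] that d mult_left_mono[OF that, of "norm A"] by simp
  then show ?thesis
    unfolding mnc_bounds_def using d
    by (auto intro!: exI[of _ "{0}"] intro: le_less_trans[OF norm_ge_zero])
qed

lemma bdd_below_mnc_bounds: "bdd_below (mnc_bounds A)"
  by (rule bdd_belowI[of _ 0]) (auto simp: mnc_bounds_def)

lemma hausdorff_mnc_le: "\<delta> \<in> mnc_bounds A \<Longrightarrow> hausdorff_mnc A \<le> \<delta>"
  unfolding hausdorff_mnc_eq by (rule cInf_lower[OF _ bdd_below_mnc_bounds])

lemma mnc_bounds_nonempty: "mnc_bounds A \<noteq> {}"
  using mnc_bounds_norm[of A "norm A + 1"] by auto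

lemma hausdorff_mnc_lessD:
  assumes "hausdorff_mnc A < \<delta>"
  shows "\<exists>F. finite F \<and> (\<forall>f. norm f \<le> 1 \<longrightarrow> (\<exists>g\<in>F. norm (A f - g) \<le> \<delta>))"
proof -
  obtain d where "d \<in> mnc_bounds A" "d < \<delta>"
    using cInf_lessD[OF mnc_bounds_nonempty assms[unfolded hausdorff_mnc_eq]] by blast
  then obtain F where F: "finite F" "\<And>f. norm f \<le> 1 \<Longrightarrow> \<exists>g\<in>F. norm (A f - g) \<le> d"
    by (auto simp: mnc_bounds_def)
  show ?thesis using F(2) \<open>d < \<delta>\<close> by (intro exI[of _ F] conjI F(1)) force
qed

lemma hausdorff_mnc_nonneg: "0 \<le> hausdorff_mnc A"
  unfolding hausdorff_mnc_eq
  by (intro cInf_greatest mnc_bounds_nonempty) (auto simp: mnc_bounds_def)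

text \<open>Approximate B f up to an error of norm at most b, rescale that error to the unit ball,
  and approximate its image under A up to a. As the infima need not be attained, this is done for
  larger a and b, which then decrease.\<close>

lemma hausdorff_mnc_compose: "hausdorff_mnc (A o\<^sub>L B) \<le> hausdorff_mnc A * hausdorff_mnc B"
proof -
  have "hausdorff_mnc (A o\<^sub>L B) \<le> a * b" if a: "hausdorff_mnc A < a" and b: "hausdorff_mnc B < b" for a b
  proof -
    have pos: "a > 0" "b > 0"
      using a b hausdorff_mnc_nonneg[of A] hausdorff_mnc_nonneg[of B] by linarith+
    obtain F where F: "finite F" "\<And>f. norm f \<le> 1 \<Longrightarrow> \<exists>g\<in>F. norm (A f - g) \<le> a"
      using hausdorff_mnc_lessD[OF a] by blast
    obtain G where G: "finite G" "\<And>f. norm f \<le> 1 \<Longrightarrow> \<exists>g\<in>G. norm (B f - g) \<le> b"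
      using hausdorff_mnc_lessD[OF b] by blast
    have "a * b \<in> mnc_bounds (A o\<^sub>L B)"
      unfolding mnc_bounds_def
    proof (intro CollectI conjI exI[of _ "(\<lambda>(g, h). A g + b *\<^sub>R h) ` (G \<times> F)"] allI impI)
      fix f :: 'a assume "norm f \<le> 1"
      then obtain g where g: "g \<in> G" "norm (B f - g) \<le> b" using G by blast
      then have "norm ((1 / b) *\<^sub>R (B f - g)) \<le> 1"
        using pos unfolding norm_scaleR by simp
      then obtain h where h: "h \<in> F" "norm (A ((1 / b) *\<^sub>R (B f - g)) - h) \<le> a" using F by blast
      have "(A o\<^sub>L B) f - (A g + b *\<^sub>R h) = b *\<^sub>R (A ((1 / b) *\<^sub>R (B f - g)) - h)"
        using pos by (simp add: blinfun.scaleR_right blinfun.diff_right scaleR_diff_right)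
      then have "norm ((A o\<^sub>L B) f - (A g + b *\<^sub>R h)) \<le> a * b"
        using h(2) pos by (simp add: mult.commute)
      then show "\<exists>g\<in>(\<lambda>(g, h). A g + b *\<^sub>R h) ` (G \<times> F). norm ((A o\<^sub>L B) f - g) \<le> a * b"
        using g h by force
    qed (use pos F G in auto)
    then show ?thesis by (rule hausdorff_mnc_le)
  qed
  then have le: "hausdorff_mnc (A o\<^sub>L B) \<le> (hausdorff_mnc A + e) * (hausdorff_mnc B + e)"
    if "e > 0" for e using that by simp
  show ?thesis
  proof (rule tendsto_lowerbound)
    show "((\<lambda>e. (hausdorff_mnc A + e) * (hausdorff_mnc B + e)) \<longlongrightarrow> hausdorff_mnc A * hausdorff_mnc B) (at_right 0)"
      by (auto intro!: tendsto_eq_intros)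
    show "\<forall>\<^sub>F e in at_right 0. hausdorff_mnc (A o\<^sub>L B) \<le> (hausdorff_mnc A + e) * (hausdorff_mnc B + e)"
      using le unfolding eventually_at_right_field by (auto intro: exI[of _ 1])
  qed simp
qed

interpretation mnc_functional: submultiplicative_functional
  "hausdorff_mnc :: ('l::real_normed_vector \<Rightarrow>\<^sub>L 'l) \<Rightarrow> real"
proof
  show "hausdorff_mnc A \<le> norm A" for A :: "'l \<Rightarrow>\<^sub>L 'l"
  proof (rule dense_ge)
    fix d assume "norm A < d"
    then show "hausdorff_mnc A \<le> d" by (intro hausdorff_mnc_le mnc_bounds_norm)
  qed
qed (rule hausdorff_mnc_nonneg hausdorff_mnc_compose)+

section \<open>The Hahn--Banach theorem for sublinear functionals\<close>

text \<open>Homogeneity is an inequality for positive factors, the form that passes directly to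
  infima; equality follows by scaling back with 1 / c.\<close>

definition sublinear :: "('v::real_vector \<Rightarrow> real) \<Rightarrow> bool" where
  "sublinear q \<longleftrightarrow> (\<forall>x y. q (x + y) \<le> q x + q y) \<and> (\<forall>c x. c > 0 \<longrightarrow> q (c *\<^sub>R x) \<le> c * q x)"

lemma sublinear_add: "sublinear q \<Longrightarrow> q (x + y) \<le> q x + q y"
  and sublinear_scale_le: "sublinear q \<Longrightarrow> c > 0 \<Longrightarrow> q (c *\<^sub>R x) \<le> c * q x"
  by (simp_all add: sublinear_def)

lemma sublinear_0: "sublinear q \<Longrightarrow> q 0 = 0"
  using sublinear_add[of q 0 0] sublinear_scale_le[of q "1/2" 0] by simp

lemma sublinear_ge: "sublinear q \<Longrightarrow> - q (- x) \<le> q x"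
  using sublinear_add[of q x "- x"] sublinear_0[of q] by simp

lemma sublinear_scale:
  assumes "sublinear q" "c \<ge> 0"
  shows "q (c *\<^sub>R x) = c * q x"
proof (cases "c = 0")
  case False
  then have "q x \<le> (1 / c) * q (c *\<^sub>R x)"
    using sublinear_scale_le[OF assms(1), of "1 / c" "c *\<^sub>R x"] assms(2) by simp
  then show ?thesis
    using sublinear_scale_le[OF assms(1), of c x] False assms(2) by (simp add: field_simps)
qed (simp add: sublinear_0[OF assms(1)])

text \<open>For fixed y, the infimum over t \<ge> 0 of q (x + t y) - t q y is sublinear in x and
  below q. Minimality makes it equal to q, and t = 1 gives the missing inequality q x + q y \<le> q
  (x + y).\<close>

lemma minimal_sublinear_imp_linear:
  fixes q :: "'v::real_vector \<Rightarrow> real"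
  assumes q: "sublinear q" and min: "\<And>q'. sublinear q' \<Longrightarrow> (\<And>x. q' x \<le> q x) \<Longrightarrow> q' = q"
  shows "linear q"
proof -
  have add: "q (x + y) = q x + q y" for x y
  proof -
    define q' where "q' x = (INF t\<in>{0..}. q (x + t *\<^sub>R y) - t * q y)" for x
    have lower: "- q (- x) \<le> q (x + t *\<^sub>R y) - t * q y" if "t \<ge> 0" for x t
      using sublinear_add[OF q, of "x + t *\<^sub>R y" "- x"] sublinear_scale[OF q that, of y] by simp
    have bdd: "bdd_below ((\<lambda>t. q (x + t *\<^sub>R y) - t * q y) ` {0..})" for x
      using lower by (intro bdd_belowI2[of _ "- q (- x)"]) auto
    have upper: "q' x \<le> q (x + t *\<^sub>R y) - t * q y" if "t \<ge> 0" for x t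
      unfolding q'_def using that by (intro cINF_lower bdd) auto
    have "sublinear q'"
      unfolding sublinear_def
    proof (intro conjI allI impI)
      fix x z
      have "q' (x + z) - (q (x + t *\<^sub>R y) - t * q y) \<le> q' z" if t: "t \<ge> 0" for t
        unfolding q'_def[of z]
      proof (rule cINF_greatest)
        fix s :: real assume s: "s \<in> {0..}"
        have "q' (x + z) \<le> q ((x + z) + (t + s) *\<^sub>R y) - (t + s) * q y"
          using s t by (intro upper) simp
        also have "q ((x + z) + (t + s) *\<^sub>R y) \<le> q (x + t *\<^sub>R y) + q (z + s *\<^sub>R y)"
          using sublinear_add[OF q, of "x + t *\<^sub>R y" "z + s *\<^sub>R y"] by (simp add: algebra_simps)
        finally show "q' (x + z) - (q (x + t *\<^sub>R y) - t * q y) \<le> q (z + s *\<^sub>R y) - s * q y"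
          by (simp add: algebra_simps)
      qed simp
      then have "q' (x + z) - q' z \<le> q' x"
        unfolding q'_def[of x] by (intro cINF_greatest) (auto simp: algebra_simps)
      then show "q' (x + z) \<le> q' x + q' z" by simp
    next
      fix c :: real and x assume c: "c > 0"
      have "q' (c *\<^sub>R x) / c \<le> q' x"
        unfolding q'_def[of x]
      proof (rule cINF_greatest)
        fix t :: real assume t: "t \<in> {0..}"
        have "q' (c *\<^sub>R x) \<le> q (c *\<^sub>R x + (c * t) *\<^sub>R y) - (c * t) * q y"
          using c t by (intro upper) simp
        also have "q (c *\<^sub>R x + (c * t) *\<^sub>R y) = c * q (x + t *\<^sub>R y)"
          using sublinear_scale[OF q, of c "x + t *\<^sub>R y"] c by (simp add: scaleR_add_right)
        finally show "q' (c *\<^sub>R x) / c \<le> q (x + t *\<^sub>R y) - t * q y"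
          using c by (simp add: field_simps)
      qed simp
      then show "q' (c *\<^sub>R x) \<le> c * q' x" using c by (simp add: field_simps)
    qed
    moreover have "q' x \<le> q x" for x using upper[of 0 x] by simp
    ultimately have "q' = q" by (rule min)
    then have "q x \<le> q (x + y) - q y" using upper[of 1 x] by simp
    then show ?thesis using sublinear_add[OF q, of x y] by simp
  qed
  have neg: "q (- x) = - q x" for x using add[of x "- x"] sublinear_0[OF q] by simp
  have "q (c *\<^sub>R x) = c * q x" for c x
  proof (cases "c \<ge> 0")
    case False
    then have "q ((- c) *\<^sub>R x) = (- c) * q x" by (intro sublinear_scale[OF q]) simp
    then show ?thesis using neg[of "c *\<^sub>R x"] by simp
  qed (rule sublinear_scale[OF q])
  then show ?thesis using add by (intro linearI) auto
qed

text \<open>The common bound \<open>p\<close> keeps the infima finite, since every member is at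
  least - p (- x) at x. Subadditivity uses the chain: two members can be replaced by the smaller
  one.\<close>

lemma sublinear_INF_chain:
  fixes C :: "('v::real_vector \<Rightarrow> real) set"
  assumes ne: "C \<noteq> {}" and sub: "\<And>q. q \<in> C \<Longrightarrow> sublinear q"
    and chain: "\<And>q r. q \<in> C \<Longrightarrow> r \<in> C \<Longrightarrow> q \<le> r \<or> r \<le> q"
    and le: "\<And>q. q \<in> C \<Longrightarrow> q \<le> p"
  defines "u \<equiv> \<lambda>x. INF q\<in>C. q x"
  shows "sublinear u" and "q \<in> C \<Longrightarrow> u \<le> q"
proof -
  have u_eq: "u x = (INF q\<in>C. q x)" for x by (simp add: u_def)
  have "- p (- x) \<le> q x" if "q \<in> C" for q x
    using sublinear_ge[OF sub[OF that], of x] le_funD[OF le[OF that], of "- x"] by simp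
  then have bdd: "bdd_below ((\<lambda>q. q x) ` C)" for x
    by (rule bdd_belowI2)
  have upper: "u x \<le> q x" if "q \<in> C" for q x
    unfolding u_def using that by (intro cINF_lower bdd)
  show "q \<in> C \<Longrightarrow> u \<le> q" by (intro le_funI upper)
  show "sublinear u"
    unfolding sublinear_def
  proof (intro conjI allI impI)
    fix x y
    have "u (x + y) - q x \<le> u y" if q: "q \<in> C" for q
      unfolding u_eq[of y]
    proof (rule cINF_greatest[OF ne])
      fix r assume r: "r \<in> C"
      define s where "s = (if q \<le> r then q else r)"
      have s: "s \<in> C" "s \<le> q" "s \<le> r" using chain[OF q r] q r by (auto simp: s_def)
      have "u (x + y) \<le> s (x + y)" by (rule upper[OF s(1)])
      also have "\<dots> \<le> s x + s y" by (rule sublinear_add[OF sub[OF s(1)]])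
      also have "\<dots> \<le> q x + r y" using le_funD[OF s(2), of x] le_funD[OF s(3), of y] by simp
      finally show "u (x + y) - q x \<le> r y" by simp
    qed
    then have "u (x + y) - u y \<le> u x"
      unfolding u_eq[of x] by (intro cINF_greatest[OF ne]) (simp add: algebra_simps)
    then show "u (x + y) \<le> u x + u y" by simp
  next
    fix c :: real and x assume c: "c > 0"
    have "u (c *\<^sub>R x) / c \<le> u x"
      unfolding u_eq[of x]
    proof (rule cINF_greatest[OF ne])
      fix q assume q: "q \<in> C"
      have "u (c *\<^sub>R x) \<le> c * q x"
        using upper[OF q, of "c *\<^sub>R x"] sublinear_scale_le[OF sub[OF q] c, of x] by simp
      then show "u (c *\<^sub>R x) / c \<le> q x" using c by (simp add: field_simps)
    qed
    then show "u (c *\<^sub>R x) \<le> c * u x" using c by (simp add: field_simps)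
  qed
qed

text \<open>Hahn-Banach without extension from subspaces: Zorn's lemma gives a minimal sublinear
  functional below \<open>p\<close>, which is linear. The order is reversed in \<open>R\<close>
  because Zorn's lemma yields maximal elements.\<close>

theorem sublinear_dominates_linear:
  fixes p :: "'v::real_vector \<Rightarrow> real"
  assumes p: "sublinear p"
  obtains \<phi> where "linear \<phi>" "\<And>x. \<phi> x \<le> p x"
proof -
  define \<A> where "\<A> = {q. sublinear q \<and> q \<le> p}"
  define R where "R = (\<lambda>(q::'v \<Rightarrow> real) r. r \<le> q)"
  have "\<exists>q\<in>\<A>. \<forall>r\<in>\<A>. R q r \<longrightarrow> r = q"
  proof (rule predicate_Zorn)
    show "partial_order_on \<A> (relation_of R \<A>)"
      by (rule partial_order_on_relation_ofI) (auto simp: R_def)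
    fix C assume "C \<in> Chains (relation_of R \<A>)"
    then have C: "C \<subseteq> \<A>" "\<And>q r. q \<in> C \<Longrightarrow> r \<in> C \<Longrightarrow> q \<le> r \<or> r \<le> q"
      by (auto simp: Chains_def relation_of_def R_def)
    show "\<exists>u\<in>\<A>. \<forall>q\<in>C. R q u"
    proof (cases "C = {}")
      case True
      then show ?thesis using p by (auto simp: \<A>_def)
    next
      case False
      have sub: "sublinear q" and le: "q \<le> p" if "q \<in> C" for q using C(1) that by (auto simp: \<A>_def)
      let ?u = "\<lambda>x. INF q\<in>C. q x"
      have u: "sublinear ?u"
        using False sub C(2) le by (rule sublinear_INF_chain(1)[where C = C and p = p])
      have u': "?u \<le> q" if "q \<in> C" for q
        using False sub C(2) le that by (rule sublinear_INF_chain(2)[where C = C and p = p])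
      obtain q where q: "q \<in> C" using False by blast
      have "?u \<in> \<A>" using u order_trans[OF u'[OF q] le[OF q]] by (simp add: \<A>_def)
      then show ?thesis using u' by (auto simp: R_def)
    qed
  qed
  then obtain q where q: "sublinear q" "q \<le> p" "\<And>r. sublinear r \<Longrightarrow> r \<le> q \<Longrightarrow> r = q"
    unfolding \<A>_def R_def by (auto intro: order_trans)
  have "linear q"
    using q(1)
  proof (rule minimal_sublinear_imp_linear)
    show "q' = q" if "sublinear q'" "\<And>x. q' x \<le> q x" for q'
      using that by (intro q(3) le_funI)
  qed
  then show ?thesis using le_funD[OF q(2)] by (rule that)
qed

section \<open>Banach function spaces\<close>

lemma nonneg_Reals_iff_cmod: "z \<in> \<real>\<^sub>\<ge>\<^sub>0 \<longleftrightarrow> z = of_real (cmod z)"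
proof
  assume "z = of_real (cmod z)"
  then show "z \<in> \<real>\<^sub>\<ge>\<^sub>0" by (metis nonneg_Reals_of_real_iff norm_ge_zero)
qed (auto elim: nonneg_Reals_cases)

context banach_function_space
begin

declare rep_measurable [measurable, simp]

section \<open>The positive cone, moduli and limits of positive functions\<close>

abbreviation pos_cone :: "'l set" where "pos_cone \<equiv> positive_cone M rep"

lemma cone_iff: "f \<in> pos_cone \<longleftrightarrow> (AE x in M. rep f x = of_real (cmod (rep f x)))"
  unfolding positive_cone_def by (simp flip: nonneg_Reals_iff_cmod)

lemma coneI:
  assumes "AE x in M. rep f x = of_real (u x)" "AE x in M. 0 \<le> u x"
  shows "f \<in> pos_cone"
  unfolding positive_cone_def mem_Collect_eq using assms by eventually_elim simp

lemma coneD: "f \<in> pos_cone \<Longrightarrow> AE x in M. rep f x = of_real (cmod (rep f x))"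
  by (simp add: cone_iff)

lemma rep_scaleR: "AE x in M. rep (r *\<^sub>R f) x = of_real r * rep f x"
  using rep_scaleC[of "of_real r" f] by (simp add: scaleC_of_real)

lemma rep_zero: "AE x in M. rep 0 x = 0"
  using rep_scaleR[of 0 0] by simp

lemma rep_diff: "AE x in M. rep (f - g) x = rep f x - rep g x"
  using rep_add[of "f - g" g] by (auto simp: algebra_simps)

lemma rep_sum: "finite I \<Longrightarrow> AE x in M. rep (\<Sum>i\<in>I. f i) x = (\<Sum>i\<in>I. rep (f i) x)"
proof (induction I rule: finite_induct)
  case empty
  then show ?case using rep_zero by simp
next
  case (insert i I)
  then show ?case using rep_add[of "f i" "\<Sum>i\<in>I. f i"] by (auto elim: eventually_elim2)
qed

text \<open>Solidity yields only some element with the representative of f and a small norm;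
  injectivity of \<open>rep\<close> identifies it with f.\<close>

lemma norm_mono:
  assumes "AE x in M. cmod (rep f x) \<le> cmod (rep g x)"
  shows "norm f \<le> norm g"
proof -
  obtain h where "AE x in M. rep h x = rep f x" "norm h \<le> norm g"
    using solid[OF rep_measurable assms] by blast
  then show ?thesis using rep_inject by blast
qed

lemma obtain_positive:
  assumes "u \<in> borel_measurable M" "AE x in M. 0 \<le> u x" "AE x in M. u x \<le> cmod (rep f x)"
  obtains h where "h \<in> pos_cone" "AE x in M. rep h x = complex_of_real (u x)" "norm h \<le> norm f"
proof -
  have "AE x in M. cmod (complex_of_real (u x)) \<le> cmod (rep f x)"
    using assms(2,3) by eventually_elim simp
  then obtain h where h: "AE x in M. rep h x = complex_of_real (u x)" "norm h \<le> norm f"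
    using solid[of "\<lambda>x. complex_of_real (u x)" f] assms(1) by auto
  then show ?thesis using that coneI assms(2) by blast
qed

lemma obtain_modulus:
  obtains p where "p \<in> pos_cone" "AE x in M. cmod (rep p x) = cmod (rep f x)" "norm p = norm f"
proof -
  obtain h where h: "h \<in> pos_cone" "AE x in M. rep h x = complex_of_real (cmod (rep f x))"
    using obtain_positive[of "\<lambda>x. cmod (rep f x)" f] by auto
  have eq: "AE x in M. cmod (rep h x) = cmod (rep f x)" using h(2) by eventually_elim simp
  have "norm h = norm f"
    using eq by (intro antisym norm_mono) auto
  then show ?thesis using that h(1) eq by blast
qed

lemma cone_add:
  assumes "f \<in> pos_cone" "g \<in> pos_cone"
  shows "f + g \<in> pos_cone"
  using assms rep_add[of f g] unfolding positive_cone_def mem_Collect_eq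
  by eventually_elim simp

lemma cone_scaleR:
  assumes "f \<in> pos_cone" "0 \<le> r"
  shows "r *\<^sub>R f \<in> pos_cone"
  using assms(1) rep_scaleR[of r f] unfolding positive_cone_def mem_Collect_eq
  by eventually_elim (use assms(2) in simp)

lemma zero_in_cone [simp]: "0 \<in> pos_cone"
  unfolding positive_cone_def mem_Collect_eq using rep_zero by eventually_elim simp

lemma cone_sum: "(\<And>i. i \<in> I \<Longrightarrow> f i \<in> pos_cone) \<Longrightarrow> (\<Sum>i\<in>I. f i) \<in> pos_cone"
  by (induction I rule: infinite_finite_induct) (auto intro: cone_add)

lemma cmod_rep_sum:
  assumes "finite I" "\<And>i. i \<in> I \<Longrightarrow> f i \<in> pos_cone" "\<And>i. i \<in> I \<Longrightarrow> 0 \<le> c i"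
  shows "AE x in M. cmod (rep (\<Sum>i\<in>I. c i *\<^sub>R f i) x) = (\<Sum>i\<in>I. c i * cmod (rep (f i) x))"
proof -
  have "AE x in M. \<forall>i\<in>I. rep (f i) x = of_real (cmod (rep (f i) x))"
    using assms by (intro AE_finite_allI coneD)
  moreover have "AE x in M. \<forall>i\<in>I. rep (c i *\<^sub>R f i) x = of_real (c i) * rep (f i) x"
    using assms by (intro AE_finite_allI rep_scaleR)
  ultimately show ?thesis using rep_sum[OF assms(1), of "\<lambda>i. c i *\<^sub>R f i"]
  proof eventually_elim
    case (elim x)
    have "rep (\<Sum>i\<in>I. c i *\<^sub>R f i) x = (\<Sum>i\<in>I. of_real (c i) * of_real (cmod (rep (f i) x)))"
      unfolding elim(3) using elim(1,2) by (intro sum.cong) auto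
    also have "\<dots> = of_real (\<Sum>i\<in>I. c i * cmod (rep (f i) x))" by simp
    finally show ?case using assms(3) by (simp add: sum_nonneg del: of_real_sum of_real_mult)
  qed
qed

lemma cmod_rep_add:
  assumes "f \<in> pos_cone" "g \<in> pos_cone"
  shows "AE x in M. cmod (rep (f + g) x) = cmod (rep f x) + cmod (rep g x)"
  using rep_add[of f g] coneD[OF assms(1)] coneD[OF assms(2)]
proof eventually_elim
  case (elim x)
  have "rep (f + g) x = of_real (cmod (rep f x) + cmod (rep g x))" using elim by simp
  then show ?case by (simp del: of_real_add)
qed

lemma cone_diff_iff:
  assumes "f \<in> pos_cone" "g \<in> pos_cone"
  shows "f - g \<in> pos_cone \<longleftrightarrow> (AE x in M. cmod (rep g x) \<le> cmod (rep f x))"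
proof -
  have "AE x in M. (rep (f - g) x \<in> \<real>\<^sub>\<ge>\<^sub>0) = (cmod (rep g x) \<le> cmod (rep f x))"
    using rep_diff[of f g] coneD[OF assms(1)] coneD[OF assms(2)]
  proof eventually_elim
    case (elim x)
    have "rep (f - g) x = of_real (cmod (rep f x) - cmod (rep g x))" using elim by simp
    then show ?case by (simp del: of_real_diff)
  qed
  then show ?thesis unfolding positive_cone_def mem_Collect_eq by (rule eventually_subst)
qed

text \<open>Norm convergence gives no a.e. limit at once, so the defect |l - |l|| is estimated in
  norm: it is at most 2 |l - f n|, because f n equals its modulus, and hence it vanishes.\<close>

lemma cone_limit:
  assumes f: "\<And>n. f n \<in> pos_cone" and lim: "f \<longlonglongrightarrow> l"
  shows "l \<in> pos_cone"
proof -
  define u where "u x = cmod (rep l x - of_real (cmod (rep l x)))" for x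
  \<comment> \<open>This crude bound serves to represent the defect by an element of L.\<close>
  have "AE x in M. u x \<le> cmod (rep (2 *\<^sub>R l) x)"
    using rep_scaleR[of 2 l]
  proof eventually_elim
    case (elim x)
    have "u x \<le> cmod (rep l x) + cmod (of_real (cmod (rep l x)))"
      unfolding u_def by (rule norm_triangle_ineq4)
    then show ?case using elim by (simp add: norm_mult)
  qed
  then obtain h where h: "AE x in M. rep h x = of_real (u x)"
    using obtain_positive[of u "2 *\<^sub>R l"] unfolding u_def by auto
  have "norm h \<le> norm (2 *\<^sub>R (l - f n))" for n
  proof (rule norm_mono)
    show "AE x in M. cmod (rep h x) \<le> cmod (rep (2 *\<^sub>R (l - f n)) x)"
      using h rep_scaleR[of 2 "l - f n"] rep_diff[of l "f n"] coneD[OF f[of n]]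
    proof eventually_elim
      case (elim x)
      have "u x \<le> cmod (rep l x - rep (f n) x) + cmod (rep (f n) x - of_real (cmod (rep l x)))"
        using norm_triangle_ineq[of "rep l x - rep (f n) x" "rep (f n) x - of_real (cmod (rep l x))"]
        by (simp add: u_def)
      also have "rep (f n) x - of_real (cmod (rep l x)) = of_real (cmod (rep (f n) x) - cmod (rep l x))"
        using elim(4) by simp
      also have "cmod \<dots> \<le> cmod (rep l x - rep (f n) x)"
        using norm_triangle_ineq3[of "rep (f n) x" "rep l x"] by (simp add: norm_minus_commute del: of_real_diff)
      finally have "u x \<le> 2 * cmod (rep l x - rep (f n) x)" by simp
      also have "\<dots> = cmod (rep (2 *\<^sub>R (l - f n)) x)"
        unfolding elim(2,3) norm_mult by simp
      finally show ?case unfolding elim(1) by (simp add: u_def)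
    qed
  qed
  moreover have "(\<lambda>n. norm (2 *\<^sub>R (l - f n))) \<longlonglongrightarrow> norm (2 *\<^sub>R (l - l))"
    by (intro tendsto_intros lim)
  ultimately have "norm h \<le> norm (2 *\<^sub>R (l - l))"
    by (intro LIMSEQ_le_const) blast+
  then have "h = 0" by simp
  then show ?thesis
    unfolding cone_iff using h rep_zero by (auto simp: u_def elim: eventually_elim2)
qed

text \<open>The tails of the series are norm limits of positive sums, hence positive, so the total
  dominates every partial sum a.e. This is what turns convergence in norm into convergence
  a.e.\<close>

lemma suminf_cone:
  assumes f: "\<And>n. f n \<in> pos_cone" and sum: "summable (\<lambda>n. norm (f n))"
  shows "suminf f \<in> pos_cone"
    and "AE x in M. \<forall>n. (\<Sum>i<n. cmod (rep (f i) x)) \<le> cmod (rep (suminf f) x)"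
proof -
  have S: "summable f" by (rule summable_norm_cancel[OF sum])
  then have lim: "(\<lambda>n. \<Sum>i<n. f i) \<longlonglongrightarrow> suminf f" by (rule summable_LIMSEQ)
  show pos_cone: "suminf f \<in> pos_cone"
    using f by (intro cone_limit[OF _ lim] cone_sum)
  have "AE x in M. (\<Sum>i<n. cmod (rep (f i) x)) \<le> cmod (rep (suminf f) x)" for n
  proof -
    have "suminf f - (\<Sum>i<n. f i) \<in> pos_cone"
    proof (rule cone_limit)
      show "(\<lambda>k. (\<Sum>i<k + n. f i) - (\<Sum>i<n. f i)) \<longlonglongrightarrow> suminf f - (\<Sum>i<n. f i)"
        by (intro tendsto_intros LIMSEQ_ignore_initial_segment lim)
      have "(\<Sum>i<k + n. f i) - (\<Sum>i<n. f i) = (\<Sum>i\<in>{n..<k + n}. f i)" for k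
        using sum.atLeastLessThan_concat[of 0 n "k + n" f] by (simp add: lessThan_atLeast0 algebra_simps)
      then show "(\<Sum>i<k + n. f i) - (\<Sum>i<n. f i) \<in> pos_cone" for k
        using f by (simp add: cone_sum)
    qed
    moreover have "(\<Sum>i<n. f i) \<in> pos_cone" using f by (intro cone_sum)
    ultimately have "AE x in M. cmod (rep (\<Sum>i<n. f i) x) \<le> cmod (rep (suminf f) x)"
      using cone_diff_iff[OF pos_cone] by simp
    moreover have "AE x in M. cmod (rep (\<Sum>i<n. f i) x) = (\<Sum>i<n. cmod (rep (f i) x))"
      using cmod_rep_sum[of "{..<n}" f "\<lambda>_. 1"] f by simp
    ultimately show ?thesis by eventually_elim simp
  qed
  then show "AE x in M. \<forall>n. (\<Sum>i<n. cmod (rep (f i) x)) \<le> cmod (rep (suminf f) x)"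
    by (simp add: AE_all_countable)
qed

lemma summable_rep:
  assumes "\<And>n. f n \<in> pos_cone" "summable (\<lambda>n. norm (f n))"
  shows "AE x in M. summable (\<lambda>n. cmod (rep (f n) x))"
  using suminf_cone(2)[OF assms]
  by eventually_elim (auto intro!: summableI_nonneg_bounded)

text \<open>The scaled mean inequality bounds |h| by a linear combination of the \<open>g j\<close>,
  to which monotonicity of the norm and the triangle inequality apply. It is Hoelder's inequality
  for an arbitrary lattice norm.\<close>

lemma norm_geometric_mean_le:
  fixes \<alpha> t :: "'i \<Rightarrow> real" and g :: "'i \<Rightarrow> 'l"
  assumes fin: "finite J" and \<alpha>: "\<And>j. j \<in> J \<Longrightarrow> \<alpha> j > 0" and sum: "(\<Sum>j\<in>J. \<alpha> j) = 1"
    and g: "\<And>j. j \<in> J \<Longrightarrow> g j \<in> pos_cone" and t: "\<And>j. j \<in> J \<Longrightarrow> 0 < t j"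
    and norm_g: "\<And>j. j \<in> J \<Longrightarrow> norm (g j) \<le> t j * s"
    and le: "AE x in M. cmod (rep h x) \<le> (\<Prod>j\<in>J. cmod (rep (g j) x) powr \<alpha> j)"
  shows "norm h \<le> (\<Prod>j\<in>J. t j powr \<alpha> j) * s"
proof -
  define T where "T = (\<Prod>j\<in>J. t j powr \<alpha> j)"
  have T: "T \<ge> 0" unfolding T_def by (intro prod_nonneg) auto
  have c: "0 \<le> T * (\<alpha> j / t j)" if "j \<in> J" for j
    using T \<alpha>[OF that] t[OF that] by simp
  have S: "AE x in M. cmod (rep (\<Sum>j\<in>J. (T * (\<alpha> j / t j)) *\<^sub>R g j) x) =
      (\<Sum>j\<in>J. T * (\<alpha> j / t j) * cmod (rep (g j) x))"
    using fin g c by (rule cmod_rep_sum)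
  have "norm h \<le> norm (\<Sum>j\<in>J. (T * (\<alpha> j / t j)) *\<^sub>R g j)"
  proof (rule norm_mono)
    show "AE x in M. cmod (rep h x) \<le> cmod (rep (\<Sum>j\<in>J. (T * (\<alpha> j / t j)) *\<^sub>R g j) x)"
      using le S
    proof eventually_elim
      case (elim x)
      note elim(1)
      also have "(\<Prod>j\<in>J. cmod (rep (g j) x) powr \<alpha> j) \<le> T * (\<Sum>j\<in>J. \<alpha> j * (cmod (rep (g j) x) / t j))"
        unfolding T_def by (rule weighted_geometric_le_scaled_arithmetic[OF fin \<alpha> sum norm_ge_zero t])
      also have "\<dots> = (\<Sum>j\<in>J. T * (\<alpha> j / t j) * cmod (rep (g j) x))"
        by (simp add: sum_distrib_left mult.assoc)
      finally show ?case unfolding elim(2) .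
    qed
  qed
  also have "\<dots> \<le> (\<Sum>j\<in>J. T * (\<alpha> j / t j) * (t j * s))"
  proof (rule sum_norm_le)
    fix j assume j: "j \<in> J"
    have "norm ((T * (\<alpha> j / t j)) *\<^sub>R g j) = T * (\<alpha> j / t j) * norm (g j)"
      using c[OF j] by (simp only: norm_scaleR abs_of_nonneg)
    also have "\<dots> \<le> T * (\<alpha> j / t j) * (t j * s)"
      using c[OF j] norm_g[OF j] by (intro mult_left_mono)
    finally show "norm ((T * (\<alpha> j / t j)) *\<^sub>R g j) \<le> T * (\<alpha> j / t j) * (t j * s)" .
  qed
  also have "\<dots> = (\<Sum>j\<in>J. \<alpha> j * (T * s))"
  proof (rule sum.cong[OF refl])
    fix j assume "j \<in> J"
    then have "t j \<noteq> 0" using t by force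
    then show "T * (\<alpha> j / t j) * (t j * s) = \<alpha> j * (T * s)" by simp
  qed
  also have "\<dots> = T * s" by (simp add: sum flip: sum_distrib_right)
  finally show ?thesis by (simp add: T_def)
qed

text \<open>Encodes positivity together with |A f| \<le> A |f| for complex f, with any positive
  majorant \<open>g\<close> in place of the modulus.\<close>

definition modulus_bounded :: "('l \<Rightarrow>\<^sub>L 'l) \<Rightarrow> bool" where
  "modulus_bounded A \<longleftrightarrow> (\<forall>f g. g \<in> pos_cone \<longrightarrow> (AE x in M. cmod (rep f x) \<le> cmod (rep g x)) \<longrightarrow>
    A g \<in> pos_cone \<and> (AE x in M. cmod (rep (A f) x) \<le> cmod (rep (A g) x)))"

lemma modulus_boundedD:
  assumes "modulus_bounded A" "g \<in> pos_cone"
  shows "A g \<in> pos_cone"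
    and "(AE x in M. cmod (rep f x) \<le> cmod (rep g x)) \<Longrightarrow> AE x in M. cmod (rep (A f) x) \<le> cmod (rep (A g) x)"
  using assms unfolding modulus_bounded_def by blast+

lemma modulus_bounded_compose:
  assumes "modulus_bounded A" "modulus_bounded B"
  shows "modulus_bounded (A o\<^sub>L B)"
  unfolding modulus_bounded_def blinfun_apply_blinfun_compose
  by (intro allI impI conjI modulus_boundedD assms)

text \<open>This relation replaces the Hadamard mean: unlike the kernel formula it is visibly stable
  under composition, and it carries all the information needed for the norm inequalities.\<close>

definition geometric_mean_bounded ::
  "nat \<Rightarrow> (nat \<Rightarrow> real) \<Rightarrow> (nat \<Rightarrow> 'l \<Rightarrow>\<^sub>L 'l) \<Rightarrow> ('l \<Rightarrow>\<^sub>L 'l) \<Rightarrow> bool" where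
  "geometric_mean_bounded m \<alpha> C B \<longleftrightarrow> (\<forall>f g.
    (\<forall>j<m. g j \<in> pos_cone) \<longrightarrow>
    (AE x in M. cmod (rep f x) \<le> (\<Prod>j<m. cmod (rep (g j) x) powr \<alpha> j)) \<longrightarrow>
    (\<forall>j<m. C j (g j) \<in> pos_cone) \<and>
    (AE x in M. cmod (rep (B f) x) \<le> (\<Prod>j<m. cmod (rep (C j (g j)) x) powr \<alpha> j)))"

lemma geometric_mean_bounded_compose:
  assumes "geometric_mean_bounded m \<alpha> C B" "geometric_mean_bounded m \<alpha> C' B'"
  shows "geometric_mean_bounded m \<alpha> (\<lambda>j. C j o\<^sub>L C' j) (B o\<^sub>L B')"
  unfolding geometric_mean_bounded_def
proof (intro allI impI)
  fix f and g :: "nat \<Rightarrow> 'l"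
  assume "\<forall>j<m. g j \<in> pos_cone"
    "AE x in M. cmod (rep f x) \<le> (\<Prod>j<m. cmod (rep (g j) x) powr \<alpha> j)"
  then have "\<forall>j<m. C' j (g j) \<in> pos_cone"
    "AE x in M. cmod (rep (B' f) x) \<le> (\<Prod>j<m. cmod (rep (C' j (g j)) x) powr \<alpha> j)"
    using assms(2) unfolding geometric_mean_bounded_def by blast+
  then show "(\<forall>j<m. (C j o\<^sub>L C' j) (g j) \<in> pos_cone) \<and>
      (AE x in M. cmod (rep ((B o\<^sub>L B') f) x) \<le> (\<Prod>j<m. cmod (rep ((C j o\<^sub>L C' j) (g j)) x) powr \<alpha> j))"
    using assms(1)[unfolded geometric_mean_bounded_def, rule_format, of "\<lambda>j. C' j (g j)" "B' f"] by simp
qed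

text \<open>All functions are taken equal to \<open>p\<close>: as the exponents add up to 1, the
  product of the powers of |p| is |p|.\<close>

lemma geometric_mean_bounded_modulus:
  assumes gm: "geometric_mean_bounded m \<alpha> C B" and sum: "(\<Sum>j<m. \<alpha> j) = 1"
    and p: "p \<in> pos_cone" and le: "AE x in M. cmod (rep f x) \<le> cmod (rep p x)"
  shows "j < m \<Longrightarrow> C j p \<in> pos_cone"
    and "AE x in M. cmod (rep (B f) x) \<le> (\<Prod>j<m. cmod (rep (C j p) x) powr \<alpha> j)"
proof -
  have "(\<Prod>j<m. cmod (rep p x) powr \<alpha> j) = cmod (rep p x)" for x
    using sum by (intro prod_powr_const) auto
  then have *: "AE x in M. cmod (rep f x) \<le> (\<Prod>j<m. cmod (rep p x) powr \<alpha> j)"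
    using le by simp
  show "j < m \<Longrightarrow> C j p \<in> pos_cone"
    "AE x in M. cmod (rep (B f) x) \<le> (\<Prod>j<m. cmod (rep (C j p) x) powr \<alpha> j)"
    using gm[unfolded geometric_mean_bounded_def, rule_format, of "\<lambda>_. p" f] p * by auto
qed

lemma geometric_mean_bounded_norm_le:
  assumes gm: "geometric_mean_bounded m \<alpha> C B"
    and \<alpha>: "\<And>j. j < m \<Longrightarrow> \<alpha> j > 0" and sum: "(\<Sum>j<m. \<alpha> j) = 1"
  shows "norm B \<le> (\<Prod>j<m. norm (C j) powr \<alpha> j)"
proof (rule le_weighted_geometric_limit)
  fix t assume t: "\<And>j. j \<in> {..<m} \<Longrightarrow> norm (C j) < t j"
  show "norm B \<le> (\<Prod>j<m. t j powr \<alpha> j)"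
  proof (rule norm_blinfun_bound)
    fix f
    obtain p where p: "p \<in> pos_cone" "AE x in M. cmod (rep p x) = cmod (rep f x)" "norm p = norm f"
      by (rule obtain_modulus)
    have "AE x in M. cmod (rep f x) \<le> cmod (rep p x)" using p(2) by eventually_elim simp
    note gm' = geometric_mean_bounded_modulus[OF gm sum p(1) this]
    show "norm (B f) \<le> (\<Prod>j<m. t j powr \<alpha> j) * norm f"
    proof (rule norm_geometric_mean_le[OF _ _ sum _ _ _ gm'(2)])
      fix j assume j: "j \<in> {..<m}"
      show "C j p \<in> pos_cone" using gm'(1) j by simp
      show t0: "0 < t j" using le_less_trans[OF norm_ge_zero t[OF j]] .
      have "norm (C j p) \<le> norm (C j) * norm p" by (rule norm_blinfun)
      also have "\<dots> \<le> t j * norm f" using t[OF j] t0 p(3) by (intro mult_mono) auto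
      finally show "norm (C j p) \<le> t j * norm f" .
    qed (use \<alpha> in auto)
  qed (intro prod_nonneg, simp)
qed (use \<alpha> in auto)

end

section \<open>Positive kernel operators and Hadamard means\<close>

text \<open>Hoelder's inequality for several functions, with scales that decrease to the integrals;
  this covers vanishing integrals as well.\<close>

lemma integral_geometric_mean:
  fixes u :: "'i \<Rightarrow> 'a \<Rightarrow> real" and \<alpha> :: "'i \<Rightarrow> real"
  assumes fin: "finite J" and \<alpha>: "\<And>j. j \<in> J \<Longrightarrow> \<alpha> j > 0" and sum: "(\<Sum>j\<in>J. \<alpha> j) = 1"
    and int: "\<And>j. j \<in> J \<Longrightarrow> integrable M (u j)" and nonneg: "\<And>j x. j \<in> J \<Longrightarrow> 0 \<le> u j x"
  shows "integrable M (\<lambda>x. \<Prod>j\<in>J. u j x powr \<alpha> j)"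
    and "(\<integral>x. (\<Prod>j\<in>J. u j x powr \<alpha> j) \<partial>M) \<le> (\<Prod>j\<in>J. (\<integral>x. u j x \<partial>M) powr \<alpha> j)"
proof -
  have [measurable]: "u j \<in> borel_measurable M" if "j \<in> J" for j
    using int[OF that] by simp
  show I: "integrable M (\<lambda>x. \<Prod>j\<in>J. u j x powr \<alpha> j)"
  proof (rule Bochner_Integration.integrable_bound)
    show "integrable M (\<lambda>x. \<Sum>j\<in>J. \<alpha> j * u j x)"
      using int by (intro Bochner_Integration.integrable_sum integrable_mult_right)
    show "(\<lambda>x. \<Prod>j\<in>J. u j x powr \<alpha> j) \<in> borel_measurable M"
      by (intro borel_measurable_prod powr_real_measurable) auto
    show "AE x in M. norm (\<Prod>j\<in>J. u j x powr \<alpha> j) \<le> norm (\<Sum>j\<in>J. \<alpha> j * u j x)"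
    proof (rule AE_I2)
      fix x
      have "0 \<le> (\<Prod>j\<in>J. u j x powr \<alpha> j)" by (intro prod_nonneg) simp
      moreover have "(\<Prod>j\<in>J. u j x powr \<alpha> j) \<le> (\<Sum>j\<in>J. \<alpha> j * u j x)"
        using fin \<alpha> sum nonneg by (rule weighted_geometric_le_arithmetic)
      ultimately show "norm (\<Prod>j\<in>J. u j x powr \<alpha> j) \<le> norm (\<Sum>j\<in>J. \<alpha> j * u j x)" by simp
    qed
  qed
  show "(\<integral>x. (\<Prod>j\<in>J. u j x powr \<alpha> j) \<partial>M) \<le> (\<Prod>j\<in>J. (\<integral>x. u j x \<partial>M) powr \<alpha> j)"
  proof (rule le_weighted_geometric_limit[OF fin \<alpha>])
    show i0: "0 \<le> (\<integral>x. u j x \<partial>M)" if "j \<in> J" for j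
      using nonneg[OF that] by (intro integral_nonneg_AE) simp
    fix t assume t: "\<And>j. j \<in> J \<Longrightarrow> (\<integral>x. u j x \<partial>M) < t j"
    have t0: "0 < t j" if "j \<in> J" for j using i0[OF that] t[OF that] by simp
    define T where "T = (\<Prod>j\<in>J. t j powr \<alpha> j)"
    have T: "T \<ge> 0" unfolding T_def by (intro prod_nonneg) simp
    have "(\<integral>x. (\<Prod>j\<in>J. u j x powr \<alpha> j) \<partial>M) \<le> (\<integral>x. T * (\<Sum>j\<in>J. \<alpha> j * (u j x / t j)) \<partial>M)"
    proof (rule integral_mono[OF I])
      show "integrable M (\<lambda>x. T * (\<Sum>j\<in>J. \<alpha> j * (u j x / t j)))"
        using int by (intro integrable_mult_right Bochner_Integration.integrable_sum integrable_divide)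
      show "(\<Prod>j\<in>J. u j x powr \<alpha> j) \<le> T * (\<Sum>j\<in>J. \<alpha> j * (u j x / t j))" for x
        unfolding T_def using fin \<alpha> sum nonneg t0 by (rule weighted_geometric_le_scaled_arithmetic)
    qed
    also have "\<dots> = T * (\<Sum>j\<in>J. \<alpha> j * ((\<integral>x. u j x \<partial>M) / t j))"
      using int by (simp add: Bochner_Integration.integral_sum)
    also have "\<dots> \<le> T * (\<Sum>j\<in>J. \<alpha> j * 1)"
    proof (intro mult_left_mono sum_mono T)
      fix j assume j: "j \<in> J"
      show "(\<integral>x. u j x \<partial>M) / t j \<le> 1" using t[OF j] t0[OF j] by (simp add: divide_le_eq)
      show "0 \<le> \<alpha> j" using \<alpha>[OF j] by simp
    qed
    finally show "(\<integral>x. (\<Prod>j\<in>J. u j x powr \<alpha> j) \<partial>M) \<le> (\<Prod>j\<in>J. t j powr \<alpha> j)"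
      using sum by (simp add: T_def)
  qed
qed

context banach_function_space
begin

section \<open>Operators with a nonnegative real kernel\<close>

context
  fixes A and a :: "'a \<times> 'a \<Rightarrow> real"
  assumes kernel: "has_kernel M rep A (\<lambda>z. complex_of_real (a z))" and a_nonneg: "\<And>z. 0 \<le> a z"
begin

lemma kernel_measurable: "a \<in> borel_measurable (M \<Otimes>\<^sub>M M)"
proof -
  have "(\<lambda>z. complex_of_real (a z)) \<in> borel_measurable (M \<Otimes>\<^sub>M M)"
    using kernel unfolding has_kernel_def by blast
  then have "(\<lambda>z. Re (complex_of_real (a z))) \<in> borel_measurable (M \<Otimes>\<^sub>M M)"
    by measurable
  then show ?thesis by simp
qed

lemma kernel_apply:
  "AE x in M. integrable M (\<lambda>y. complex_of_real (a (x, y)) * rep f y) \<and>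
    rep (A f) x = (\<integral>y. complex_of_real (a (x, y)) * rep f y \<partial>M)"
  using kernel unfolding has_kernel_def by blast

lemma kernel_integrable_cmod: "AE x in M. integrable M (\<lambda>y. a (x, y) * cmod (rep f y))"
  using kernel_apply[of f]
proof eventually_elim
  case (elim x)
  have "integrable M (\<lambda>y. norm (complex_of_real (a (x, y)) * rep f y))"
    using conjunct1[OF elim] by (rule integrable_norm)
  then show ?case using a_nonneg by (simp add: norm_mult)
qed

lemma kernel_apply_le: "AE x in M. cmod (rep (A f) x) \<le> (\<integral>y. a (x, y) * cmod (rep f y) \<partial>M)"
  using kernel_apply[of f]
proof eventually_elim
  case (elim x)
  have "cmod (rep (A f) x) \<le> (\<integral>y. norm (complex_of_real (a (x, y)) * rep f y) \<partial>M)"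
    unfolding conjunct2[OF elim] by (rule integral_norm_bound)
  then show ?case using a_nonneg by (simp add: norm_mult)
qed

lemma kernel_apply_pos:
  assumes f: "f \<in> pos_cone"
  shows "AE x in M. rep (A f) x = complex_of_real (\<integral>y. a (x, y) * cmod (rep f y) \<partial>M)"
  using kernel_apply[of f] kernel_integrable_cmod[of f]
proof eventually_elim
  case (elim x)
  have "(\<integral>y. complex_of_real (a (x, y)) * rep f y \<partial>M) = (\<integral>y. complex_of_real (a (x, y) * cmod (rep f y)) \<partial>M)"
  proof (rule integral_cong_AE)
    show "AE y in M. complex_of_real (a (x, y)) * rep f y = complex_of_real (a (x, y) * cmod (rep f y))"
      using coneD[OF f] by eventually_elim simp
    show "(\<lambda>y. complex_of_real (a (x, y)) * rep f y) \<in> borel_measurable M"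
      using conjunct1[OF elim(1)] by (rule borel_measurable_integrable)
    show "(\<lambda>y. complex_of_real (a (x, y) * cmod (rep f y))) \<in> borel_measurable M"
      using borel_measurable_integrable[OF elim(2)] by (rule measurable_compose) measurable
  qed
  then show ?case using elim by (simp del: of_real_mult)
qed

lemma kernel_apply_cone:
  assumes f: "f \<in> pos_cone"
  shows "A f \<in> pos_cone"
    and "AE x in M. cmod (rep (A f) x) = (\<integral>y. a (x, y) * cmod (rep f y) \<partial>M)"
proof -
  have nn: "0 \<le> (\<integral>y. a (x, y) * cmod (rep f y) \<partial>M)" for x
    using a_nonneg by (intro integral_nonneg_AE) simp
  show "A f \<in> pos_cone" using kernel_apply_pos[OF f] nn by (intro coneI) auto
  show "AE x in M. cmod (rep (A f) x) = (\<integral>y. a (x, y) * cmod (rep f y) \<partial>M)"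
    using kernel_apply_pos[OF f] by eventually_elim (use nn in simp)
qed

lemma kernel_modulus_bounded: "modulus_bounded A"
  unfolding modulus_bounded_def
proof (intro allI impI conjI)
  fix f g assume g: "g \<in> pos_cone" and le: "AE x in M. cmod (rep f x) \<le> cmod (rep g x)"
  show "A g \<in> pos_cone" by (rule kernel_apply_cone[OF g])
  show "AE x in M. cmod (rep (A f) x) \<le> cmod (rep (A g) x)"
    using kernel_apply_le[of f] kernel_apply_cone(2)[OF g]
      kernel_integrable_cmod[of f] kernel_integrable_cmod[of g]
  proof eventually_elim
    case (elim x)
    note elim(1)
    also have "(\<integral>y. a (x, y) * cmod (rep f y) \<partial>M) \<le> (\<integral>y. a (x, y) * cmod (rep g y) \<partial>M)"
      using elim(3,4)
    proof (rule integral_mono_AE)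
      show "AE y in M. a (x, y) * cmod (rep f y) \<le> a (x, y) * cmod (rep g y)"
        using le by eventually_elim (use a_nonneg in \<open>simp add: mult_left_mono\<close>)
    qed
    finally show ?case using elim(2) by simp
  qed
qed

end

text \<open>For fixed x, this is Hoelder's inequality in y for the functions a j (x, y) |g j y|: the
  product of their powers is the kernel of B times the product of the powers of the |g j|, which
  dominates |f|.\<close>

lemma hadamard_mean_geometric_mean_bounded:
  assumes mean: "hadamard_mean M rep \<alpha>s As B" and len: "length As = m"
    and \<alpha>: "\<And>j. j < m \<Longrightarrow> \<alpha>s ! j > 0" and sum: "(\<Sum>j<m. \<alpha>s ! j) = 1"
  shows "geometric_mean_bounded m (\<lambda>j. \<alpha>s ! j) (\<lambda>j. As ! j) B"
proof -
  obtain a :: "nat \<Rightarrow> 'a \<times> 'a \<Rightarrow> real" where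
    a: "\<And>j. j < m \<Longrightarrow> has_kernel M rep (As ! j) (\<lambda>z. complex_of_real (a j z))"
      "\<And>j z. j < m \<Longrightarrow> 0 \<le> a j z"
    and b: "has_kernel M rep B (\<lambda>z. complex_of_real (\<Prod>j<m. a j z powr (\<alpha>s ! j)))"
    using mean unfolding hadamard_mean_def len by blast
  have b0: "0 \<le> (\<Prod>j<m. a j z powr (\<alpha>s ! j))" for z by (intro prod_nonneg) simp
  show ?thesis
    unfolding geometric_mean_bounded_def
  proof (intro allI impI conjI)
    fix f and g :: "nat \<Rightarrow> 'l"
    assume g: "\<forall>j<m. g j \<in> pos_cone"
      and le: "AE x in M. cmod (rep f x) \<le> (\<Prod>j<m. cmod (rep (g j) x) powr (\<alpha>s ! j))"
    show "(As ! j) (g j) \<in> pos_cone" if "j < m" for j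
      using kernel_apply_cone(1)[OF a(1)[OF that] a(2)[OF that]] g that by blast
    have "AE x in M. \<forall>j\<in>{..<m}. cmod (rep ((As ! j) (g j)) x) = (\<integral>y. a j (x, y) * cmod (rep (g j) y) \<partial>M)"
      using kernel_apply_cone(2)[OF a(1) a(2)] g by (intro AE_finite_allI) auto
    moreover have "AE x in M. \<forall>j\<in>{..<m}. integrable M (\<lambda>y. a j (x, y) * cmod (rep (g j) y))"
      using kernel_integrable_cmod[OF a(1) a(2)] by (intro AE_finite_allI) auto
    ultimately show "AE x in M. cmod (rep (B f) x) \<le> (\<Prod>j<m. cmod (rep ((As ! j) (g j)) x) powr (\<alpha>s ! j))"
      using kernel_apply_le[OF b b0, of f] kernel_integrable_cmod[OF b b0, of f]
    proof eventually_elim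
      case (elim x)
      let ?u = "\<lambda>j y. a j (x, y) * cmod (rep (g j) y)"
      have u: "integrable M (\<lambda>y. \<Prod>j<m. ?u j y powr (\<alpha>s ! j))"
        "(\<integral>y. (\<Prod>j<m. ?u j y powr (\<alpha>s ! j)) \<partial>M) \<le> (\<Prod>j<m. (\<integral>y. ?u j y \<partial>M) powr (\<alpha>s ! j))"
        using integral_geometric_mean[of "{..<m}" "\<lambda>j. \<alpha>s ! j" M ?u] \<alpha> sum elim(2) a(2) by auto
      note elim(3)
      also have "(\<integral>y. (\<Prod>j<m. a j (x, y) powr (\<alpha>s ! j)) * cmod (rep f y) \<partial>M)
          \<le> (\<integral>y. (\<Prod>j<m. ?u j y powr (\<alpha>s ! j)) \<partial>M)"
        using elim(4) u(1)
      proof (rule integral_mono_AE)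
        show "AE y in M. (\<Prod>j<m. a j (x, y) powr (\<alpha>s ! j)) * cmod (rep f y) \<le> (\<Prod>j<m. ?u j y powr (\<alpha>s ! j))"
          using le
        proof eventually_elim
          case (elim y)
          have "(\<Prod>j<m. a j (x, y) powr (\<alpha>s ! j)) * cmod (rep f y)
              \<le> (\<Prod>j<m. a j (x, y) powr (\<alpha>s ! j)) * (\<Prod>j<m. cmod (rep (g j) y) powr (\<alpha>s ! j))"
            using elim b0 by (rule mult_left_mono)
          also have "\<dots> = (\<Prod>j<m. ?u j y powr (\<alpha>s ! j))"
            using a(2) by (simp add: powr_mult flip: prod.distrib)
          finally show ?case .
        qed
      qed
      also note u(2)
      also have "(\<Prod>j<m. (\<integral>y. ?u j y \<partial>M) powr (\<alpha>s ! j)) =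
          (\<Prod>j<m. cmod (rep ((As ! j) (g j)) x) powr (\<alpha>s ! j))"
        using elim(1) by (intro prod.cong) auto
      finally show ?case .
    qed
  qed
qed

end

section \<open>Compactness of integrable kernels\<close>

context sigma_finite_measure
begin

text \<open>The bound holds everywhere and not just a.e., so that functions can be compared
  pointwise without exceptional sets.\<close>

definition unit_functions :: "('a \<Rightarrow> complex) set" where
  "unit_functions = {\<theta> \<in> borel_measurable M. \<forall>x. cmod (\<theta> x) \<le> 1}"

text \<open>The L1 distance of the images of \<open>\<theta>\<close> and \<open>\<theta>'\<close>
  under the integral operator with kernel \<open>k\<close>; with extended values the outer integral
  is defined without an integrability condition.\<close>

definition kernel_distance :: "('a \<times> 'a \<Rightarrow> real) \<Rightarrow> ('a \<Rightarrow> complex) \<Rightarrow> ('a \<Rightarrow> complex) \<Rightarrow> ennreal" where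
  "kernel_distance k \<theta> \<theta>' =
    (\<integral>\<^sup>+x. ennreal (cmod (\<integral>y. complex_of_real (k (x, y)) * (\<theta> y - \<theta>' y) \<partial>M)) \<partial>M)"

text \<open>Total boundedness is expressed by colourings with finitely many colours, because these
  can be refined jointly; finite nets cannot.\<close>

definition compact_kernel :: "('a \<times> 'a \<Rightarrow> real) \<Rightarrow> bool" where
  "compact_kernel k \<longleftrightarrow> (\<forall>\<epsilon>>0. \<exists>col :: ('a \<Rightarrow> complex) \<Rightarrow> nat. finite (col ` unit_functions) \<and>
    (\<forall>\<theta>\<in>unit_functions. \<forall>\<theta>'\<in>unit_functions. col \<theta> = col \<theta>' \<longrightarrow>
      kernel_distance k \<theta> \<theta>' \<le> ennreal \<epsilon>))"

lemma compact_kernelD: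
  assumes "compact_kernel k" "\<epsilon> > 0"
  shows "\<exists>col :: ('a \<Rightarrow> complex) \<Rightarrow> nat. finite (col ` unit_functions) \<and>
    (\<forall>\<theta>\<in>unit_functions. \<forall>\<theta>'\<in>unit_functions. col \<theta> = col \<theta>' \<longrightarrow>
      kernel_distance k \<theta> \<theta>' \<le> ennreal \<epsilon>)"
  using assms by (simp add: compact_kernel_def)

lemma unit_functions_measurable: "\<theta> \<in> unit_functions \<Longrightarrow> \<theta> \<in> borel_measurable M"
  and unit_functions_le: "\<theta> \<in> unit_functions \<Longrightarrow> cmod (\<theta> x) \<le> 1"
  by (simp_all add: unit_functions_def)

lemma unit_functions_diff_le:
  "\<theta> \<in> unit_functions \<Longrightarrow> \<theta>' \<in> unit_functions \<Longrightarrow> cmod (\<theta> x - \<theta>' x) \<le> 2"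
  using norm_triangle_ineq4[of "\<theta> x" "\<theta>' x"] unit_functions_le[of \<theta> x] unit_functions_le[of \<theta>' x] by simp

lemma kernel_distance_le:
  assumes [measurable]: "k \<in> borel_measurable (M \<Otimes>\<^sub>M M)"
    and \<theta>: "\<theta> \<in> unit_functions" "\<theta>' \<in> unit_functions"
  shows "kernel_distance k \<theta> \<theta>' \<le> 2 * (\<integral>\<^sup>+z. ennreal \<bar>k z\<bar> \<partial>(M \<Otimes>\<^sub>M M))"
proof -
  have "ennreal (cmod (\<integral>y. complex_of_real (k (x, y)) * (\<theta> y - \<theta>' y) \<partial>M))
      \<le> (\<integral>\<^sup>+y. 2 * ennreal \<bar>k (x, y)\<bar> \<partial>M)" for x
  \<comment> \<open>A section that is not integrable has Bochner integral 0 by convention, which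
    makes the bound trivial.\<close>
  proof (cases "integrable M (\<lambda>y. complex_of_real (k (x, y)) * (\<theta> y - \<theta>' y))")
    case True
    then have "ennreal (cmod (\<integral>y. complex_of_real (k (x, y)) * (\<theta> y - \<theta>' y) \<partial>M))
        \<le> (\<integral>\<^sup>+y. ennreal (cmod (complex_of_real (k (x, y)) * (\<theta> y - \<theta>' y))) \<partial>M)"
      by (rule integral_norm_bound_ennreal)
    also have "\<dots> \<le> (\<integral>\<^sup>+y. 2 * ennreal \<bar>k (x, y)\<bar> \<partial>M)"
    proof (rule nn_integral_mono)
      fix y
      have "cmod (complex_of_real (k (x, y)) * (\<theta> y - \<theta>' y)) \<le> \<bar>k (x, y)\<bar> * 2"
        unfolding norm_mult norm_of_real using unit_functions_diff_le[OF \<theta>] by (intro mult_left_mono) auto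
      then have "ennreal (cmod (complex_of_real (k (x, y)) * (\<theta> y - \<theta>' y))) \<le> ennreal (2 * \<bar>k (x, y)\<bar>)"
        by (intro ennreal_leI) simp
      then show "ennreal (cmod (complex_of_real (k (x, y)) * (\<theta> y - \<theta>' y))) \<le> 2 * ennreal \<bar>k (x, y)\<bar>"
        by (simp add: ennreal_mult')
    qed
    finally show ?thesis .
  qed (simp add: not_integrable_integral_eq)
  then have "kernel_distance k \<theta> \<theta>' \<le> (\<integral>\<^sup>+x. \<integral>\<^sup>+y. 2 * ennreal \<bar>k (x, y)\<bar> \<partial>M \<partial>M)"
    unfolding kernel_distance_def by (intro nn_integral_mono)
  also have "\<dots> = (\<integral>\<^sup>+z. 2 * ennreal \<bar>k z\<bar> \<partial>(M \<Otimes>\<^sub>M M))"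
    by (rule nn_integral_fst) measurable
  also have "\<dots> = 2 * (\<integral>\<^sup>+z. ennreal \<bar>k z\<bar> \<partial>(M \<Otimes>\<^sub>M M))"
    by (rule nn_integral_cmult) measurable
  finally show ?thesis .
qed

lemma kernel_section_integrable:
  assumes k: "integrable (M \<Otimes>\<^sub>M M) k" and \<theta>: "\<theta> \<in> unit_functions" "\<theta>' \<in> unit_functions"
  shows "AE x in M. integrable M (\<lambda>y. complex_of_real (k (x, y)) * (\<theta> y - \<theta>' y))"
proof -
  interpret P: pair_sigma_finite M M ..
  have [measurable]: "\<theta> \<in> borel_measurable M" "\<theta>' \<in> borel_measurable M"
    using \<theta> by (auto intro: unit_functions_measurable)
  show ?thesis using P.AE_integrable_fst'[OF k]
  proof eventually_elim
    case (elim x)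
    have [measurable]: "(\<lambda>y. k (x, y)) \<in> borel_measurable M"
      using elim by (rule borel_measurable_integrable)
    show ?case
    proof (rule Bochner_Integration.integrable_bound)
      show "integrable M (\<lambda>y. 2 * k (x, y))" using elim by simp
      show "AE y in M. norm (complex_of_real (k (x, y)) * (\<theta> y - \<theta>' y)) \<le> norm (2 * k (x, y))"
      proof (rule AE_I2)
        fix y
        have "\<bar>k (x, y)\<bar> * cmod (\<theta> y - \<theta>' y) \<le> \<bar>k (x, y)\<bar> * 2"
          using unit_functions_diff_le[OF \<theta>] by (intro mult_left_mono) auto
        then show "norm (complex_of_real (k (x, y)) * (\<theta> y - \<theta>' y)) \<le> norm (2 * k (x, y))"
          by (simp add: norm_mult abs_mult)
      qed
    qed measurable
  qed
qed

lemma kernel_distance_add: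
  assumes k1: "integrable (M \<Otimes>\<^sub>M M) k1" and k2: "integrable (M \<Otimes>\<^sub>M M) k2"
    and \<theta>: "\<theta> \<in> unit_functions" "\<theta>' \<in> unit_functions"
  shows "kernel_distance (\<lambda>z. k1 z + k2 z) \<theta> \<theta>' \<le> kernel_distance k1 \<theta> \<theta>' + kernel_distance k2 \<theta> \<theta>'"
proof -
  have [measurable]: "\<theta> \<in> borel_measurable M" "\<theta>' \<in> borel_measurable M"
    "k1 \<in> borel_measurable (M \<Otimes>\<^sub>M M)" "k2 \<in> borel_measurable (M \<Otimes>\<^sub>M M)"
    using \<theta> k1 k2 by (auto intro: unit_functions_measurable)
  let ?I = "\<lambda>k x. (\<integral>y. complex_of_real (k (x, y)) * (\<theta> y - \<theta>' y) \<partial>M)"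
  have "kernel_distance (\<lambda>z. k1 z + k2 z) \<theta> \<theta>' \<le> (\<integral>\<^sup>+x. ennreal (cmod (?I k1 x)) + ennreal (cmod (?I k2 x)) \<partial>M)"
    unfolding kernel_distance_def
  proof (rule nn_integral_mono_AE)
    show "AE x in M. ennreal (cmod (?I (\<lambda>z. k1 z + k2 z) x)) \<le> ennreal (cmod (?I k1 x)) + ennreal (cmod (?I k2 x))"
      using kernel_section_integrable[OF k1 \<theta>] kernel_section_integrable[OF k2 \<theta>]
    proof eventually_elim
      case (elim x)
      have "?I (\<lambda>z. k1 z + k2 z) x = (\<integral>y. complex_of_real (k1 (x, y)) * (\<theta> y - \<theta>' y) +
          complex_of_real (k2 (x, y)) * (\<theta> y - \<theta>' y) \<partial>M)"
        by (simp add: algebra_simps)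
      also have "\<dots> = ?I k1 x + ?I k2 x" using elim by (rule Bochner_Integration.integral_add)
      finally show ?case
        using norm_triangle_ineq[of "?I k1 x" "?I k2 x"] by (simp add: ennreal_leI flip: ennreal_plus)
    qed
  qed
  also have "\<dots> = kernel_distance k1 \<theta> \<theta>' + kernel_distance k2 \<theta> \<theta>'"
    unfolding kernel_distance_def by (rule nn_integral_add) measurable
  finally show ?thesis .
qed

lemma kernel_distance_cmult:
  assumes [measurable]: "k \<in> borel_measurable (M \<Otimes>\<^sub>M M)"
    and \<theta>: "\<theta> \<in> unit_functions" "\<theta>' \<in> unit_functions"
  shows "kernel_distance (\<lambda>z. c * k z) \<theta> \<theta>' = ennreal \<bar>c\<bar> * kernel_distance k \<theta> \<theta>'"
proof -
  have [measurable]: "\<theta> \<in> borel_measurable M" "\<theta>' \<in> borel_measurable M"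
    using \<theta> by (auto intro: unit_functions_measurable)
  have "cmod (\<integral>y. complex_of_real (c * k (x, y)) * (\<theta> y - \<theta>' y) \<partial>M) =
      \<bar>c\<bar> * cmod (\<integral>y. complex_of_real (k (x, y)) * (\<theta> y - \<theta>' y) \<partial>M)" for x
    by (simp add: mult.assoc norm_mult)
  then show ?thesis
    unfolding kernel_distance_def by (simp add: ennreal_mult nn_integral_cmult)
qed

text \<open>The joint refinement of two colourings; \<open>prod_encode\<close> turns the pair of
  colours back into a natural number.\<close>

lemma compact_kernel_add:
  assumes k: "integrable (M \<Otimes>\<^sub>M M) k1" "integrable (M \<Otimes>\<^sub>M M) k2"
    and c: "compact_kernel k1" "compact_kernel k2"
  shows "compact_kernel (\<lambda>z. k1 z + k2 z)"
  unfolding compact_kernel_def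
proof (intro allI impI)
  fix \<epsilon> :: real assume e: "0 < \<epsilon>"
  then have e2: "\<epsilon> / 2 > 0" by simp
  obtain c1 :: "('a \<Rightarrow> complex) \<Rightarrow> nat" where c1: "finite (c1 ` unit_functions)"
    "\<forall>\<theta>\<in>unit_functions. \<forall>\<theta>'\<in>unit_functions. c1 \<theta> = c1 \<theta>' \<longrightarrow>
      kernel_distance k1 \<theta> \<theta>' \<le> ennreal (\<epsilon> / 2)"
    using compact_kernelD[OF c(1) e2] by (elim exE conjE) (rule that)
  obtain c2 :: "('a \<Rightarrow> complex) \<Rightarrow> nat" where c2: "finite (c2 ` unit_functions)"
    "\<forall>\<theta>\<in>unit_functions. \<forall>\<theta>'\<in>unit_functions. c2 \<theta> = c2 \<theta>' \<longrightarrow>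
      kernel_distance k2 \<theta> \<theta>' \<le> ennreal (\<epsilon> / 2)"
    using compact_kernelD[OF c(2) e2] by (elim exE conjE) (rule that)
  show "\<exists>col :: ('a \<Rightarrow> complex) \<Rightarrow> nat. finite (col ` unit_functions) \<and>
      (\<forall>\<theta>\<in>unit_functions. \<forall>\<theta>'\<in>unit_functions. col \<theta> = col \<theta>' \<longrightarrow>
        kernel_distance (\<lambda>z. k1 z + k2 z) \<theta> \<theta>' \<le> ennreal \<epsilon>)"
  proof (intro exI[of _ "\<lambda>\<theta>. prod_encode (c1 \<theta>, c2 \<theta>)"] conjI ballI impI)
    have "(\<lambda>\<theta>. prod_encode (c1 \<theta>, c2 \<theta>)) ` unit_functions
        \<subseteq> prod_encode ` ((c1 ` unit_functions) \<times> (c2 ` unit_functions))" by blast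
    then show "finite ((\<lambda>\<theta>. prod_encode (c1 \<theta>, c2 \<theta>)) ` unit_functions)"
      by (rule finite_subset) (intro finite_imageI finite_cartesian_product c1 c2)
    fix \<theta> \<theta>' assume \<theta>: "\<theta> \<in> unit_functions" "\<theta>' \<in> unit_functions"
      and eq: "prod_encode (c1 \<theta>, c2 \<theta>) = prod_encode (c1 \<theta>', c2 \<theta>')"
    have "kernel_distance (\<lambda>z. k1 z + k2 z) \<theta> \<theta>' \<le> kernel_distance k1 \<theta> \<theta>' + kernel_distance k2 \<theta> \<theta>'"
      using k \<theta> by (rule kernel_distance_add)
    also have "\<dots> \<le> ennreal (\<epsilon> / 2) + ennreal (\<epsilon> / 2)"
      using eq \<theta> c1(2) c2(2) by (intro add_mono) simp_all
    also have "\<dots> = ennreal \<epsilon>" using e by (simp flip: ennreal_plus)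
    finally show "kernel_distance (\<lambda>z. k1 z + k2 z) \<theta> \<theta>' \<le> ennreal \<epsilon>" .
  qed
qed

lemma compact_kernel_cmult:
  assumes k: "k \<in> borel_measurable (M \<Otimes>\<^sub>M M)" and c: "compact_kernel k"
  shows "compact_kernel (\<lambda>z. c * k z)"
  unfolding compact_kernel_def
proof (intro allI impI)
  fix \<epsilon> :: real assume e: "0 < \<epsilon>"
  then have e2: "\<epsilon> / (\<bar>c\<bar> + 1) > 0" by simp
  obtain col :: "('a \<Rightarrow> complex) \<Rightarrow> nat" where col: "finite (col ` unit_functions)"
    "\<forall>\<theta>\<in>unit_functions. \<forall>\<theta>'\<in>unit_functions. col \<theta> = col \<theta>' \<longrightarrow>
      kernel_distance k \<theta> \<theta>' \<le> ennreal (\<epsilon> / (\<bar>c\<bar> + 1))"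
    using compact_kernelD[OF c e2] by (elim exE conjE) (rule that)
  show "\<exists>col :: ('a \<Rightarrow> complex) \<Rightarrow> nat. finite (col ` unit_functions) \<and>
      (\<forall>\<theta>\<in>unit_functions. \<forall>\<theta>'\<in>unit_functions. col \<theta> = col \<theta>' \<longrightarrow>
        kernel_distance (\<lambda>z. c * k z) \<theta> \<theta>' \<le> ennreal \<epsilon>)"
  proof (intro exI[of _ col] conjI col(1) ballI impI)
    fix \<theta> \<theta>' assume \<theta>: "\<theta> \<in> unit_functions" "\<theta>' \<in> unit_functions" and eq: "col \<theta> = col \<theta>'"
    have "kernel_distance (\<lambda>z. c * k z) \<theta> \<theta>' \<le> ennreal \<bar>c\<bar> * ennreal (\<epsilon> / (\<bar>c\<bar> + 1))"
      unfolding kernel_distance_cmult[OF k \<theta>] using col(2)[rule_format, OF \<theta> eq] by (intro mult_left_mono) auto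
    also have "\<dots> = ennreal (\<bar>c\<bar> * (\<epsilon> / (\<bar>c\<bar> + 1)))" using e2 by (intro ennreal_mult[symmetric]) auto
    also have "\<dots> \<le> ennreal \<epsilon>" using e by (intro ennreal_leI) (simp add: divide_simps)
    finally show "kernel_distance (\<lambda>z. c * k z) \<theta> \<theta>' \<le> ennreal \<epsilon>" .
  qed
qed

text \<open>By dominated convergence some \<open>s n\<close> is close to \<open>k\<close> in L1 of
  the product measure, and its colouring serves for \<open>k\<close>.\<close>

lemma compact_kernel_limit:
  assumes k: "integrable (M \<Otimes>\<^sub>M M) k" and s: "\<And>n. integrable (M \<Otimes>\<^sub>M M) (s n)"
    and c: "\<And>n. compact_kernel (s n)" and w: "integrable (M \<Otimes>\<^sub>M M) w"
    and bound: "\<And>n z. z \<in> space (M \<Otimes>\<^sub>M M) \<Longrightarrow> \<bar>s n z\<bar> \<le> w z"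
    and lim: "\<And>z. z \<in> space (M \<Otimes>\<^sub>M M) \<Longrightarrow> (\<lambda>n. s n z) \<longlonglongrightarrow> k z"
  shows "compact_kernel k"
  unfolding compact_kernel_def
proof (intro allI impI)
  fix \<epsilon> :: real assume e: "0 < \<epsilon>"
  have "(\<integral>\<^sup>+z. ennreal (w z) \<partial>(M \<Otimes>\<^sub>M M)) \<le> (\<integral>\<^sup>+z. ennreal (norm (w z)) \<partial>(M \<Otimes>\<^sub>M M))"
    by (intro nn_integral_mono ennreal_leI) simp
  also have "\<dots> < \<infinity>" using w by (simp add: integrable_iff_bounded)
  finally have w': "(\<integral>\<^sup>+z. ennreal (w z) \<partial>(M \<Otimes>\<^sub>M M)) < \<infinity>" .
  have "(\<lambda>n. \<integral>\<^sup>+z. ennreal (norm (k z - s n z)) \<partial>(M \<Otimes>\<^sub>M M)) \<longlonglongrightarrow> 0"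
    using k s w bound lim w'
    by (intro nn_integral_dominated_convergence_norm[where w = w] AE_I2) auto
  \<comment> \<open>The difference of two unit functions can have modulus 2, so an L1 error below
    \<epsilon> / 4 contributes at most \<epsilon> / 2.\<close>
  moreover have e4: "0 < ennreal (\<epsilon> / 4)" using e by simp
  ultimately have "\<forall>\<^sub>F n in sequentially. (\<integral>\<^sup>+z. ennreal (norm (k z - s n z)) \<partial>(M \<Otimes>\<^sub>M M)) < ennreal (\<epsilon> / 4)"
    by (rule order_tendstoD(2))
  then obtain n where n: "(\<integral>\<^sup>+z. ennreal (norm (k z - s n z)) \<partial>(M \<Otimes>\<^sub>M M)) < ennreal (\<epsilon> / 4)"
    by (auto simp: eventually_sequentially)
  have e2: "\<epsilon> / 2 > 0" using e by simp
  obtain col :: "('a \<Rightarrow> complex) \<Rightarrow> nat" where col: "finite (col ` unit_functions)"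
    "\<forall>\<theta>\<in>unit_functions. \<forall>\<theta>'\<in>unit_functions. col \<theta> = col \<theta>' \<longrightarrow>
      kernel_distance (s n) \<theta> \<theta>' \<le> ennreal (\<epsilon> / 2)"
    using compact_kernelD[OF c[of n] e2] by (elim exE conjE) (rule that)
  show "\<exists>col :: ('a \<Rightarrow> complex) \<Rightarrow> nat. finite (col ` unit_functions) \<and>
      (\<forall>\<theta>\<in>unit_functions. \<forall>\<theta>'\<in>unit_functions. col \<theta> = col \<theta>' \<longrightarrow>
        kernel_distance k \<theta> \<theta>' \<le> ennreal \<epsilon>)"
  proof (intro exI[of _ col] conjI col(1) ballI impI)
    fix \<theta> \<theta>' assume \<theta>: "\<theta> \<in> unit_functions" "\<theta>' \<in> unit_functions" and eq: "col \<theta> = col \<theta>'"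
    have "kernel_distance k \<theta> \<theta>' = kernel_distance (\<lambda>z. s n z + (k z - s n z)) \<theta> \<theta>'" by simp
    also have "\<dots> \<le> kernel_distance (s n) \<theta> \<theta>' + kernel_distance (\<lambda>z. k z - s n z) \<theta> \<theta>'"
      using k s \<theta> by (intro kernel_distance_add) auto
    also have "\<dots> \<le> ennreal (\<epsilon> / 2) + 2 * (\<integral>\<^sup>+z. ennreal \<bar>k z - s n z\<bar> \<partial>(M \<Otimes>\<^sub>M M))"
      using col(2)[rule_format, OF \<theta> eq] k s \<theta> by (intro add_mono kernel_distance_le) auto
    also have "\<dots> \<le> ennreal (\<epsilon> / 2) + 2 * ennreal (\<epsilon> / 4)"
      using n by (intro add_left_mono mult_left_mono) auto
    also have "\<dots> = ennreal (\<epsilon> / 2) + ennreal (2 * (\<epsilon> / 4))" using e ennreal_mult'[of 2 "\<epsilon> / 4"] by simp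
    also have "\<dots> = ennreal \<epsilon>" using e by (simp flip: ennreal_plus)
    finally show "kernel_distance k \<theta> \<theta>' \<le> ennreal \<epsilon>" .
  qed
qed

lemma compact_kernel_zero: "compact_kernel (\<lambda>_. 0)"
  unfolding compact_kernel_def kernel_distance_def
  by (intro allI impI exI[of _ "\<lambda>_. 0"]) (auto simp: image_constant_conv)

text \<open>The operator has rank one: the image of \<theta> is the indicator of E times the number
  \<open>I \<theta>\<close>, and these numbers fill a bounded part of the plane. A colour is a cell
  of a square grid.\<close>

lemma compact_kernel_rectangle:
  assumes E: "E \<in> sets M" "emeasure M E < \<infinity>" and F: "F \<in> sets M" "emeasure M F < \<infinity>"
  shows "compact_kernel (indicator (E \<times> F))"
  unfolding compact_kernel_def
proof (intro allI impI)
  fix \<epsilon> :: real assume e: "0 < \<epsilon>"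
  define I where "I \<theta> = (\<integral>y. indicator F y * \<theta> y \<partial>M)" for \<theta> :: "'a \<Rightarrow> complex"
  have int: "integrable M (\<lambda>y. indicator F y * \<theta> y)" if \<theta>: "\<theta> \<in> unit_functions" for \<theta>
  proof (rule Bochner_Integration.integrable_bound)
    show "integrable M (indicator F :: 'a \<Rightarrow> real)" using F by simp
    show "(\<lambda>y. indicator F y * \<theta> y) \<in> borel_measurable M"
      using F unit_functions_measurable[OF \<theta>] by measurable
    show "AE y in M. norm (indicator F y * \<theta> y) \<le> norm (indicator F y :: real)"
      using unit_functions_le[OF \<theta>] by (intro AE_I2) (auto simp: indicator_def)
  qed
  define c where "c = measure M F"
  have I_le: "cmod (I \<theta>) \<le> c" if \<theta>: "\<theta> \<in> unit_functions" for \<theta>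
  proof -
    have "cmod (I \<theta>) \<le> (\<integral>y. cmod (indicator F y * \<theta> y) \<partial>M)"
      unfolding I_def by (rule integral_norm_bound)
    also have "\<dots> \<le> (\<integral>y. indicator F y \<partial>M)"
    proof (intro integral_mono integrable_norm int \<theta>)
      show "integrable M (indicator F :: 'a \<Rightarrow> real)" using F by simp
      show "cmod (indicator F y * \<theta> y) \<le> indicator F y" for y
        using unit_functions_le[OF \<theta>] by (auto simp: indicator_def)
    qed
    also have "\<dots> = c" using F by (simp add: c_def Int_absorb2 sets.sets_into_space)
    finally show ?thesis .
  qed
  have dist: "kernel_distance (indicator (E \<times> F)) \<theta> \<theta>' = ennreal (measure M E * cmod (I \<theta> - I \<theta>'))"
    if \<theta>: "\<theta> \<in> unit_functions" "\<theta>' \<in> unit_functions" for \<theta> \<theta>'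
  proof -
    have "(\<integral>y. complex_of_real (indicator (E \<times> F) (x, y)) * (\<theta> y - \<theta>' y) \<partial>M) =
        indicator E x * (I \<theta> - I \<theta>')" for x
    proof -
      have "(\<integral>y. complex_of_real (indicator (E \<times> F) (x, y)) * (\<theta> y - \<theta>' y) \<partial>M) =
          (\<integral>y. indicator E x * (indicator F y * \<theta> y - indicator F y * \<theta>' y) \<partial>M)"
        by (intro Bochner_Integration.integral_cong) (auto simp: indicator_def)
      also have "\<dots> = indicator E x * (I \<theta> - I \<theta>')"
        using int[OF \<theta>(1)] int[OF \<theta>(2)] by (simp add: I_def)
      finally show ?thesis .
    qed
    then have "kernel_distance (indicator (E \<times> F)) \<theta> \<theta>' =
        (\<integral>\<^sup>+x. ennreal (cmod (I \<theta> - I \<theta>')) * indicator E x \<partial>M)"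
      unfolding kernel_distance_def by (intro nn_integral_cong) (auto simp: indicator_def norm_mult)
    also have "\<dots> = ennreal (cmod (I \<theta> - I \<theta>')) * emeasure M E"
      using E by (simp add: nn_integral_cmult_indicator)
    also have "emeasure M E = ennreal (measure M E)"
      using E by (simp add: emeasure_eq_ennreal_measure)
    finally show ?thesis by (simp add: mult.commute flip: ennreal_mult)
  qed
  \<comment> \<open>\<open>b\<close> replaces the measure of E, which may be 0, as a divisor; the
    mesh \<open>\<eta>\<close> is chosen with \<open>b * (2 * \<eta>) = \<epsilon>\<close>.\<close>
  define b where "b = measure M E + 1"
  have b: "b > 0" "measure M E \<le> b" by (simp_all add: b_def add_nonneg_pos)
  define \<eta> where "\<eta> = \<epsilon> / (2 * b)"
  have \<eta>: "\<eta> > 0" using e b by (simp add: \<eta>_def)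
  define col :: "('a \<Rightarrow> complex) \<Rightarrow> nat"
    where "col \<theta> = to_nat (\<lfloor>Re (I \<theta>) / \<eta>\<rfloor>, \<lfloor>Im (I \<theta>) / \<eta>\<rfloor>)" for \<theta>
  show "\<exists>col :: ('a \<Rightarrow> complex) \<Rightarrow> nat. finite (col ` unit_functions) \<and>
      (\<forall>\<theta>\<in>unit_functions. \<forall>\<theta>'\<in>unit_functions. col \<theta> = col \<theta>' \<longrightarrow>
        kernel_distance (indicator (E \<times> F)) \<theta> \<theta>' \<le> ennreal \<epsilon>)"
  proof (intro exI[of _ col] conjI ballI impI)
    let ?R = "{\<lfloor>- c / \<eta>\<rfloor>..\<lfloor>c / \<eta>\<rfloor>}"
    have "\<lfloor>t / \<eta>\<rfloor> \<in> ?R" if "\<bar>t\<bar> \<le> c" for t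
    proof -
      have "- c / \<eta> \<le> t / \<eta>" "t / \<eta> \<le> c / \<eta>"
        using that \<eta> by (intro divide_right_mono; linarith)+
      then show ?thesis by (auto intro: floor_mono)
    qed
    then have "col ` unit_functions \<subseteq> to_nat ` (?R \<times> ?R)"
      using order_trans[OF abs_Re_le_cmod I_le] order_trans[OF abs_Im_le_cmod I_le]
      unfolding col_def by blast
    then show "finite (col ` unit_functions)" by (rule finite_subset) simp
    fix \<theta> \<theta>' assume \<theta>: "\<theta> \<in> unit_functions" "\<theta>' \<in> unit_functions" and eq: "col \<theta> = col \<theta>'"
    have close: "\<bar>s - t\<bar> \<le> \<eta>" if "\<lfloor>s / \<eta>\<rfloor> = \<lfloor>t / \<eta>\<rfloor>" for s t
    proof -
      have "\<bar>s / \<eta> - t / \<eta>\<bar> \<le> 1" using that by linarith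
      then show ?thesis using \<eta> by (simp add: abs_le_iff field_simps)
    qed
    have "\<lfloor>Re (I \<theta>) / \<eta>\<rfloor> = \<lfloor>Re (I \<theta>') / \<eta>\<rfloor>" "\<lfloor>Im (I \<theta>) / \<eta>\<rfloor> = \<lfloor>Im (I \<theta>') / \<eta>\<rfloor>"
      using eq by (auto simp: col_def)
    then have "cmod (I \<theta> - I \<theta>') \<le> \<eta> + \<eta>"
      using close cmod_le[of "I \<theta> - I \<theta>'"] by (smt (verit) minus_complex.sel)
    then have "measure M E * cmod (I \<theta> - I \<theta>') \<le> b * (2 * \<eta>)"
      using b by (intro mult_mono) auto
    also have "\<dots> = \<epsilon>" using b by (simp add: \<eta>_def)
    finally show "kernel_distance (indicator (E \<times> F)) \<theta> \<theta>' \<le> ennreal \<epsilon>"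
      unfolding dist[OF \<theta>] by (rule ennreal_leI)
  qed
qed

text \<open>Dynkin's argument, starting from the rectangles, which are stable under intersection.
  Cutting with a square of finite measure keeps complements integrable; countable disjoint unions
  are limits of finite ones.\<close>

lemma compact_kernel_indicator_Int:
  assumes E: "E \<in> sets M" "emeasure M E < \<infinity>" and A: "A \<in> sets (M \<Otimes>\<^sub>M M)"
  shows "compact_kernel (indicator (A \<inter> (E \<times> E)))"
proof -
  let ?P = "M \<Otimes>\<^sub>M M" and ?G = "{a \<times> b |a b. a \<in> sets M \<and> b \<in> sets M}" and ?\<Omega> = "space M \<times> space M"
  have ss: "sigma_sets ?\<Omega> ?G = sets ?P" by (simp add: sets_pair_measure)
  have EE: "E \<times> E \<in> sets ?P" "emeasure ?P (E \<times> E) < \<infinity>"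
    using E by (auto simp: emeasure_pair_measure_Times ennreal_mult_less_top)
  have int: "integrable ?P (indicator (A \<inter> (E \<times> E)) :: _ \<Rightarrow> real)" if "A \<in> sets ?P" for A
  proof (rule integrable_real_indicator)
    show "A \<inter> (E \<times> E) \<in> sets ?P" using that EE by auto
    have "emeasure ?P (A \<inter> (E \<times> E)) \<le> emeasure ?P (E \<times> E)"
      using EE by (intro emeasure_mono) auto
    then show "emeasure ?P (A \<inter> (E \<times> E)) < \<infinity>" using EE(2) by (rule order_le_less_trans)
  qed
  have "?G \<subseteq> Pow ?\<Omega>" using sets.sets_into_space by blast
  from Int_stable_pair_measure_generator this A[folded ss] show ?thesis
  proof (induction rule: sigma_sets_induct_disjoint)
    case (basic A)
    then obtain a b where ab: "A = a \<times> b" "a \<in> sets M" "b \<in> sets M" by blast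
    have "A \<inter> (E \<times> E) = (a \<inter> E) \<times> (b \<inter> E)" unfolding ab by blast
    moreover have "emeasure M (c \<inter> E) < \<infinity>" if "c \<in> sets M" for c
    proof -
      have "emeasure M (c \<inter> E) \<le> emeasure M E" using E that by (intro emeasure_mono) auto
      then show ?thesis using E(2) by (rule order_le_less_trans)
    qed
    ultimately show ?case using ab E by (auto intro!: compact_kernel_rectangle)
  next
    case empty
    show ?case by (simp add: compact_kernel_zero)
  next
    case (compl A)
    have A: "A \<in> sets ?P" using compl(1) unfolding ss .
    have eq: "indicator ((?\<Omega> - A) \<inter> (E \<times> E)) z =
        (indicator (E \<times> E) z + (- 1) * indicator (A \<inter> (E \<times> E)) z :: real)" for z
      using sets.sets_into_space[OF E(1)] by (auto simp: indicator_def)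
    have "compact_kernel (\<lambda>z. indicator (E \<times> E) z + (- 1) * indicator (A \<inter> (E \<times> E)) z)"
    proof (rule compact_kernel_add)
      show "integrable ?P (indicator (E \<times> E) :: _ \<Rightarrow> real)"
        using EE by (intro integrable_real_indicator)
      show "integrable ?P (\<lambda>z. (- 1) * indicator (A \<inter> (E \<times> E)) z :: real)"
        using int[OF A] by (rule integrable_mult_right)
      show "compact_kernel (indicator (E \<times> E))" using E by (intro compact_kernel_rectangle)
      show "compact_kernel (\<lambda>z. (- 1) * indicator (A \<inter> (E \<times> E)) z)"
        using borel_measurable_integrable[OF int[OF A]] compl(2) by (rule compact_kernel_cmult)
    qed
    then show ?case unfolding eq[abs_def, symmetric] .
  next
    case (union A)
    have A: "A i \<in> sets ?P" for i using union(2) unfolding ss by blast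
    let ?s = "\<lambda>n. indicator ((\<Union>i<n. A i) \<inter> (E \<times> E)) :: _ \<Rightarrow> real"
    have UN: "(\<Union>i<n. A i) \<in> sets ?P" for n using A by (intro sets.finite_UN) auto
    have "compact_kernel (?s n)" for n
    proof (induction n)
      case 0
      show ?case by (simp add: compact_kernel_zero)
    next
      case (Suc n)
      have disj: "A n \<inter> (\<Union>i<n. A i) = {}"
      proof -
        have "A n \<inter> A i = {}" if "i < n" for i
          using disjoint_family_onD[OF union(1), of n i] that by simp
        then show ?thesis by blast
      qed
      have "(\<Union>i<Suc n. A i) \<inter> (E \<times> E) = ((\<Union>i<n. A i) \<inter> (E \<times> E)) \<union> (A n \<inter> (E \<times> E))"
        unfolding lessThan_Suc by blast
      moreover have "((\<Union>i<n. A i) \<inter> (E \<times> E)) \<inter> (A n \<inter> (E \<times> E)) = {}" using disj by blast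
      ultimately have eq: "?s (Suc n) z = ?s n z + indicator (A n \<inter> (E \<times> E)) z" for z
        using indicator_add by metis
      show ?case
        unfolding eq[abs_def] using int[OF UN] int[OF A] Suc union(3) by (rule compact_kernel_add)
    qed
    then show ?case
    proof (rule compact_kernel_limit[where s = ?s and w = "indicator (E \<times> E)", rotated 2])
      show "integrable ?P (indicator ((\<Union>i. A i) \<inter> (E \<times> E)) :: _ \<Rightarrow> real)"
        using A by (intro int sets.countable_UN) auto
      show "integrable ?P (?s n)" for n by (rule int[OF UN])
      show "integrable ?P (indicator (E \<times> E) :: _ \<Rightarrow> real)"
        using EE by (intro integrable_real_indicator)
      show "\<bar>?s n z\<bar> \<le> indicator (E \<times> E) z" for n z by (auto simp: indicator_def)
      show "(\<lambda>n. ?s n z) \<longlonglongrightarrow> indicator ((\<Union>i. A i) \<inter> (E \<times> E)) z" for z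
      proof (cases "z \<in> (\<Union>i. A i) \<inter> (E \<times> E)")
        case True
        then obtain i where "z \<in> A i" by blast
        then have "\<forall>\<^sub>F n in sequentially. ?s n z = 1"
          using True by (intro eventually_sequentiallyI[of "Suc i"]) (auto simp: indicator_def Suc_le_eq)
        then show ?thesis using True by (simp add: tendsto_eventually)
      next
        case False
        then have "?s n z = 0" for n by (auto simp: indicator_def)
        then show ?thesis using False by simp
      qed
    qed
  qed
qed

text \<open>By sigma-finiteness, squares of finite measure exhaust the product space; the cut
  indicators converge, dominated by the indicator of \<open>A\<close>.\<close>

lemma compact_kernel_indicator:
  assumes A: "A \<in> sets (M \<Otimes>\<^sub>M M)" "emeasure (M \<Otimes>\<^sub>M M) A < \<infinity>"
  shows "compact_kernel (indicator A)"
proof -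
  obtain E :: "nat \<Rightarrow> 'a set" where E: "range E \<subseteq> sets M" "(\<Union>i. E i) = space M"
      "\<And>i. emeasure M (E i) \<noteq> \<infinity>" "incseq E"
    using sigma_finite_incseq by metis
  let ?s = "\<lambda>n. indicator (A \<inter> (E n \<times> E n)) :: _ \<Rightarrow> real"
  have Es: "E n \<in> sets M" for n using E(1) by blast
  have meas: "A \<inter> (E n \<times> E n) \<in> sets (M \<Otimes>\<^sub>M M)" for n using A Es by auto
  have int: "integrable (M \<Otimes>\<^sub>M M) (indicator A :: _ \<Rightarrow> real)"
    using A by (intro integrable_real_indicator)
  have "compact_kernel (?s n)" for n
    using Es E(3) A(1) by (intro compact_kernel_indicator_Int) (auto simp: top.not_eq_extremum)
  then show ?thesis
  proof (rule compact_kernel_limit[where s = ?s and w = "indicator A", rotated 2])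
    show "integrable (M \<Otimes>\<^sub>M M) (?s n)" for n
    proof (rule Bochner_Integration.integrable_bound[OF int])
      show "?s n \<in> borel_measurable (M \<Otimes>\<^sub>M M)" using meas by (rule borel_measurable_indicator)
    qed (auto simp: indicator_def)
    show "\<bar>?s n z\<bar> \<le> indicator A z" for n z by (auto simp: indicator_def)
    show "(\<lambda>n. ?s n z) \<longlonglongrightarrow> indicator A z" if z: "z \<in> space (M \<Otimes>\<^sub>M M)" for z
    proof -
      obtain x y where xy: "z = (x, y)" "x \<in> space M" "y \<in> space M"
        using z by (auto simp: space_pair_measure)
      then obtain i j where ij: "x \<in> E i" "y \<in> E j" using E(2) by blast
      have "x \<in> E n \<and> y \<in> E n" if "n \<ge> max i j" for n
        using ij incseqD[OF E(4), of i n] incseqD[OF E(4), of j n] that by auto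
      then have "\<forall>\<^sub>F n in sequentially. ?s n z = indicator A z"
        by (intro eventually_sequentiallyI[of "max i j"]) (auto simp: indicator_def xy)
      then show ?thesis by (rule tendsto_eventually)
    qed
  qed (rule int)+
qed

text \<open>Integrable kernels are limits of simple ones with majorant 2 |f|, so closure under sums,
  multiples and dominated limits reduces everything to indicators.\<close>

theorem compact_kernel_integrable:
  fixes k :: "'a \<times> 'a \<Rightarrow> real"
  assumes "integrable (M \<Otimes>\<^sub>M M) k"
  shows "compact_kernel k"
  using assms
proof (induction rule: integrable_induct)
  case (base A c)
  have "compact_kernel (\<lambda>z. c * indicator A z)"
    using base by (intro compact_kernel_cmult compact_kernel_indicator borel_measurable_indicator)
  then show ?case by (simp add: mult.commute)
next
  case (add f g)
  then show ?case by (intro compact_kernel_add)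
next
  case (lim f s)
  show ?case
  proof (rule compact_kernel_limit[where s = s and w = "\<lambda>z. 2 * \<bar>f z\<bar>"])
    show "integrable (M \<Otimes>\<^sub>M M) (\<lambda>z. 2 * \<bar>f z\<bar>)" using lim by simp
    show "\<bar>s n z\<bar> \<le> 2 * \<bar>f z\<bar>" if "z \<in> space (M \<Otimes>\<^sub>M M)" for n z
      using lim that by simp
  qed (use lim in auto)
qed

end

section \<open>Order continuity of the norm and order intervals\<close>

context banach_function_space
begin

text \<open>Writing h = \<theta> v with |\<theta>| \<le> 1 transports the functions dominated by v
  to the unit functions. The kernel \<rho>(x) a(x, y) v(y) is integrable, since its integral is that
  of \<rho> times A v.\<close>

lemma kernel_coloring:
  fixes a :: "'a \<times> 'a \<Rightarrow> real"
  assumes kernel: "has_kernel M rep A (\<lambda>z. complex_of_real (a z))" and a0: "\<And>z. 0 \<le> a z"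
    and v: "v \<in> pos_cone" and \<rho>[measurable]: "\<rho> \<in> borel_measurable M" and \<rho>0: "\<And>x. 0 \<le> \<rho> x"
    and int: "integrable M (\<lambda>x. \<rho> x * cmod (rep (A v) x))" and e: "\<epsilon> > 0"
  defines "S \<equiv> {h. AE x in M. cmod (rep h x) \<le> cmod (rep v x)}"
  shows "\<exists>col :: 'l \<Rightarrow> nat. finite (col ` S) \<and> (\<forall>h\<in>S. \<forall>h'\<in>S. col h = col h' \<longrightarrow>
    (\<integral>\<^sup>+x. ennreal (\<rho> x * cmod (rep (A h - A h') x)) \<partial>M) \<le> ennreal \<epsilon>)"
proof -
  have [measurable]: "a \<in> borel_measurable (M \<Otimes>\<^sub>M M)" by (rule kernel_measurable[OF kernel a0])
  define k where "k z = \<rho> (fst z) * (a z * cmod (rep v (snd z)))" for z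
  have k[measurable]: "k \<in> borel_measurable (M \<Otimes>\<^sub>M M)" unfolding k_def by measurable
  have "integrable (M \<Otimes>\<^sub>M M) k"
  proof (rule integrableI_bounded[OF k])
    have "(\<integral>\<^sup>+z. ennreal (norm (k z)) \<partial>(M \<Otimes>\<^sub>M M)) = (\<integral>\<^sup>+x. \<integral>\<^sup>+y. ennreal (norm (k (x, y))) \<partial>M \<partial>M)"
      by (rule nn_integral_fst[symmetric]) measurable
    also have "\<dots> = (\<integral>\<^sup>+x. ennreal (norm (\<rho> x * cmod (rep (A v) x))) \<partial>M)"
    proof (rule nn_integral_cong_AE)
      show "AE x in M. (\<integral>\<^sup>+y. ennreal (norm (k (x, y))) \<partial>M) = ennreal (norm (\<rho> x * cmod (rep (A v) x)))"
        using kernel_integrable_cmod[OF kernel a0, of v] kernel_apply_cone(2)[OF kernel a0 v]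
      proof eventually_elim
        case (elim x)
        have "(\<integral>\<^sup>+y. ennreal (norm (k (x, y))) \<partial>M) = (\<integral>\<^sup>+y. ennreal (\<rho> x * (a (x, y) * cmod (rep v y))) \<partial>M)"
          using \<rho>0 a0 by (simp add: k_def)
        also have "\<dots> = ennreal (\<integral>y. \<rho> x * (a (x, y) * cmod (rep v y)) \<partial>M)"
          using elim(1) \<rho>0 a0 by (intro nn_integral_eq_integral AE_I2) auto
        also have "\<dots> = ennreal (\<rho> x * cmod (rep (A v) x))" unfolding elim(2) by simp
        finally show ?case using \<rho>0 by (simp add: abs_mult)
      qed
    qed
    also have "\<dots> < \<infinity>" using int by (simp add: integrable_iff_bounded)
    finally show "(\<integral>\<^sup>+z. ennreal (norm (k z)) \<partial>(M \<Otimes>\<^sub>M M)) < \<infinity>" .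
  qed
  from compact_kernelD[OF compact_kernel_integrable[OF this] e]
  obtain col :: "('a \<Rightarrow> complex) \<Rightarrow> nat" where col: "finite (col ` unit_functions)"
    "\<forall>\<theta>\<in>unit_functions. \<forall>\<theta>'\<in>unit_functions. col \<theta> = col \<theta>' \<longrightarrow>
      kernel_distance k \<theta> \<theta>' \<le> ennreal \<epsilon>"
    by (elim exE conjE) (rule that)
  \<comment> \<open>The case distinction makes \<open>\<Theta> h\<close> a unit function everywhere.
    Where v vanishes, division by 0 gives 0, which is consistent because h vanishes there
    too.\<close>
  define \<Theta> where "\<Theta> h y = (if cmod (rep h y) \<le> cmod (rep v y) then rep h y / of_real (cmod (rep v y)) else 0)" for h y
  have \<Theta>: "\<Theta> h \<in> unit_functions" for h
  proof -
    have "\<Theta> h \<in> borel_measurable M" unfolding \<Theta>_def by measurable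
    moreover have "cmod (\<Theta> h y) \<le> 1" for y
      by (auto simp: \<Theta>_def norm_divide divide_le_eq)
    ultimately show ?thesis by (simp add: unit_functions_def)
  qed
  have mult: "AE y in M. of_real (cmod (rep v y)) * \<Theta> h y = rep h y" if "h \<in> S" for h
  proof -
    have "AE y in M. cmod (rep h y) \<le> cmod (rep v y)" using that by (simp add: S_def)
    then show ?thesis by eventually_elim (auto simp: \<Theta>_def)
  qed
  have dist: "kernel_distance k (\<Theta> h) (\<Theta> h') = (\<integral>\<^sup>+x. ennreal (\<rho> x * cmod (rep (A h - A h') x)) \<partial>M)"
    if h: "h \<in> S" "h' \<in> S" for h h'
    unfolding kernel_distance_def
  proof (rule nn_integral_cong_AE)
    show "AE x in M. ennreal (cmod (\<integral>y. complex_of_real (k (x, y)) * (\<Theta> h y - \<Theta> h' y) \<partial>M)) =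
        ennreal (\<rho> x * cmod (rep (A h - A h') x))"
      using kernel_apply[OF kernel a0, of h] kernel_apply[OF kernel a0, of h'] rep_diff[of "A h" "A h'"]
        kernel_integrable_cmod[OF kernel a0, of v] AE_space
    proof eventually_elim
      case (elim x)
      have [measurable]: "(\<lambda>y. k (x, y)) \<in> borel_measurable M" using elim(5) by measurable
      have [measurable]: "\<Theta> h \<in> borel_measurable M" "\<Theta> h' \<in> borel_measurable M"
        using \<Theta> unit_functions_measurable by auto
      have [measurable]: "(\<lambda>y. complex_of_real (a (x, y)) * rep h y) \<in> borel_measurable M"
        "(\<lambda>y. complex_of_real (a (x, y)) * rep h' y) \<in> borel_measurable M"
        using elim(1,2) by (auto intro: borel_measurable_integrable)
      have "(\<integral>y. complex_of_real (k (x, y)) * (\<Theta> h y - \<Theta> h' y) \<partial>M) =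
          (\<integral>y. of_real (\<rho> x) * (of_real (a (x, y)) * rep h y - of_real (a (x, y)) * rep h' y) \<partial>M)"
      proof (rule integral_cong_AE)
        show "AE y in M. complex_of_real (k (x, y)) * (\<Theta> h y - \<Theta> h' y) =
            of_real (\<rho> x) * (of_real (a (x, y)) * rep h y - of_real (a (x, y)) * rep h' y)"
          using mult[OF h(1)] mult[OF h(2)]
        proof eventually_elim
          case (elim y)
          have "complex_of_real (k (x, y)) * (\<Theta> h y - \<Theta> h' y) = of_real (\<rho> x) * of_real (a (x, y)) *
             (of_real (cmod (rep v y)) * \<Theta> h y - of_real (cmod (rep v y)) * \<Theta> h' y)"
            by (simp add: k_def algebra_simps)
          then show ?case unfolding elim by (simp add: algebra_simps)
        qed
      qed measurable
      also have "\<dots> = of_real (\<rho> x) * (rep (A h) x - rep (A h') x)"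
        using elim(1,2) by simp
      finally show ?case using elim(3) \<rho>0 by (simp add: norm_mult)
    qed
  qed
  show ?thesis
  proof (intro exI[of _ "\<lambda>h. col (\<Theta> h)"] conjI ballI impI)
    have "(\<lambda>h. col (\<Theta> h)) ` S \<subseteq> col ` unit_functions" using \<Theta> by blast
    then show "finite ((\<lambda>h. col (\<Theta> h)) ` S)" using col(1) by (rule finite_subset)
    show "(\<integral>\<^sup>+x. ennreal (\<rho> x * cmod (rep (A h - A h') x)) \<partial>M) \<le> ennreal \<epsilon>"
      if "h \<in> S" "h' \<in> S" "col (\<Theta> h) = col (\<Theta> h')" for h h'
      using col(2) \<Theta> that by (simp flip: dist)
  qed
qed

text \<open>Order continuity speaks of decreasing sequences, so |f n| is replaced by the supremum of
  its tail, which decreases to 0 a.e.\<close>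

lemma dominated_norm_tendsto_0:
  assumes oc: "order_continuous_norm pos_cone"
    and le: "\<And>n::nat. AE x in M. cmod (rep (f n) x) \<le> cmod (rep w x)"
    and lim: "AE x in M. (\<lambda>n. rep (f n) x) \<longlonglongrightarrow> 0"
  shows "(\<lambda>n. norm (f n)) \<longlonglongrightarrow> 0"
proof -
  \<comment> \<open>Cutting at |w| makes the bound hold everywhere, so that the suprema
    \<open>H n\<close> are finite at every point.\<close>
  define g where "g n x = min (cmod (rep (f n) x)) (cmod (rep w x))" for n x
  have [measurable]: "g n \<in> borel_measurable M" for n unfolding g_def by measurable
  have g0: "0 \<le> g n x" and gw: "g n x \<le> cmod (rep w x)" for n x by (simp_all add: g_def)
  define H where "H n x = (SUP k\<in>{n..}. g k x)" for n x
  have bdd: "bdd_above ((\<lambda>k. g k x) ` I)" for x I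
    using gw by (rule bdd_aboveI2)
  have H_upper: "g k x \<le> H n x" if "n \<le> k" for n k x
    unfolding H_def using that by (intro cSUP_upper bdd) simp
  have H_least: "H n x \<le> c" if "\<And>k. n \<le> k \<Longrightarrow> g k x \<le> c" for n x c
    unfolding H_def using that by (intro cSUP_least) auto
  have H0: "0 \<le> H n x" for n x using g0[of n x] H_upper[of n n x] by simp
  have [measurable]: "H n \<in> borel_measurable M" for n
    unfolding H_def by (rule borel_measurable_cSUP) (auto intro: bdd)
  have "\<exists>h. h \<in> pos_cone \<and> (AE x in M. rep h x = complex_of_real (H n x))" for n
  proof -
    have Hw: "H n x \<le> cmod (rep w x)" for x by (rule H_least[OF gw])
    have m: "H n \<in> borel_measurable M" by measurable
    show ?thesis
      by (rule obtain_positive[OF m AE_I2[OF H0] AE_I2[OF Hw]]) blast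
  qed
  then obtain h where h: "\<And>n. h n \<in> pos_cone" "\<And>n. AE x in M. rep (h n) x = complex_of_real (H n x)"
    by metis
  have ch: "AE x in M. cmod (rep (h n) x) = H n x" for n
    using h(2)[of n] by eventually_elim (simp add: H0)
  have "h n - h (Suc n) \<in> pos_cone" for n
    unfolding cone_diff_iff[OF h(1) h(1)] using ch[of n] ch[of "Suc n"]
  proof eventually_elim
    case (elim x)
    have "H (Suc n) x \<le> H n x" by (intro H_least H_upper) simp
    then show ?case using elim by simp
  qed
  \<comment> \<open>A lower bound b is below the pointwise limit 0 a.e.; that the nonnegative reals
    are closed in the complex plane also settles a b that is complex valued a priori.\<close>
  moreover have "0 - b \<in> pos_cone" if b: "\<And>n. h n - b \<in> pos_cone" for b
  proof -
    have "AE x in M. \<forall>n. rep (h n - b) x \<in> \<real>\<^sub>\<ge>\<^sub>0"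
      using b unfolding positive_cone_def AE_all_countable by simp
    moreover have "AE x in M. \<forall>n. rep (h n - b) x = rep (h n) x - rep b x"
      unfolding AE_all_countable using rep_diff by blast
    moreover have "AE x in M. \<forall>n. rep (h n) x = complex_of_real (H n x)"
      unfolding AE_all_countable using h(2) by blast
    ultimately have "AE x in M. rep (0 - b) x \<in> \<real>\<^sub>\<ge>\<^sub>0"
      using lim rep_diff[of 0 b] rep_zero
    proof eventually_elim
      case (elim x)
      have "(\<lambda>n. H n x) \<longlonglongrightarrow> 0"
      proof (rule LIMSEQ_I)
        fix r :: real assume r: "0 < r"
        obtain N where N: "\<And>n. n \<ge> N \<Longrightarrow> cmod (rep (f n) x) < r / 2"
          using LIMSEQ_D[OF elim(4), of "r / 2"] r by auto
        have "H n x \<le> r / 2" if "n \<ge> N" for n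
        proof (rule H_least)
          fix k assume "n \<le> k"
          then show "g k x \<le> r / 2" using N[of k] that unfolding g_def by linarith
        qed
        then show "\<exists>N. \<forall>n\<ge>N. norm (H n x - 0) < r" using H0 r by (intro exI[of _ N]) force
      qed
      then have "(\<lambda>n. complex_of_real (H n x) - rep b x) \<longlonglongrightarrow> of_real 0 - rep b x"
        by (intro tendsto_intros)
      then have lim': "(\<lambda>n. rep (h n - b) x) \<longlonglongrightarrow> of_real 0 - rep b x"
        using elim(2,3) by simp
      have "rep (h n - b) x \<in> \<real>\<^sub>\<ge>\<^sub>0" for n using elim(1) by simp
      from closed_sequentially[OF closed_nonneg_Reals_complex this lim']
      have "of_real 0 - rep b x \<in> \<real>\<^sub>\<ge>\<^sub>0" .
      then show ?case using elim(5,6) by simp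
    qed
    then show ?thesis by (simp add: positive_cone_def)
  qed
  ultimately have "(\<forall>n. h n \<in> pos_cone) \<and> (\<forall>n. h n - h (Suc n) \<in> pos_cone) \<and>
      (\<forall>g. (\<forall>n. h n - g \<in> pos_cone) \<longrightarrow> 0 - g \<in> pos_cone)"
    using h(1) by simp
  then have "(\<lambda>n. norm (h n)) \<longlonglongrightarrow> 0"
    by (rule oc[unfolded order_continuous_norm_def, THEN spec, THEN mp])
  moreover have "norm (f n) \<le> norm (h n)" for n
  proof (rule norm_mono)
    show "AE x in M. cmod (rep (f n) x) \<le> cmod (rep (h n) x)"
      using le[of n] ch[of n]
    proof eventually_elim
      case (elim x)
      then have "cmod (rep (f n) x) = g n x" by (simp add: g_def)
      then show ?case using H_upper[of n n x] elim by simp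
    qed
  qed
  ultimately show ?thesis
    by (intro real_tendsto_sandwich[OF _ _ tendsto_const, of 0 "\<lambda>n. norm (f n)" sequentially "\<lambda>n. norm (h n)"]
        always_eventually allI norm_ge_zero)
qed

section \<open>Comparison of the norm with a weighted integral on the functions dominated by
  w\<close>

context
  fixes w and \<rho> :: "'a \<Rightarrow> real"
  assumes \<rho>_measurable [measurable]: "\<rho> \<in> borel_measurable M" and \<rho>_pos: "\<And>x. 0 < \<rho> x"
    and \<rho>_integrable: "integrable M (\<lambda>x. \<rho> x * cmod (rep w x))"
begin

lemma weighted_integrable:
  assumes "AE x in M. cmod (rep h x) \<le> cmod (rep w x)"
  shows "integrable M (\<lambda>x. \<rho> x * cmod (rep h x))"
proof (rule Bochner_Integration.integrable_bound[OF \<rho>_integrable])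
  show "AE x in M. norm (\<rho> x * cmod (rep h x)) \<le> norm (\<rho> x * cmod (rep w x))"
    using assms
  proof eventually_elim
    case (elim x)
    then show ?case using \<rho>_pos[of x] by (simp add: abs_mult mult_left_mono)
  qed
qed measurable

text \<open>Otherwise a sequence tends to 0 in weighted L1 but stays away from 0 in norm; a
  subsequence tends to 0 a.e. below the majorant w, against order continuity.\<close>

lemma norm_small_if_integral_small:
  assumes oc: "order_continuous_norm pos_cone" and e: "\<epsilon> > 0"
  obtains \<eta> where "\<eta> > 0" "\<And>h. (AE x in M. cmod (rep h x) \<le> cmod (rep w x)) \<Longrightarrow>
    (\<integral>x. \<rho> x * cmod (rep h x) \<partial>M) \<le> \<eta> \<Longrightarrow> norm h < \<epsilon>"
proof (rule ccontr)
  assume "\<not> thesis"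
  then have "\<exists>h. (AE x in M. cmod (rep h x) \<le> cmod (rep w x)) \<and>
      (\<integral>x. \<rho> x * cmod (rep h x) \<partial>M) \<le> 1 / Suc n \<and> \<epsilon> \<le> norm h" for n
    using that[of "1 / Suc n"] by force
  then obtain h where h: "\<And>n. AE x in M. cmod (rep (h n) x) \<le> cmod (rep w x)"
    "\<And>n. (\<integral>x. \<rho> x * cmod (rep (h n) x) \<partial>M) \<le> 1 / Suc n" "\<And>n. \<epsilon> \<le> norm (h n)"
    by metis
  have nn: "norm (\<rho> x * cmod (rep (h n) x)) = \<rho> x * cmod (rep (h n) x)" for n x
    using \<rho>_pos[of x] by simp
  have "(\<lambda>n. \<integral>x. norm (\<rho> x * cmod (rep (h n) x)) \<partial>M) \<longlonglongrightarrow> 0"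
  proof (rule tendsto_sandwich[of "\<lambda>_. 0"])
    show "(\<lambda>n. 1 / real (Suc n)) \<longlonglongrightarrow> 0" by (rule LIMSEQ_Suc[OF lim_const_over_n])
    show "\<forall>\<^sub>F n in sequentially. (\<integral>x. norm (\<rho> x * cmod (rep (h n) x)) \<partial>M) \<le> 1 / real (Suc n)"
      unfolding nn using h(2) by (intro always_eventually allI)
  qed auto
  then obtain r where r: "strict_mono r" "AE x in M. (\<lambda>n. \<rho> x * cmod (rep (h (r n)) x)) \<longlonglongrightarrow> 0"
    using tendsto_L1_AE_subseq[of M "\<lambda>n x. \<rho> x * cmod (rep (h n) x)"] weighted_integrable[OF h(1)] by blast
  have "AE x in M. (\<lambda>n. rep (h (r n)) x) \<longlonglongrightarrow> 0"
    using r(2)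
  proof eventually_elim
    case (elim x)
    have "(\<lambda>n. (1 / \<rho> x) * (\<rho> x * cmod (rep (h (r n)) x))) \<longlonglongrightarrow> (1 / \<rho> x) * 0"
      using elim by (intro tendsto_mult tendsto_const)
    then show ?case using \<rho>_pos[of x] by (simp add: tendsto_norm_zero_iff)
  qed
  then have "(\<lambda>n. norm (h (r n))) \<longlonglongrightarrow> 0"
    using h(1) by (intro dominated_norm_tendsto_0[OF oc, where w = w])
  then have "\<epsilon> \<le> 0" by (rule LIMSEQ_le_const) (use h(3) in blast)
  then show False using e by simp
qed

text \<open>Otherwise there are counterexamples with norms below 2^(-n). Summability of the norms
  forces convergence to 0 a.e., and dominated convergence contradicts the lower bound on the
  integrals.\<close>

lemma norm_large_if_integral_large:
  assumes \<eta>: "\<eta> > 0"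
  obtains c where "c > 0" "\<And>h. (AE x in M. cmod (rep h x) \<le> cmod (rep w x)) \<Longrightarrow>
    \<eta> \<le> (\<integral>x. \<rho> x * cmod (rep h x) \<partial>M) \<Longrightarrow> c \<le> norm h"
proof (rule ccontr)
  assume "\<not> thesis"
  then have "\<exists>h. (AE x in M. cmod (rep h x) \<le> cmod (rep w x)) \<and>
      \<eta> \<le> (\<integral>x. \<rho> x * cmod (rep h x) \<partial>M) \<and> norm h < (1/2) ^ n" for n
    using that[of "(1/2) ^ n"] by force
  then obtain h where h: "\<And>n. AE x in M. cmod (rep (h n) x) \<le> cmod (rep w x)"
    "\<And>n. \<eta> \<le> (\<integral>x. \<rho> x * cmod (rep (h n) x) \<partial>M)" "\<And>n. norm (h n) < (1/2) ^ n"
    by metis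
  have "\<exists>p. p \<in> pos_cone \<and> (AE x in M. cmod (rep p x) = cmod (rep (h n) x)) \<and> norm p = norm (h n)" for n
    by (rule obtain_modulus[of "h n"]) blast
  then obtain p where p: "\<And>n. p n \<in> pos_cone" "\<And>n. AE x in M. cmod (rep (p n) x) = cmod (rep (h n) x)"
    "\<And>n. norm (p n) = norm (h n)"
    by metis
  have "summable (\<lambda>n. norm (p n))"
  proof (rule summable_comparison_test)
    show "\<exists>N. \<forall>n\<ge>N. norm (norm (p n)) \<le> (1/2) ^ n" using p(3) h(3) by (auto intro: less_imp_le)
  qed (simp add: summable_geometric)
  from summable_rep[OF p(1) this] have "AE x in M. (\<lambda>n. cmod (rep (p n) x)) \<longlonglongrightarrow> 0"
    by eventually_elim (rule summable_LIMSEQ_zero)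
  moreover have "AE x in M. \<forall>n. cmod (rep (p n) x) = cmod (rep (h n) x)"
    unfolding AE_all_countable using p(2) by blast
  ultimately have "AE x in M. (\<lambda>n. \<rho> x * cmod (rep (h n) x)) \<longlonglongrightarrow> 0"
    by eventually_elim (auto intro!: tendsto_mult_right_zero)
  then have "(\<lambda>n. \<integral>x. \<rho> x * cmod (rep (h n) x) \<partial>M) \<longlonglongrightarrow> (\<integral>x. 0 \<partial>M)"
  proof (rule integral_dominated_convergence[rotated 3])
    show "AE x in M. norm (\<rho> x * cmod (rep (h n) x)) \<le> \<rho> x * cmod (rep w x)" for n
      using h(1)[of n]
    proof eventually_elim
      case (elim x)
      then show ?case using \<rho>_pos[of x] by (simp add: abs_mult mult_left_mono)
    qed
  qed (use \<rho>_integrable in auto)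
  then have "\<eta> \<le> (\<integral>x. 0 \<partial>M)" by (rule LIMSEQ_le_const) (use h(2) in blast)
  then show False using \<eta> by simp
qed

end

text \<open>Sigma-finiteness provides a positive integrable function; dividing it by 1 + |w| makes w
  integrable against it.\<close>

lemma obtain_weight:
  obtains \<rho> :: "'a \<Rightarrow> real" where "\<rho> \<in> borel_measurable M" "\<And>x. 0 < \<rho> x"
    "integrable M (\<lambda>x. \<rho> x * cmod (rep w x))"
proof -
  obtain g :: "'a \<Rightarrow> real" where g: "g \<in> borel_measurable M" "\<And>x. g x > 0" "integrable M g"
    using obtain_positive_integrable_function by metis
  have [measurable]: "g \<in> borel_measurable M" by fact
  define \<rho> where "\<rho> x = g x / (1 + cmod (rep w x))" for x
  have pos: "1 + cmod (rep w x) > 0" for x by (simp add: add_pos_nonneg)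
  show ?thesis
  proof (rule that)
    show "\<rho> \<in> borel_measurable M" unfolding \<rho>_def by measurable
    show "0 < \<rho> x" for x using g(2) pos by (simp add: \<rho>_def)
    show "integrable M (\<lambda>x. \<rho> x * cmod (rep w x))"
    proof (rule Bochner_Integration.integrable_bound[OF g(3)])
      show "AE x in M. norm (\<rho> x * cmod (rep w x)) \<le> norm (g x)"
      proof (rule AE_I2)
        fix x
        have "g x * cmod (rep w x) \<le> g x * (1 + cmod (rep w x))"
          using g(2)[of x] by (intro mult_left_mono) auto
        then show "norm (\<rho> x * cmod (rep w x)) \<le> norm (g x)"
          using g(2)[of x] pos[of x] by (simp add: \<rho>_def abs_mult divide_le_eq)
      qed
    qed (unfold \<rho>_def, measurable)
  qed
qed

text \<open>This is AM-compactness: order bounded sets have totally bounded images.\<close>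

definition order_compact :: "('l \<Rightarrow>\<^sub>L 'l) \<Rightarrow> bool" where
  "order_compact A \<longleftrightarrow> (\<forall>v\<in>pos_cone. \<forall>\<epsilon>>0. \<exists>G. finite G \<and>
    (\<forall>h. (AE x in M. cmod (rep h x) \<le> cmod (rep v x)) \<longrightarrow> (\<exists>g\<in>G. norm (A h - g) \<le> \<epsilon>)))"

lemma order_compact_compose:
  assumes "order_compact A" "modulus_bounded B"
  shows "order_compact (A o\<^sub>L B)"
  unfolding order_compact_def
proof (intro ballI allI impI)
  fix v and \<epsilon> :: real assume v: "v \<in> pos_cone" and "0 < \<epsilon>"
  then obtain G where "finite G" "\<And>h. (AE x in M. cmod (rep h x) \<le> cmod (rep (B v) x)) \<Longrightarrow>
      (\<exists>g\<in>G. norm (A h - g) \<le> \<epsilon>)"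
    using assms(1) modulus_boundedD(1)[OF assms(2) v] unfolding order_compact_def by meson
  then show "\<exists>G. finite G \<and> (\<forall>h. (AE x in M. cmod (rep h x) \<le> cmod (rep v x)) \<longrightarrow>
      (\<exists>g\<in>G. norm ((A o\<^sub>L B) h - g) \<le> \<epsilon>))"
    using modulus_boundedD(2)[OF assms(2) v] by (intro exI[of _ G]) simp
qed

text \<open>The colouring controls differences of images in a weighted L1 norm; order continuity
  turns this into norm control, because these differences share a majorant.\<close>

lemma kernel_order_compact:
  fixes a :: "'a \<times> 'a \<Rightarrow> real"
  assumes oc: "order_continuous_norm pos_cone"
    and kernel: "has_kernel M rep A (\<lambda>z. complex_of_real (a z))" and a0: "\<And>z. 0 \<le> a z"
  shows "order_compact A"
  unfolding order_compact_def
proof (intro ballI allI impI)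
  fix v and \<epsilon> :: real assume v: "v \<in> pos_cone" and e: "0 < \<epsilon>"
  note mb = kernel_modulus_bounded[OF kernel a0]
  \<comment> \<open>The factor 2 appears because A h - A h' is dominated by twice A v.\<close>
  define w where "w = 2 *\<^sub>R A v"
  obtain \<rho> :: "'a \<Rightarrow> real" where [measurable]: "\<rho> \<in> borel_measurable M" and \<rho>0: "\<And>x. 0 < \<rho> x"
    and \<rho>int: "integrable M (\<lambda>x. \<rho> x * cmod (rep w x))"
    by (rule obtain_weight[of w]) blast
  note \<rho> = \<open>\<rho> \<in> borel_measurable M\<close> \<rho>0 \<rho>int
  obtain \<eta> where \<eta>: "\<eta> > 0" "\<And>h. (AE x in M. cmod (rep h x) \<le> cmod (rep w x)) \<Longrightarrow>
    (\<integral>x. \<rho> x * cmod (rep h x) \<partial>M) \<le> \<eta> \<Longrightarrow> norm h < \<epsilon>"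
    using norm_small_if_integral_small[OF \<rho> oc e] by metis
  have rw: "AE x in M. cmod (rep w x) = 2 * cmod (rep (A v) x)"
    unfolding w_def using rep_scaleR[of 2 "A v"] by eventually_elim (simp add: norm_mult)
  then have "AE x in M. cmod (rep (A v) x) \<le> cmod (rep w x)" by eventually_elim simp
  then have int: "integrable M (\<lambda>x. \<rho> x * cmod (rep (A v) x))"
    by (rule weighted_integrable[OF \<rho>])
  define S where "S = {h. AE x in M. cmod (rep h x) \<le> cmod (rep v x)}"
  obtain col :: "'l \<Rightarrow> nat" where col: "finite (col ` S)" "\<forall>h\<in>S. \<forall>h'\<in>S. col h = col h' \<longrightarrow>
    (\<integral>\<^sup>+x. ennreal (\<rho> x * cmod (rep (A h - A h') x)) \<partial>M) \<le> ennreal \<eta>"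
    using kernel_coloring[OF kernel a0 v \<rho>(1) less_imp_le[OF \<rho>(2)] int \<eta>(1), folded S_def]
    by (elim exE conjE) (rule that)
  have close: "norm (A h - A h') \<le> \<epsilon>" if h: "h \<in> S" "h' \<in> S" "col h = col h'" for h h'
  proof -
    have le: "AE x in M. cmod (rep (A h - A h') x) \<le> cmod (rep w x)"
      using modulus_boundedD(2)[OF mb v, of h] modulus_boundedD(2)[OF mb v, of h'] h rw
        rep_diff[of "A h" "A h'"] unfolding S_def mem_Collect_eq
    proof -
      assume *: "AE x in M. cmod (rep h x) \<le> cmod (rep v x) \<Longrightarrow> AE x in M. cmod (rep (A h) x) \<le> cmod (rep (A v) x)"
        "AE x in M. cmod (rep h' x) \<le> cmod (rep v x) \<Longrightarrow> AE x in M. cmod (rep (A h') x) \<le> cmod (rep (A v) x)"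
        "AE x in M. cmod (rep h x) \<le> cmod (rep v x)" "AE x in M. cmod (rep h' x) \<le> cmod (rep v x)"
      from *(1)[OF *(3)] *(2)[OF *(4)] rw rep_diff[of "A h" "A h'"]
      show ?thesis
      proof eventually_elim
        case (elim x)
        then show ?case using norm_triangle_ineq4[of "rep (A h) x" "rep (A h') x"] by simp
      qed
    qed
    have nn: "0 \<le> \<rho> x * cmod (rep (A h - A h') x)" for x using \<rho>(2)[of x] by simp
    have "ennreal (\<integral>x. \<rho> x * cmod (rep (A h - A h') x) \<partial>M) =
        (\<integral>\<^sup>+x. ennreal (\<rho> x * cmod (rep (A h - A h') x)) \<partial>M)"
      using nn by (intro nn_integral_eq_integral[symmetric] weighted_integrable[OF \<rho> le] AE_I2)
    also have "\<dots> \<le> ennreal \<eta>" using col(2) h by blast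
    finally have "(\<integral>x. \<rho> x * cmod (rep (A h - A h') x) \<partial>M) \<le> \<eta>"
      using \<eta>(1) by (simp add: ennreal_le_iff)
    then show ?thesis using \<eta>(2)[OF le] by simp
  qed
  \<comment> \<open>One member of each colour class provides the net; at numbers that are not
    colours the choice is arbitrary.\<close>
  define pick where "pick n = (SOME h. h \<in> S \<and> col h = n)" for n
  have pick: "pick (col h) \<in> S \<and> col (pick (col h)) = col h" if "h \<in> S" for h
    unfolding pick_def by (rule someI[of _ h]) (use that in simp)
  show "\<exists>G. finite G \<and> (\<forall>h. (AE x in M. cmod (rep h x) \<le> cmod (rep v x)) \<longrightarrow> (\<exists>g\<in>G. norm (A h - g) \<le> \<epsilon>))"
  proof (intro exI[of _ "(\<lambda>n. A (pick n)) ` col ` S"] conjI allI impI)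
    show "finite ((\<lambda>n. A (pick n)) ` col ` S)" using col(1) by (rule finite_imageI)
    fix h assume "AE x in M. cmod (rep h x) \<le> cmod (rep v x)"
    then have h: "h \<in> S" by (simp add: S_def)
    have "norm (A h - A (pick (col h))) \<le> \<epsilon>"
      using pick[OF h] h by (intro close) auto
    then show "\<exists>g\<in>(\<lambda>n. A (pick n)) ` col ` S. norm (A h - g) \<le> \<epsilon>" using h by blast
  qed
qed

end

section \<open>Positive functionals\<close>

text \<open>For gauges that are described by a set \<open>S x\<close> of admissible upper values
  rather than by a formula: sums and multiples of admissible values pass to the infima.\<close>

lemma sublinear_Inf:
  fixes S :: "'v::real_vector \<Rightarrow> real set"
  assumes ne: "\<And>x. S x \<noteq> {}" and bdd: "\<And>x. bdd_below (S x)"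
    and add: "\<And>x y s r. s \<in> S x \<Longrightarrow> r \<in> S y \<Longrightarrow> s + r \<in> S (x + y)"
    and scale: "\<And>c x s. c > 0 \<Longrightarrow> s \<in> S x \<Longrightarrow> c * s \<in> S (c *\<^sub>R x)"
  shows "sublinear (\<lambda>x. Inf (S x))"
  unfolding sublinear_def
proof (intro conjI allI impI)
  fix x y
  have "Inf (S (x + y)) - s \<le> Inf (S y)" if s: "s \<in> S x" for s
  proof (rule cInf_greatest[OF ne])
    fix r assume "r \<in> S y"
    then have "Inf (S (x + y)) \<le> s + r" by (intro cInf_lower bdd add s)
    then show "Inf (S (x + y)) - s \<le> r" by simp
  qed
  then have "Inf (S (x + y)) - Inf (S y) \<le> Inf (S x)"
    by (intro cInf_greatest[OF ne]) (simp add: algebra_simps)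
  then show "Inf (S (x + y)) \<le> Inf (S x) + Inf (S y)" by simp
next
  fix c :: real and x assume c: "c > 0"
  have "Inf (S (c *\<^sub>R x)) / c \<le> Inf (S x)"
  proof (rule cInf_greatest[OF ne])
    fix s assume "s \<in> S x"
    then have "Inf (S (c *\<^sub>R x)) \<le> c * s" by (intro cInf_lower bdd scale c)
    then show "Inf (S (c *\<^sub>R x)) / c \<le> s" using c by (simp add: field_simps)
  qed
  then show "Inf (S (c *\<^sub>R x)) \<le> c * Inf (S x)" using c by (simp add: field_simps)
qed

context banach_function_space
begin

abbreviation dual_cone :: "('l \<Rightarrow>\<^sub>L complex) set" where "dual_cone \<equiv> dual_positive_cone M rep"

lemma dual_coneD:
  assumes "\<Phi> \<in> dual_cone"
  shows "\<Phi> (c *\<^sub>C f) = c * \<Phi> f" and "f \<in> pos_cone \<Longrightarrow> \<Phi> f \<in> \<real>\<^sub>\<ge>\<^sub>0"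
  using assms unfolding dual_positive_cone_def by auto

lemma dual_cone_mono:
  assumes "\<Phi> \<in> dual_cone" "f \<in> pos_cone" "g \<in> pos_cone" "AE x in M. cmod (rep f x) \<le> cmod (rep g x)"
  shows "Re (\<Phi> f) \<le> Re (\<Phi> g)"
proof -
  have "g - f \<in> pos_cone" using cone_diff_iff[OF assms(3,2)] assms(4) by simp
  then have "\<Phi> (g - f) \<in> \<real>\<^sub>\<ge>\<^sub>0" by (rule dual_coneD(2)[OF assms(1)])
  then have "0 \<le> Re (\<Phi> (g - f))" by (simp add: complex_nonneg_Reals_iff)
  then show ?thesis by (simp add: blinfun.diff_right)
qed

text \<open>The usual complexification \<phi> f - i \<phi> (i f) has real part \<phi>; the
  assumption on i f for positive f makes its values on the cone real.\<close>

lemma positive_real_functional_complexify: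
  assumes lin: "linear \<phi>" and le: "\<And>f. \<phi> f \<le> norm f"
    and pos: "\<And>f. f \<in> pos_cone \<Longrightarrow> 0 \<le> \<phi> f"
    and imag: "\<And>f. f \<in> pos_cone \<Longrightarrow> \<phi> (\<i> *\<^sub>C f) = 0"
  obtains \<Phi> where "\<Phi> \<in> dual_cone" "\<And>f. Re (blinfun_apply \<Phi> f) = \<phi> f"
proof -
  define F where "F f = Complex (\<phi> f) (- \<phi> (\<i> *\<^sub>C f))" for f
  have abs: "\<bar>\<phi> f\<bar> \<le> norm f" for f
    using le[of f] le[of "- f"] linear_neg[OF lin, of f] by simp
  have F: "bounded_linear F"
  proof (rule bounded_linear_intro)
    show "F (f + g) = F f + F g" for f g
      by (simp add: F_def scaleC_add_right linear_add[OF lin] complex_eq_iff)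
    show "F (r *\<^sub>R f) = r *\<^sub>R F f" for r f
      by (simp add: F_def scaleC_scaleR linear_scale[OF lin] complex_eq_iff)
    show "norm (F f) \<le> norm f * 2" for f
    proof -
      have "norm (F f) \<le> \<bar>\<phi> f\<bar> + \<bar>\<phi> (\<i> *\<^sub>C f)\<bar>"
        using cmod_le[of "F f"] by (simp add: F_def)
      also have "\<dots> \<le> norm f + norm (\<i> *\<^sub>C f)" by (intro add_mono abs)
      finally show ?thesis by (simp add: norm_scaleC)
    qed
  qed
  have F_apply: "blinfun_apply (Blinfun F) = F" using F by (rule bounded_linear_Blinfun_apply)
  have cl: "F (c *\<^sub>C f) = c * F f" for c f
  proof -
    have "c = of_real (Re c) + of_real (Im c) * \<i>" by (simp add: complex_eq_iff)
    then have "c *\<^sub>C f = (of_real (Re c) + of_real (Im c) * \<i>) *\<^sub>C f" by simp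
    also have "\<dots> = Re c *\<^sub>R f + Im c *\<^sub>R (\<i> *\<^sub>C f)"
      by (simp only: scaleC_add_left scaleC_scaleC[symmetric] scaleC_of_real)
    finally have 1: "\<phi> (c *\<^sub>C f) = Re c * \<phi> f + Im c * \<phi> (\<i> *\<^sub>C f)"
      by (simp add: linear_add[OF lin] linear_scale[OF lin])
    have "\<i> * c = of_real (Re c) * \<i> + of_real (- Im c)" by (simp add: complex_eq_iff)
    then have "\<i> *\<^sub>C c *\<^sub>C f = (of_real (Re c) * \<i> + of_real (- Im c)) *\<^sub>C f"
      by (simp only: scaleC_scaleC)
    also have "\<dots> = Re c *\<^sub>R (\<i> *\<^sub>C f) + (- Im c) *\<^sub>R f"
      by (simp only: scaleC_add_left scaleC_scaleC[symmetric] scaleC_of_real)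
    finally have 2: "\<phi> (\<i> *\<^sub>C c *\<^sub>C f) = Re c * \<phi> (\<i> *\<^sub>C f) - Im c * \<phi> f"
      by (simp only: linear_add[OF lin] linear_scale[OF lin]) simp
    show ?thesis by (simp add: F_def 1 2 complex_eq_iff)
  qed
  show ?thesis
  proof (rule that[of "Blinfun F"])
    have "F f \<in> \<real>\<^sub>\<ge>\<^sub>0" if "f \<in> pos_cone" for f
      using pos[OF that] imag[OF that] by (simp add: F_def complex_nonneg_Reals_iff)
    then show "Blinfun F \<in> dual_cone"
      using cl by (simp add: dual_positive_cone_def F_apply)
    show "Re (blinfun_apply (Blinfun F) f) = \<phi> f" for f by (simp add: F_apply F_def)
  qed
qed

text \<open>The functional is obtained by separating the convex set of all \<open>h\<close> in the order interval
  \<open>[0, w]\<close> with \<open>\<integral> \<rho> h \<ge> \<eta>\<close>, which contains all \<open>h\<close> of norm at least \<open>\<epsilon>\<close>, from a ball.\<close>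

lemma obtain_positive_functional:
  assumes oc: "order_continuous_norm pos_cone" and e: "\<epsilon> > 0"
  obtains \<Phi> c where "\<Phi> \<in> dual_cone" "c > 0"
    "\<And>h. h \<in> pos_cone \<Longrightarrow> AE x in M. cmod (rep h x) \<le> cmod (rep w x) \<Longrightarrow> \<epsilon> \<le> norm h \<Longrightarrow>
      c \<le> Re (blinfun_apply \<Phi> h)"
proof -
  obtain \<rho> :: "'a \<Rightarrow> real" where [measurable]: "\<rho> \<in> borel_measurable M" and \<rho>0: "\<And>x. 0 < \<rho> x"
    and \<rho>int: "integrable M (\<lambda>x. \<rho> x * cmod (rep w x))"
    by (rule obtain_weight[of w]) blast
  note \<rho> = \<open>\<rho> \<in> borel_measurable M\<close> \<rho>0 \<rho>int
  obtain \<eta> where \<eta>: "\<eta> > 0" "\<And>h. (AE x in M. cmod (rep h x) \<le> cmod (rep w x)) \<Longrightarrow>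
    (\<integral>x. \<rho> x * cmod (rep h x) \<partial>M) \<le> \<eta> \<Longrightarrow> norm h < \<epsilon>"
    by (rule norm_small_if_integral_small[OF \<rho> oc e]) blast
  obtain c where c: "c > 0" "\<And>h. (AE x in M. cmod (rep h x) \<le> cmod (rep w x)) \<Longrightarrow>
    \<eta> \<le> (\<integral>x. \<rho> x * cmod (rep h x) \<partial>M) \<Longrightarrow> c \<le> norm h"
    by (rule norm_large_if_integral_large[OF \<rho> \<eta>(1)]) blast
  \<comment> \<open>For t > 0, \<open>K t\<close> is t times the convex set \<open>K 1\<close>;
    carrying t along keeps sums and multiples within the family.\<close>
  define K where "K t = {G \<in> pos_cone. (AE x in M. cmod (rep G x) \<le> t * cmod (rep w x)) \<and>
    t * \<eta> \<le> (\<integral>x. \<rho> x * cmod (rep G x) \<partial>M)}" for t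
  have K_int: "integrable M (\<lambda>x. \<rho> x * cmod (rep G x))" if "G \<in> K t" for G t
  proof (rule Bochner_Integration.integrable_bound)
    show "integrable M (\<lambda>x. t * (\<rho> x * cmod (rep w x)))" using \<rho>int by simp
    have "AE x in M. cmod (rep G x) \<le> t * cmod (rep w x)" using that by (simp add: K_def)
    then show "AE x in M. norm (\<rho> x * cmod (rep G x)) \<le> norm (t * (\<rho> x * cmod (rep w x)))"
    proof eventually_elim
      case (elim x)
      have "norm (\<rho> x * cmod (rep G x)) = \<rho> x * cmod (rep G x)" using \<rho>0[of x] by simp
      also have "\<dots> \<le> \<rho> x * (t * cmod (rep w x))" using elim \<rho>0[of x] by (intro mult_left_mono) auto
      also have "\<dots> \<le> norm (t * (\<rho> x * cmod (rep w x)))" by (simp add: algebra_simps)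
      finally show ?case .
    qed
  qed measurable
  have K_add: "G + G' \<in> K (t + t')" if G: "G \<in> K t" "G' \<in> K t'" for G G' t t'
  proof -
    have cone: "G \<in> pos_cone" "G' \<in> pos_cone" using G by (auto simp: K_def)
    note eq = cmod_rep_add[OF cone]
    have "AE x in M. cmod (rep G x) \<le> t * cmod (rep w x)" "AE x in M. cmod (rep G' x) \<le> t' * cmod (rep w x)"
      using G by (auto simp: K_def)
    then have "AE x in M. cmod (rep (G + G') x) \<le> (t + t') * cmod (rep w x)"
      using eq by eventually_elim (simp add: algebra_simps)
    moreover have "(\<integral>x. \<rho> x * cmod (rep (G + G') x) \<partial>M) =
        (\<integral>x. \<rho> x * cmod (rep G x) + \<rho> x * cmod (rep G' x) \<partial>M)"
    proof (rule integral_cong_AE)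
      show "AE x in M. \<rho> x * cmod (rep (G + G') x) = \<rho> x * cmod (rep G x) + \<rho> x * cmod (rep G' x)"
        using eq by eventually_elim (simp add: algebra_simps)
    qed measurable
    moreover have "\<dots> = (\<integral>x. \<rho> x * cmod (rep G x) \<partial>M) + (\<integral>x. \<rho> x * cmod (rep G' x) \<partial>M)"
      using K_int[OF G(1)] K_int[OF G(2)] by (rule Bochner_Integration.integral_add)
    ultimately show ?thesis
      using G cone_add[OF cone] by (simp add: K_def algebra_simps)
  qed
  have K_scale: "r *\<^sub>R G \<in> K (r * t)" if G: "G \<in> K t" and r: "r \<ge> 0" for G t r
  proof -
    have cone: "r *\<^sub>R G \<in> pos_cone" using G r by (auto simp: K_def intro: cone_scaleR)
    have eq: "AE x in M. cmod (rep (r *\<^sub>R G) x) = r * cmod (rep G x)"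
      using rep_scaleR[of r G] by eventually_elim (simp add: norm_mult r)
    have "AE x in M. cmod (rep G x) \<le> t * cmod (rep w x)" using G by (simp add: K_def)
    then have "AE x in M. cmod (rep (r *\<^sub>R G) x) \<le> r * t * cmod (rep w x)"
      using eq by eventually_elim (use r in \<open>simp add: mult.assoc mult_left_mono\<close>)
    moreover have "(\<integral>x. \<rho> x * cmod (rep (r *\<^sub>R G) x) \<partial>M) = (\<integral>x. r * (\<rho> x * cmod (rep G x)) \<partial>M)"
    proof (rule integral_cong_AE)
      show "AE x in M. \<rho> x * cmod (rep (r *\<^sub>R G) x) = r * (\<rho> x * cmod (rep G x))"
        using eq by eventually_elim simp
    qed measurable
    moreover have "r * (t * \<eta>) \<le> r * (\<integral>x. \<rho> x * cmod (rep G x) \<partial>M)"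
      using G r by (intro mult_left_mono) (auto simp: K_def)
    ultimately show ?thesis using cone by (simp add: K_def)
  qed
  have K_zero: "0 \<in> K 0"
  proof -
    have "AE x in M. cmod (rep 0 x) \<le> 0 * cmod (rep w x)" using rep_zero by eventually_elim simp
    moreover have "0 \<le> (\<integral>x. \<rho> x * cmod (rep 0 x) \<partial>M)"
      using \<rho>0 by (intro integral_nonneg_AE AE_I2) (simp add: less_imp_le)
    ultimately show ?thesis by (simp add: K_def)
  qed
  have K_norm: "t * c \<le> norm G" if G: "G \<in> K t" and t: "t \<ge> 0" for G t
  proof (cases "t = 0")
    case False
    then have t': "t > 0" using t by simp
    then have h: "(1 / t) *\<^sub>R G \<in> K 1" using K_scale[OF G, of "1 / t"] by simp
    have "c \<le> norm ((1 / t) *\<^sub>R G)" using h by (intro c(2)) (simp_all add: K_def)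
    then show ?thesis using t' by (simp add: field_simps)
  qed simp
  \<comment> \<open>The infimum of \<open>S f\<close> is the gauge that dominates \<phi>, and its
    cases encode the demands on \<phi>: u = f, t = 0 gives \<phi> f \<le> norm f; u = 0, t = 0 gives
    positivity; u = 0, t = 1, f = - h gives c \<le> \<phi> h for h in \<open>K 1\<close>.\<close>
  define S where "S f = {s. \<exists>u t G. t \<ge> 0 \<and> G \<in> K t \<and> norm u - t * c \<le> s \<and>
    (AE x in M. Re (rep f x) + cmod (rep G x) \<le> Re (rep u x))}" for f
  have SI: "s \<in> S f" if "t \<ge> 0" "G \<in> K t" "norm u - t * c \<le> s"
    "AE x in M. Re (rep f x) + cmod (rep G x) \<le> Re (rep u x)" for s u t G f
    using that unfolding S_def by blast
  have SE: "\<exists>u t G. t \<ge> 0 \<and> G \<in> K t \<and> norm u - t * c \<le> s \<and>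
    (AE x in M. Re (rep f x) + cmod (rep G x) \<le> Re (rep u x))" if "s \<in> S f" for s f
    using that unfolding S_def by blast
  have S_norm: "norm f \<in> S f" for f
  proof (rule SI[OF _ K_zero, of f])
    show "AE x in M. Re (rep f x) + cmod (rep 0 x) \<le> Re (rep f x)"
      using rep_zero by eventually_elim simp
  qed simp_all
  \<comment> \<open>The gauge is finite: G \<le> |u - f| and t c \<le> norm G show that the gain t c
    is at most norm u + norm f.\<close>
  have S_lower: "- norm f \<le> s" if sS: "s \<in> S f" for s f
  proof -
    obtain u t G where s: "t \<ge> 0" "G \<in> K t" "norm u - t * c \<le> s"
      "AE x in M. Re (rep f x) + cmod (rep G x) \<le> Re (rep u x)"
      using SE[OF sS] by blast
    have "norm G \<le> norm (u - f)"
    proof (rule norm_mono)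
      show "AE x in M. cmod (rep G x) \<le> cmod (rep (u - f) x)"
        using s(4) rep_diff[of u f]
      proof eventually_elim
        case (elim x)
        then show ?case using complex_Re_le_cmod[of "rep u x - rep f x"] by simp
      qed
    qed
    then show ?thesis
      using K_norm[OF s(2,1)] norm_triangle_ineq4[of u f] s(3) by linarith
  qed
  have bdd: "bdd_below (S f)" for f using S_lower by (rule bdd_belowI)
  have "sublinear (\<lambda>f. Inf (S f))"
  proof (rule sublinear_Inf[OF _ bdd])
    show "S f \<noteq> {}" for f using S_norm by blast
    fix f g s r assume "s \<in> S f" "r \<in> S g"
    obtain u t G where s: "t \<ge> 0" "G \<in> K t" "norm u - t * c \<le> s"
      "AE x in M. Re (rep f x) + cmod (rep G x) \<le> Re (rep u x)"
      using SE[OF \<open>s \<in> S f\<close>] by blast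
    obtain u' t' G' where r: "t' \<ge> 0" "G' \<in> K t'" "norm u' - t' * c \<le> r"
      "AE x in M. Re (rep g x) + cmod (rep G' x) \<le> Re (rep u' x)"
      using SE[OF \<open>r \<in> S g\<close>] by blast
    show "s + r \<in> S (f + g)"
    proof (rule SI)
      show "0 \<le> t + t'" using s r by simp
      show "G + G' \<in> K (t + t')" using s r by (intro K_add)
      show "norm (u + u') - (t + t') * c \<le> s + r"
        using s(3) r(3) norm_triangle_ineq[of u u'] by (simp add: algebra_simps)
      show "AE x in M. Re (rep (f + g) x) + cmod (rep (G + G') x) \<le> Re (rep (u + u') x)"
        using s(4) r(4) rep_add[of f g] rep_add[of G G'] rep_add[of u u']
      proof eventually_elim
        case (elim x)
        then show ?case using norm_triangle_ineq[of "rep G x" "rep G' x"] by simp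
      qed
    qed
  next
    fix b :: real and f s assume b: "b > 0" and "s \<in> S f"
    obtain u t G where s: "t \<ge> 0" "G \<in> K t" "norm u - t * c \<le> s"
      "AE x in M. Re (rep f x) + cmod (rep G x) \<le> Re (rep u x)"
      using SE[OF \<open>s \<in> S f\<close>] by blast
    show "b * s \<in> S (b *\<^sub>R f)"
    proof (rule SI)
      show "0 \<le> b * t" using s b by simp
      show "b *\<^sub>R G \<in> K (b * t)" using s b by (intro K_scale) simp_all
      have "b * (norm u - t * c) \<le> b * s" using s(3) b by (intro mult_left_mono) simp_all
      then show "norm (b *\<^sub>R u) - b * t * c \<le> b * s" using b by (simp add: algebra_simps)
      show "AE x in M. Re (rep (b *\<^sub>R f) x) + cmod (rep (b *\<^sub>R G) x) \<le> Re (rep (b *\<^sub>R u) x)"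
        using s(4) rep_scaleR[of b f] rep_scaleR[of b G] rep_scaleR[of b u]
      proof eventually_elim
        case (elim x)
        have "b * (Re (rep f x) + cmod (rep G x)) \<le> b * Re (rep u x)"
          using elim(1) b by (intro mult_left_mono) simp_all
        then show ?case using b unfolding elim by (simp add: norm_mult algebra_simps)
      qed
    qed
  qed
  then obtain \<phi> where \<phi>: "linear \<phi>" "\<And>f. \<phi> f \<le> Inf (S f)"
    by (rule sublinear_dominates_linear) blast
  have \<phi>_le: "\<phi> f \<le> s" if "s \<in> S f" for f s
    using \<phi>(2)[of f] cInf_lower[OF that bdd] by simp
  have \<phi>_le0: "\<phi> f \<le> 0" if "AE x in M. Re (rep f x) \<le> 0" for f
  proof (rule \<phi>_le, rule SI[OF _ K_zero, of 0])
    show "AE x in M. Re (rep f x) + cmod (rep 0 x) \<le> Re (rep 0 x)"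
      using that rep_zero by eventually_elim simp
  qed simp_all
  have neg: "AE x in M. rep (- f) x = - rep f x" for f
    using rep_scaleR[of "- 1" f] by simp
  have \<phi>_pos: "0 \<le> \<phi> f" if f: "f \<in> pos_cone" for f
  proof -
    have "\<phi> (- f) \<le> 0"
    proof (rule \<phi>_le0)
      show "AE x in M. Re (rep (- f) x) \<le> 0" using neg[of f] coneD[OF f]
      proof eventually_elim
        case (elim x)
        have "Re (rep f x) = cmod (rep f x)" using elim(2) by (metis Re_complex_of_real)
        then show ?case using elim(1) by simp
      qed
    qed
    then show ?thesis by (simp add: linear_neg[OF \<phi>(1)])
  qed
  \<comment> \<open>The real part of i f vanishes a.e., so the positivity bound applies to i f and
    to its negative.\<close>
  have \<phi>_imag: "\<phi> (\<i> *\<^sub>C f) = 0" if f: "f \<in> pos_cone" for f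
  proof -
    have *: "AE x in M. Re (rep (\<i> *\<^sub>C f) x) = 0"
      using rep_scaleC[of \<i> f] coneD[OF f]
    proof eventually_elim
      case (elim x)
      have "Im (rep f x) = 0" using elim(2) by (metis Im_complex_of_real)
      then show ?case using elim(1) by simp
    qed
    have "\<phi> (\<i> *\<^sub>C f) \<le> 0"
    proof (rule \<phi>_le0)
      show "AE x in M. Re (rep (\<i> *\<^sub>C f) x) \<le> 0" using * by eventually_elim simp
    qed
    moreover have "\<phi> (- (\<i> *\<^sub>C f)) \<le> 0"
    proof (rule \<phi>_le0)
      show "AE x in M. Re (rep (- (\<i> *\<^sub>C f)) x) \<le> 0"
        using * neg[of "\<i> *\<^sub>C f"] by eventually_elim simp
    qed
    ultimately show ?thesis by (simp add: linear_neg[OF \<phi>(1)])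
  qed
  have \<phi>_large: "c \<le> \<phi> h" if h: "h \<in> pos_cone" "AE x in M. cmod (rep h x) \<le> cmod (rep w x)" "\<epsilon> \<le> norm h" for h
  proof -
    have "\<eta> \<le> (\<integral>x. \<rho> x * cmod (rep h x) \<partial>M)" using \<eta>(2)[OF h(2)] h(3) by force
    then have hK: "h \<in> K 1" using h by (simp add: K_def)
    have "\<phi> (- h) \<le> - c"
    proof (rule \<phi>_le, rule SI[OF _ hK, of 0])
      show "AE x in M. Re (rep (- h) x) + cmod (rep h x) \<le> Re (rep 0 x)"
        using neg[of h] coneD[OF h(1)] rep_zero
      proof eventually_elim
        case (elim x)
        have "Re (rep h x) = cmod (rep h x)" using elim(2) by (metis Re_complex_of_real)
        then show ?case using elim(1,3) by simp
      qed
    qed simp_all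
    then show ?thesis by (simp add: linear_neg[OF \<phi>(1)])
  qed
  obtain \<Phi> where "\<Phi> \<in> dual_cone" "\<And>f. Re (blinfun_apply \<Phi> f) = \<phi> f"
    using positive_real_functional_complexify[OF \<phi>(1) \<phi>_le[OF S_norm] \<phi>_pos \<phi>_imag] by blast
  then show ?thesis using c(1) \<phi>_large by (intro that[of \<Phi> c]) simp_all
qed

text \<open>The band projection onto the functions supported in E; solidity guarantees that the
  choice is successful when E is measurable.\<close>

definition restriction :: "'a set \<Rightarrow> 'l \<Rightarrow>\<^sub>L 'l" where
  "restriction E = Blinfun (\<lambda>f. SOME h. AE x in M. rep h x = indicator E x * rep f x)"

lemma restriction:
  assumes E: "E \<in> sets M"
  shows "AE x in M. rep (restriction E f) x = indicator E x * rep f x"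
    and "norm (restriction E f) \<le> norm f"
    and "restriction E (c *\<^sub>C f) = c *\<^sub>C restriction E f"
proof -
  define P where "P f = (SOME h. AE x in M. rep h x = indicator E x * rep f x)" for f
  have P: "AE x in M. rep (P f) x = indicator E x * rep f x" for f
  proof -
    have "(\<lambda>x. indicator E x * rep f x) \<in> borel_measurable M" using E by measurable
    moreover have "AE x in M. cmod (indicator E x * rep f x) \<le> cmod (rep f x)"
      by (intro AE_I2) (simp add: indicator_def)
    ultimately obtain h where "AE x in M. rep h x = indicator E x * rep f x"
      using solid by blast
    then show ?thesis unfolding P_def by (rule someI)
  qed
  have P_le: "norm (P f) \<le> norm f" for f
  proof (rule norm_mono)
    show "AE x in M. cmod (rep (P f) x) \<le> cmod (rep f x)"
      using P[of f] by eventually_elim (simp add: indicator_def)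
  qed
  have "P (f + g) = P f + P g" for f g
  proof (rule rep_inject)
    show "AE x in M. rep (P (f + g)) x = rep (P f + P g) x"
      using P[of "f + g"] P[of f] P[of g] rep_add[of f g] rep_add[of "P f" "P g"]
      by eventually_elim (simp add: algebra_simps)
  qed
  moreover have cl: "P (c *\<^sub>C f) = c *\<^sub>C P f" for c f
  proof (rule rep_inject)
    show "AE x in M. rep (P (c *\<^sub>C f)) x = rep (c *\<^sub>C P f) x"
      using P[of "c *\<^sub>C f"] P[of f] rep_scaleC[of c f] rep_scaleC[of c "P f"]
      by eventually_elim simp
  qed
  moreover have "P (r *\<^sub>R f) = r *\<^sub>R P f" for r f
    using cl[of "complex_of_real r" f] by (simp add: scaleC_of_real)
  ultimately have "bounded_linear P"
    using P_le by (intro bounded_linear_intro[of _ 1]) simp_all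
  then have eq: "blinfun_apply (restriction E) = P"
    unfolding restriction_def P_def[abs_def, symmetric] by (rule bounded_linear_Blinfun_apply)
  show "AE x in M. rep (restriction E f) x = indicator E x * rep f x"
    "norm (restriction E f) \<le> norm f" "restriction E (c *\<^sub>C f) = c *\<^sub>C restriction E f"
    unfolding eq by (rule P P_le cl)+
qed

lemma restriction_cone:
  assumes "E \<in> sets M" "f \<in> pos_cone"
  shows "restriction E f \<in> pos_cone"
proof (rule coneI)
  show "AE x in M. rep (restriction E f) x = of_real (indicator E x * cmod (rep f x))"
    using restriction(1)[OF assms(1), of f] coneD[OF assms(2)]
    by eventually_elim (simp add: indicator_def)
qed (simp add: indicator_def)

text \<open>The functionals decrease with infimum 0: for fixed positive f their values tend to 0 by
  order continuity of the norm of L, so a lower bound g satisfies - g \<ge> 0. Order continuity of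
  the dual norm then applies.\<close>

lemma dual_norm_restriction_tendsto_0:
  assumes oc: "order_continuous_norm pos_cone" and oc': "order_continuous_norm dual_cone"
    and \<Psi>: "\<Psi> \<in> dual_cone" and F: "\<And>n. F n \<in> sets M" "decseq F"
    and null: "AE x in M. \<exists>n. x \<notin> F n"
  shows "(\<lambda>n. norm (\<Psi> o\<^sub>L restriction (F n))) \<longlonglongrightarrow> 0"
proof -
  let ?\<psi> = "\<lambda>n. \<Psi> o\<^sub>L restriction (F n)"
  have ind: "AE x in M. (\<lambda>n. indicator (F n) x :: real) \<longlonglongrightarrow> 0"
    using null
  proof eventually_elim
    case (elim x)
    then obtain N where "x \<notin> F N" by blast
    then have "\<forall>\<^sub>F n in sequentially. indicator (F n) x = (0::real)"
      using decseqD[OF F(2), of N] by (intro eventually_sequentiallyI[of N]) (auto simp: indicator_def)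
    then show ?case by (rule tendsto_eventually)
  qed
  have "?\<psi> n \<in> dual_cone" for n
    unfolding dual_positive_cone_def
    using dual_coneD[OF \<Psi>] restriction(3)[OF F(1)] restriction_cone[OF F(1)] by simp
  moreover have "?\<psi> n - ?\<psi> (Suc n) \<in> dual_cone" for n
    unfolding dual_positive_cone_def
  proof (intro CollectI conjI allI ballI)
    show "(?\<psi> n - ?\<psi> (Suc n)) (c *\<^sub>C f) = c * (?\<psi> n - ?\<psi> (Suc n)) f" for c f
      by (simp add: blinfun.diff_left dual_coneD(1)[OF \<Psi>] restriction(3)[OF F(1)] algebra_simps)
    fix f assume f: "f \<in> pos_cone"
    have "restriction (F n) f - restriction (F (Suc n)) f \<in> pos_cone"
      unfolding cone_diff_iff[OF restriction_cone[OF F(1) f] restriction_cone[OF F(1) f]]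
      using restriction(1)[OF F(1), of n f] restriction(1)[OF F(1), of "Suc n" f]
      by eventually_elim (use decseq_SucD[OF F(2), of n] in \<open>auto simp: indicator_def\<close>)
    then have "\<Psi> (restriction (F n) f - restriction (F (Suc n)) f) \<in> \<real>\<^sub>\<ge>\<^sub>0"
      by (rule dual_coneD(2)[OF \<Psi>])
    then show "(?\<psi> n - ?\<psi> (Suc n)) f \<in> \<real>\<^sub>\<ge>\<^sub>0"
      by (simp add: blinfun.diff_left blinfun.diff_right)
  qed
  \<comment> \<open>A lower bound is a priori a real-linear map; its complex linearity is inherited
    from \<open>?\<psi> 0 - g\<close>.\<close>
  moreover have "0 - g \<in> dual_cone" if g: "\<forall>n. ?\<psi> n - g \<in> dual_cone" for g
    unfolding dual_positive_cone_def
  proof (intro CollectI conjI allI ballI)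
    show "(0 - g) (c *\<^sub>C f) = c * (0 - g) f" for c f
    proof -
      have "(?\<psi> 0 - g) (c *\<^sub>C f) = c * (?\<psi> 0 - g) f" using g dual_coneD(1) by blast
      then show ?thesis
        by (simp add: blinfun.diff_left blinfun.minus_left dual_coneD(1)[OF \<Psi>] restriction(3)[OF F(1)] algebra_simps)
    qed
    fix f assume f: "f \<in> pos_cone"
    have "(\<lambda>n. norm (restriction (F n) f)) \<longlonglongrightarrow> 0"
    proof (rule dominated_norm_tendsto_0[OF oc, where w = f])
      show "AE x in M. cmod (rep (restriction (F n) f) x) \<le> cmod (rep f x)" for n
        using restriction(1)[OF F(1), of n f] by eventually_elim (simp add: indicator_def)
      have "AE x in M. \<forall>n. rep (restriction (F n) f) x = of_real (indicator (F n) x) * rep f x"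
        unfolding AE_all_countable
      proof
        show "AE x in M. rep (restriction (F n) f) x = of_real (indicator (F n) x) * rep f x" for n
          using restriction(1)[OF F(1), of n f] by eventually_elim (simp add: indicator_def)
      qed
      then show "AE x in M. (\<lambda>n. rep (restriction (F n) f) x) \<longlonglongrightarrow> 0"
        using ind
      proof eventually_elim
        case (elim x)
        have "(\<lambda>n. of_real (indicator (F n) x) * rep f x) \<longlonglongrightarrow> of_real 0 * rep f x"
          by (intro tendsto_intros elim(2))
        then show ?case using elim(1) by simp
      qed
    qed
    then have "(\<lambda>n. restriction (F n) f) \<longlonglongrightarrow> 0" by (rule tendsto_norm_zero_cancel)
    then have "(\<lambda>n. \<Psi> (restriction (F n) f)) \<longlonglongrightarrow> \<Psi> 0"
      by (rule bounded_linear.tendsto[OF blinfun.bounded_linear_right])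
    then have "(\<lambda>n. \<Psi> (restriction (F n) f) - g f) \<longlonglongrightarrow> \<Psi> 0 - g f"
      by (rule tendsto_diff[OF _ tendsto_const])
    then have lim: "(\<lambda>n. (?\<psi> n - g) f) \<longlonglongrightarrow> (0 - g) f"
      by (simp add: blinfun.diff_left blinfun.minus_left)
    have "(?\<psi> n - g) f \<in> \<real>\<^sub>\<ge>\<^sub>0" for n using g f dual_coneD(2) by blast
    from closed_sequentially[OF closed_nonneg_Reals_complex this lim]
    show "(0 - g) f \<in> \<real>\<^sub>\<ge>\<^sub>0" .
  qed
  ultimately have "(\<forall>n. ?\<psi> n \<in> dual_cone) \<and> (\<forall>n. ?\<psi> n - ?\<psi> (Suc n) \<in> dual_cone) \<and>
      (\<forall>g. (\<forall>n. ?\<psi> n - g \<in> dual_cone) \<longrightarrow> 0 - g \<in> dual_cone)"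
    by blast
  then show ?thesis by (rule oc'[unfolded order_continuous_norm_def, THEN spec, THEN mp])
qed

text \<open>Otherwise there are \<open>f n\<close> in the unit ball with \<open>\<Psi> ((f n - v n)\<^sup>+) \<ge> c\<close> for
  \<open>v n = 4\<^sup>n (f 0 + \<dots> + f (n - 1))\<close>.  The sets \<open>{f n > v n}\<close> have a null limit superior, because
  the sum of the functions \<open>f n / 2\<^sup>n\<close> is finite almost everywhere; this contradicts the order
  continuity of the dual norm.\<close>

lemma obtain_dual_truncation:
  assumes oc: "order_continuous_norm pos_cone" and oc': "order_continuous_norm dual_cone"
    and \<Psi>: "\<Psi> \<in> dual_cone" and c: "c > 0"
  obtains v where "v \<in> pos_cone"
    "\<And>f r. f \<in> pos_cone \<Longrightarrow> norm f \<le> 1 \<Longrightarrow> r \<in> pos_cone \<Longrightarrow>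
      AE x in M. cmod (rep r x) = max 0 (cmod (rep f x) - cmod (rep v x)) \<Longrightarrow>
      Re (blinfun_apply \<Psi> r) < c"
proof (rule ccontr)
  assume contra: "\<not> thesis"
  note thesisI = that
  \<comment> \<open>The implication makes \<open>P v\<close> satisfiable also for v outside the
    cone, so that total choice functions exist.\<close>
  define P where "P v f r \<longleftrightarrow> (v \<in> pos_cone \<longrightarrow> f \<in> pos_cone \<and> norm f \<le> 1 \<and> r \<in> pos_cone \<and>
      (AE x in M. cmod (rep r x) = max 0 (cmod (rep f x) - cmod (rep v x))) \<and> c \<le> Re (\<Psi> r))" for v f r
  have "\<exists>f r. P v f r" for v
  proof (rule ccontr)
    assume no: "\<nexists>f r. P v f r"
    then have v: "v \<in> pos_cone" by (auto simp: P_def)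
    have thesis
    proof (rule thesisI[OF v])
      fix f r assume *: "f \<in> pos_cone" "norm f \<le> 1" "r \<in> pos_cone"
        "AE x in M. cmod (rep r x) = max 0 (cmod (rep f x) - cmod (rep v x))"
      have "\<not> P v f r" using no by blast
      then have "\<not> c \<le> Re (\<Psi> r)" using * v by (simp add: P_def)
      then show "Re (\<Psi> r) < c" by simp
    qed
    with contra show False by blast
  qed
  then obtain Ff Rf where FR': "\<And>v. P v (Ff v) (Rf v)"
    by metis
  have FR: "Ff v \<in> pos_cone \<and> norm (Ff v) \<le> 1 \<and> Rf v \<in> pos_cone \<and>
      (AE x in M. cmod (rep (Rf v) x) = max 0 (cmod (rep (Ff v) x) - cmod (rep v x))) \<and> c \<le> Re (\<Psi> (Rf v))"
    if "v \<in> pos_cone" for v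
    using FR'[of v] that by (simp add: P_def)
  \<comment> \<open>A recursion through counterexamples: each new function is chosen against the
    level \<open>4 ^ n\<close> times the sum of all earlier ones.\<close>
  define s where "s = rec_nat (0::'l) (\<lambda>n s. s + Ff (4 ^ n *\<^sub>R s))"
  define v where "v n = (4::real) ^ n *\<^sub>R s n" for n
  define f where "f n = Ff (v n)" for n
  have s_Suc: "s (Suc n) = s n + f n" and s_0: "s 0 = 0" for n
    by (simp_all add: s_def f_def v_def)
  have s_cone: "s n \<in> pos_cone" for n
  proof (induction n)
    case (Suc n)
    then have "v n \<in> pos_cone" unfolding v_def by (intro cone_scaleR) simp_all
    then have "f n \<in> pos_cone" using FR by (simp add: f_def)
    with Suc show ?case unfolding s_Suc by (rule cone_add)
  qed (simp add: s_0)
  have v: "v n \<in> pos_cone" for n unfolding v_def by (intro cone_scaleR s_cone) simp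
  define r where "r n = Rf (v n)" for n
  have f: "f n \<in> pos_cone" "norm (f n) \<le> 1" and r: "r n \<in> pos_cone" "c \<le> Re (\<Psi> (r n))"
    and r_eq: "AE x in M. cmod (rep (r n) x) = max 0 (cmod (rep (f n) x) - cmod (rep (v n) x))" for n
    using FR[OF v[of n]] by (simp_all add: f_def r_def)
  have s_sum: "s n = (\<Sum>i<n. f i)" for n
    by (induction n) (simp_all add: s_0 s_Suc)
  have v_eq: "AE x in M. cmod (rep (v n) x) = 4 ^ n * (\<Sum>i<n. cmod (rep (f i) x))" for n
  proof -
    have "AE x in M. cmod (rep (s n) x) = (\<Sum>i<n. cmod (rep (f i) x))"
      using cmod_rep_sum[of "{..<n}" f "\<lambda>_. 1"] f(1) by (simp add: s_sum)
    then show ?thesis using rep_scaleR[of "4 ^ n" "s n"]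
      unfolding v_def by eventually_elim (simp add: norm_mult norm_power)
  qed
  define E where "E n = {x \<in> space M. cmod (rep (f n) x) > cmod (rep (v n) x)}" for n
  have E[measurable]: "E n \<in> sets M" for n unfolding E_def by measurable
  define F where "F n = (\<Union>k\<in>{n..}. E k)" for n
  have F: "F n \<in> sets M" for n unfolding F_def by (intro sets.countable_UN'') auto
  have dec: "decseq F" unfolding F_def decseq_def by (auto intro: order_trans)
  have sum: "summable (\<lambda>n. norm ((1/2) ^ n *\<^sub>R f n))"
  proof (rule summable_comparison_test)
    show "\<exists>N. \<forall>n\<ge>N. norm (norm ((1/2) ^ n *\<^sub>R f n)) \<le> (1/2) ^ n" using f(2) by (simp add: mult_left_le)
  qed (simp add: summable_geometric)
  have cone2: "(1/2) ^ n *\<^sub>R f n \<in> pos_cone" for n using f(1) by (intro cone_scaleR) simp_all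
  have "AE x in M. \<exists>n. x \<notin> F n"
  proof -
    have "AE x in M. \<forall>n. cmod (rep ((1/2) ^ n *\<^sub>R f n) x) = (1/2) ^ n * cmod (rep (f n) x)"
      unfolding AE_all_countable
    proof
      show "AE x in M. cmod (rep ((1/2) ^ n *\<^sub>R f n) x) = (1/2) ^ n * cmod (rep (f n) x)" for n
        using rep_scaleR[of "(1/2) ^ n" "f n"] by eventually_elim (simp add: norm_mult norm_power norm_divide)
    qed
    moreover have "AE x in M. \<forall>n. cmod (rep (v n) x) = 4 ^ n * (\<Sum>i<n. cmod (rep (f i) x))"
      unfolding AE_all_countable using v_eq by blast
    ultimately show ?thesis using summable_rep[OF cone2 sum]
    proof eventually_elim
      case (elim x)
      have lim: "(\<lambda>n. (1/2) ^ n * cmod (rep (f n) x)) \<longlonglongrightarrow> 0"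
        using summable_LIMSEQ_zero[OF elim(3)] elim(1) by simp
      show ?case
      proof (rule ccontr)
        assume "\<nexists>n. x \<notin> F n"
        \<comment> \<open>If x lies in infinitely many \<open>E k\<close>, then f k exceeds 4^k b
          for some late k, with a fixed b > 0. Hence f k / 2^k exceeds 2^k b, against its
          convergence to 0: the base 4 is chosen to beat the factor 2.\<close>
        then have inf: "\<exists>k\<ge>n. x \<in> E k" for n by (auto simp: F_def)
        obtain k0 where "x \<in> E k0" using inf by blast
        define b where "b = cmod (rep (f k0) x)"
        have b: "b > 0" using \<open>x \<in> E k0\<close> unfolding E_def b_def
          by (auto intro: le_less_trans[OF norm_ge_zero])
        obtain N where N: "\<And>n. n \<ge> N \<Longrightarrow> norm ((1/2) ^ n * cmod (rep (f n) x) - 0) < b"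
          using LIMSEQ_D[OF lim b] by blast
        obtain k where k: "k \<ge> max N (Suc k0)" "x \<in> E k" using inf by blast
        have "b \<le> (\<Sum>i<k. cmod (rep (f i) x))"
          unfolding b_def using k(1) by (intro member_le_sum) auto
        then have "4 ^ k * b \<le> cmod (rep (v k) x)" using elim(2) by simp
        also have "\<dots> < cmod (rep (f k) x)" using k(2) by (simp add: E_def)
        finally have "(1/2) ^ k * (4 ^ k * b) < (1/2) ^ k * cmod (rep (f k) x)"
          by (intro mult_strict_left_mono) simp_all
        moreover have "(1/2) ^ k * (4 ^ k * b) = 2 ^ k * b"
        proof -
          have "(4::real) ^ k = 2 ^ k * 2 ^ k" by (simp flip: power_mult_distrib)
          then show ?thesis by (simp add: power_divide)
        qed
        moreover have "1 * b \<le> 2 ^ k * b" using b by (intro mult_right_mono) simp_all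
        moreover have "(1/2) ^ k * cmod (rep (f k) x) < b" using N[of k] k(1) by simp
        ultimately show False by simp
      qed
    qed
  qed
  note lim = dual_norm_restriction_tendsto_0[OF oc oc' \<Psi> F dec this]
  have "c \<le> norm (\<Psi> o\<^sub>L restriction (F n))" for n
  proof -
    \<comment> \<open>Off \<open>E n\<close> the excess r n vanishes, and on \<open>E n\<close>, a
      part of \<open>F n\<close>, it is at most f n.\<close>
    have "AE x in M. cmod (rep (r n) x) \<le> cmod (rep (restriction (F n) (f n)) x)"
      using r_eq[of n] restriction(1)[OF F, of n "f n"] AE_space
    proof eventually_elim
      case (elim x)
      show ?case
      proof (cases "x \<in> E n")
        case True
        then have "x \<in> F n" by (auto simp: F_def)
        then show ?thesis using elim by simp
      next
        case False
        then show ?thesis using elim by (simp add: E_def)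
      qed
    qed
    then have "Re (\<Psi> (r n)) \<le> Re (\<Psi> (restriction (F n) (f n)))"
      using r(1) restriction_cone[OF F f(1)] by (intro dual_cone_mono[OF \<Psi>])
    also have "\<dots> \<le> norm ((\<Psi> o\<^sub>L restriction (F n)) (f n))"
      by (simp add: complex_Re_le_cmod)
    also have "\<dots> \<le> norm (\<Psi> o\<^sub>L restriction (F n)) * norm (f n)" by (rule norm_blinfun)
    also have "\<dots> \<le> norm (\<Psi> o\<^sub>L restriction (F n)) * 1" using f(2) by (intro mult_left_mono) simp_all
    finally show ?thesis using r(2)[of n] by simp
  qed
  then have "c \<le> 0" using lim by (intro LIMSEQ_le_const) blast+
  then show False using c by simp
qed

end

section \<open>The measure of noncompactness of a geometric mean\<close>

context banach_function_space
begin

text \<open>The excess of |c| over |u| is at most that over |g|, hence at most |c - g|.\<close>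

lemma obtain_truncated_difference:
  assumes "norm (c - g) \<le> t" and le: "AE x in M. cmod (rep g x) \<le> cmod (rep u x)"
  shows "\<exists>e. e \<in> pos_cone \<and> (AE x in M. cmod (rep e x) = max 0 (cmod (rep c x) - cmod (rep u x))) \<and> norm e \<le> t"
proof -
  define q where "q x = max 0 (cmod (rep c x) - cmod (rep u x))" for x
  have q: "q \<in> borel_measurable M" unfolding q_def by measurable
  have "AE x in M. q x \<le> cmod (rep (c - g) x)"
    using le rep_diff[of c g]
  proof eventually_elim
    case (elim x)
    then show ?case using norm_triangle_ineq2[of "rep c x" "rep g x"] by (simp add: q_def)
  qed
  from obtain_positive[OF q _ this]
  obtain e where e: "e \<in> pos_cone" "AE x in M. rep e x = complex_of_real (q x)" "norm e \<le> norm (c - g)"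
    by (auto simp: q_def)
  have "AE x in M. cmod (rep e x) = q x"
    using e(2) by eventually_elim (simp add: q_def)
  then show ?thesis using e assms(1) by (intro exI[of _ e]) (simp add: q_def)
qed

text \<open>The nets make the excess of each C j p over a fixed u small in norm. As the scaled mean
  inequality is linear, its bound for B p splits into a multiple of u, independent of p, and a
  combination of the excesses.\<close>

lemma geometric_mean_bounded_truncation:
  assumes gm: "geometric_mean_bounded m \<alpha> C B"
    and \<alpha>: "\<And>j. j < m \<Longrightarrow> \<alpha> j > 0" and sum: "(\<Sum>j<m. \<alpha> j) = 1"
    and t: "\<And>j. j < m \<Longrightarrow> hausdorff_mnc (C j) < t j"
  shows "\<exists>w\<in>pos_cone. \<forall>p\<in>pos_cone. norm p \<le> 1 \<longrightarrow>
    (\<forall>r. (AE x in M. cmod (rep r x) \<le> max 0 (cmod (rep (B p) x) - cmod (rep w x))) \<longrightarrow>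
      norm r \<le> (\<Prod>j<m. t j powr \<alpha> j))"
proof -
  have t0: "0 < t j" if "j < m" for j using t[OF that] hausdorff_mnc_nonneg[of "C j"] by simp
  have "\<exists>F. j < m \<longrightarrow> finite F \<and> (\<forall>f. norm f \<le> 1 \<longrightarrow> (\<exists>g\<in>F. norm (C j f - g) \<le> t j))" for j
    using hausdorff_mnc_lessD[OF t[of j]] by blast
  then obtain F where F: "\<And>j. j < m \<longrightarrow> finite (F j) \<and> (\<forall>f. norm f \<le> 1 \<longrightarrow> (\<exists>g\<in>F j. norm (C j f - g) \<le> t j))"
    by metis
  have "\<exists>p. p \<in> pos_cone \<and> (AE x in M. cmod (rep p x) = cmod (rep f x))" for f
    by (rule obtain_modulus[of f]) blast
  then obtain md where md: "\<And>f. md f \<in> pos_cone \<and> (AE x in M. cmod (rep (md f) x) = cmod (rep f x))"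
    by metis
  define Z where "Z = Sigma {..<m} F"
  have finZ: "finite Z" unfolding Z_def using F by (intro finite_SigmaI) auto
  \<comment> \<open>The sum of the moduli of all net points of all \<open>C j\<close> dominates each
    single net point.\<close>
  define u where "u = (\<Sum>z\<in>Z. 1 *\<^sub>R md (snd z))"
  have u_cone: "u \<in> pos_cone" unfolding u_def using md by (intro cone_sum) simp
  have u_ge: "AE x in M. cmod (rep g x) \<le> cmod (rep u x)" if "j < m" "g \<in> F j" for j g
  proof -
    have z: "(j, g) \<in> Z" using that by (simp add: Z_def)
    have "AE x in M. cmod (rep u x) = (\<Sum>z\<in>Z. 1 * cmod (rep (md (snd z)) x))"
      unfolding u_def using finZ md by (intro cmod_rep_sum) auto
    moreover have "AE x in M. cmod (rep (md g) x) = cmod (rep g x)" using md by blast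
    ultimately show ?thesis
    proof eventually_elim
      case (elim x)
      then show ?case
        using member_le_sum[OF z _ finZ, of "\<lambda>z. cmod (rep (md (snd z)) x)"] by simp
    qed
  qed
  define T where "T = (\<Prod>j<m. t j powr \<alpha> j)"
  have T: "T \<ge> 0" unfolding T_def by (intro prod_nonneg) simp
  \<comment> \<open>The coefficients of the scaled mean inequality; as
    \<open>b j * t j = T * \<alpha> j\<close>, the combination of the excesses has norm at most
    \<open>T\<close>.\<close>
  define b where "b j = T * (\<alpha> j / t j)" for j
  have b: "0 \<le> b j" if "j \<in> {..<m}" for j
    unfolding b_def using T \<alpha>[of j] t0[of j] that by simp
  have b0: "0 \<le> (\<Sum>j<m. b j)" using b by (rule sum_nonneg)
  define w where "w = (\<Sum>j<m. b j) *\<^sub>R u"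
  have w_eq: "AE x in M. cmod (rep w x) = (\<Sum>j<m. b j) * cmod (rep u x)"
    unfolding w_def using rep_scaleR[of "\<Sum>j<m. b j" u] by eventually_elim (simp add: norm_mult b0 del: of_real_sum)
  show ?thesis
  proof (intro bexI[of _ w] ballI impI allI)
    show "w \<in> pos_cone" unfolding w_def by (rule cone_scaleR[OF u_cone b0])
    fix p r assume p: "p \<in> pos_cone" "norm p \<le> 1"
      and r: "AE x in M. cmod (rep r x) \<le> max 0 (cmod (rep (B p) x) - cmod (rep w x))"
    have "AE x in M. cmod (rep p x) \<le> cmod (rep p x)" by simp
    note gm' = geometric_mean_bounded_modulus[OF gm sum p(1) this]
    have "\<exists>e. j < m \<longrightarrow> e \<in> pos_cone \<and>
        (AE x in M. cmod (rep e x) = max 0 (cmod (rep (C j p) x) - cmod (rep u x))) \<and> norm e \<le> t j" for j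
    proof (cases "j < m")
      case True
      then obtain g where "g \<in> F j" "norm (C j p - g) \<le> t j" using F p(2) by blast
      then show ?thesis using obtain_truncated_difference u_ge True by blast
    qed blast
    then obtain e where e: "\<And>j. j < m \<longrightarrow> e j \<in> pos_cone \<and>
        (AE x in M. cmod (rep (e j) x) = max 0 (cmod (rep (C j p) x) - cmod (rep u x))) \<and> norm (e j) \<le> t j"
      by metis
    define G where "G = (\<Sum>j<m. b j *\<^sub>R e j)"
    have G_eq: "AE x in M. cmod (rep G x) = (\<Sum>j<m. b j * cmod (rep (e j) x))"
      unfolding G_def using e b by (intro cmod_rep_sum) auto
    have e_eq: "AE x in M. \<forall>j\<in>{..<m}. cmod (rep (e j) x) = max 0 (cmod (rep (C j p) x) - cmod (rep u x))"
      using e by (intro AE_finite_allI) auto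
    have "norm r \<le> norm G"
    proof (rule norm_mono)
      show "AE x in M. cmod (rep r x) \<le> cmod (rep G x)"
        using r gm'(2) w_eq G_eq e_eq
      proof eventually_elim
        case (elim x)
        note elim(2)
        also have "(\<Prod>j<m. cmod (rep (C j p) x) powr \<alpha> j) \<le> T * (\<Sum>j<m. \<alpha> j * (cmod (rep (C j p) x) / t j))"
          unfolding T_def using \<alpha> sum t0 by (intro weighted_geometric_le_scaled_arithmetic) auto
        also have "\<dots> = (\<Sum>j<m. b j * cmod (rep (C j p) x))"
          by (simp add: b_def sum_distrib_left mult.assoc)
        also have "\<dots> \<le> (\<Sum>j<m. b j * (cmod (rep u x) + cmod (rep (e j) x)))"
          using elim(5) b by (intro sum_mono mult_left_mono) auto
        also have "\<dots> = cmod (rep w x) + cmod (rep G x)"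
          unfolding elim(3,4) by (simp add: algebra_simps sum.distrib sum_distrib_right)
        finally have "max 0 (cmod (rep (B p) x) - cmod (rep w x)) \<le> cmod (rep G x)" by simp
        with elim(1) show ?case by (rule order_trans)
      qed
    qed
    also have "\<dots> \<le> (\<Sum>j<m. b j * t j)"
      unfolding G_def
    proof (rule sum_norm_le)
      fix j assume j: "j \<in> {..<m}"
      have "norm (b j *\<^sub>R e j) = b j * norm (e j)" using b[OF j] by simp
      also have "\<dots> \<le> b j * t j" using e[of j] j b[OF j] by (intro mult_left_mono) auto
      finally show "norm (b j *\<^sub>R e j) \<le> b j * t j" .
    qed
    also have "\<dots> = (\<Sum>j<m. T * \<alpha> j)"
    proof (rule sum.cong[OF refl])
      fix j assume "j \<in> {..<m}"
      then have "t j \<noteq> 0" using t0[of j] by simp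
      then show "b j * t j = T * \<alpha> j" by (simp add: b_def)
    qed
    also have "\<dots> = T" by (simp add: sum flip: sum_distrib_left)
    finally show "norm r \<le> (\<Prod>j<m. t j powr \<alpha> j)" by (simp add: T_def)
  qed
qed

text \<open>Split f into a part below v, whose image is near the net, and a rest of modulus r = max
  0 (|f| - v). The image of the rest is dominated by B r, which is cut at w: the part below w has
  norm at most \<epsilon>, as the functional shows, and the part above has norm at most T because r
  \<le> |f|.\<close>

lemma hausdorff_mnc_le_of_truncation:
  assumes oc: "order_continuous_norm pos_cone" and oc': "order_continuous_norm dual_cone"
    and mb: "modulus_bounded B" and cl: "complex_linear B" and compact: "order_compact B"
    and w: "w \<in> pos_cone" and T: "T > 0"
    and trunc: "\<And>p r. p \<in> pos_cone \<Longrightarrow> norm p \<le> 1 \<Longrightarrow>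
      AE x in M. cmod (rep r x) \<le> max 0 (cmod (rep (B p) x) - cmod (rep w x)) \<Longrightarrow> norm r \<le> T"
  shows "hausdorff_mnc B \<le> T"
proof (rule field_le_epsilon)
  fix d :: real assume "d > 0"
  \<comment> \<open>One half of d pays for the net, the other for the part of B r below w.\<close>
  define \<epsilon> where "\<epsilon> = d / 2"
  have e: "\<epsilon> > 0" using \<open>d > 0\<close> by (simp add: \<epsilon>_def)
  obtain \<Phi> c where \<Phi>: "\<Phi> \<in> dual_cone" and c: "c > 0"
    and \<Phi>c: "\<And>h. h \<in> pos_cone \<Longrightarrow> AE x in M. cmod (rep h x) \<le> cmod (rep w x) \<Longrightarrow> \<epsilon> \<le> norm h \<Longrightarrow>
      c \<le> Re (blinfun_apply \<Phi> h)"
    by (rule obtain_positive_functional[OF oc e, of w]) blast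
  have \<Psi>: "\<Phi> o\<^sub>L B \<in> dual_cone"
    using dual_coneD[OF \<Phi>] complex_linearD[OF cl] modulus_boundedD(1)[OF mb]
    unfolding dual_positive_cone_def by simp
  \<comment> \<open>The truncation level depends on the functional and on B, but not on f; one net
    for the functions dominated by v therefore serves the whole unit ball.\<close>
  obtain v where v: "v \<in> pos_cone"
    and small: "\<And>f r. f \<in> pos_cone \<Longrightarrow> norm f \<le> 1 \<Longrightarrow> r \<in> pos_cone \<Longrightarrow>
      AE x in M. cmod (rep r x) = max 0 (cmod (rep f x) - cmod (rep v x)) \<Longrightarrow>
      Re ((\<Phi> o\<^sub>L B) r) < c"
    by (rule obtain_dual_truncation[OF oc oc' \<Psi> c]) blast
  obtain G where G: "finite G" "\<And>h. (AE x in M. cmod (rep h x) \<le> cmod (rep v x)) \<Longrightarrow> \<exists>g\<in>G. norm (B h - g) \<le> \<epsilon>"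
    using compact v e unfolding order_compact_def by meson
  have "\<exists>g\<in>G. norm (B f - g) \<le> T + d" if f: "norm f \<le> 1" for f
  proof -
    obtain p where p: "p \<in> pos_cone" "AE x in M. cmod (rep p x) = cmod (rep f x)" "norm p = norm f"
      by (rule obtain_modulus)
    \<comment> \<open>A factor in [0, 1] truncates the modulus at v and keeps the phase of f, so
      that |f - h| = |f| - |h|.\<close>
    define \<theta> where "\<theta> x = (if cmod (rep f x) \<le> cmod (rep v x) then 1 else cmod (rep v x) / cmod (rep f x))" for x
    have \<theta>: "0 \<le> \<theta> x" "\<theta> x \<le> 1" for x by (auto simp: \<theta>_def divide_le_eq)
    have "(\<lambda>x. of_real (\<theta> x) * rep f x) \<in> borel_measurable M" unfolding \<theta>_def by measurable
    moreover have "AE x in M. cmod (of_real (\<theta> x) * rep f x) \<le> cmod (rep f x)"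
      using \<theta> by (intro AE_I2) (simp add: norm_mult mult_left_le_one_le)
    ultimately obtain h where h: "AE x in M. rep h x = of_real (\<theta> x) * rep f x"
      using solid by blast
    have hv: "AE x in M. cmod (rep h x) \<le> cmod (rep v x)"
      using h by eventually_elim (auto simp: \<theta>_def norm_mult norm_divide)
    then obtain g where g: "g \<in> G" "norm (B h - g) \<le> \<epsilon>" using G(2) by blast
    define q where "q x = max 0 (cmod (rep f x) - cmod (rep v x))" for x
    have qm: "q \<in> borel_measurable M" unfolding q_def by measurable
    have "AE x in M. q x \<le> cmod (rep f x)" by (intro AE_I2) (simp add: q_def)
    from obtain_positive[OF qm _ this]
    obtain r where r: "r \<in> pos_cone" "AE x in M. rep r x = complex_of_real (q x)"
      by (auto simp: q_def)
    have r_eq: "AE x in M. cmod (rep r x) = q x" using r(2) by eventually_elim (simp add: q_def)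
    have fh: "AE x in M. cmod (rep (f - h) x) \<le> cmod (rep r x)"
      using rep_diff[of f h] h r_eq
    proof eventually_elim
      case (elim x)
      have "rep (f - h) x = of_real (1 - \<theta> x) * rep f x" using elim by (simp add: algebra_simps)
      then have "cmod (rep (f - h) x) = (1 - \<theta> x) * cmod (rep f x)"
        using \<theta>(2)[of x] by (simp add: norm_mult del: of_real_diff)
      also have "\<dots> = q x" by (auto simp: \<theta>_def q_def algebra_simps)
      finally show ?case using elim(3) by simp
    qed
    have rp: "AE x in M. cmod (rep r x) \<le> cmod (rep p x)"
      using r_eq p(2) by eventually_elim (simp add: q_def)
    have Br: "B r \<in> pos_cone" by (rule modulus_boundedD(1)[OF mb r(1)])
    have B_fh: "AE x in M. cmod (rep (B (f - h)) x) \<le> cmod (rep (B r) x)"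
      by (rule modulus_boundedD(2)[OF mb r(1) fh])
    have B_rp: "AE x in M. cmod (rep (B r) x) \<le> cmod (rep (B p) x)"
      by (rule modulus_boundedD(2)[OF mb p(1) rp])
    define q1 q2 where "q1 x = min (cmod (rep (B r) x)) (cmod (rep w x))"
      and "q2 x = max 0 (cmod (rep (B r) x) - cmod (rep w x))" for x
    have q_meas: "q1 \<in> borel_measurable M" "q2 \<in> borel_measurable M" unfolding q1_def q2_def by measurable
    have q1_le: "AE x in M. q1 x \<le> cmod (rep (B r) x)" and q2_le: "AE x in M. q2 x \<le> cmod (rep (B r) x)"
      by (intro AE_I2, simp add: q1_def q2_def)+
    from obtain_positive[OF q_meas(1) _ q1_le]
    obtain h1 where h1: "h1 \<in> pos_cone" "AE x in M. rep h1 x = complex_of_real (q1 x)" by (auto simp: q1_def)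
    from obtain_positive[OF q_meas(2) _ q2_le]
    obtain h2 where h2: "h2 \<in> pos_cone" "AE x in M. rep h2 x = complex_of_real (q2 x)" by (auto simp: q2_def)
    have h1_eq: "AE x in M. cmod (rep h1 x) = q1 x" using h1(2) by eventually_elim (simp add: q1_def)
    have h2_eq: "AE x in M. cmod (rep h2 x) = q2 x" using h2(2) by eventually_elim (simp add: q2_def)
    have "norm h1 \<le> \<epsilon>"
    proof (rule ccontr)
      assume "\<not> norm h1 \<le> \<epsilon>"
      then have "\<epsilon> \<le> norm h1" by simp
      moreover have "AE x in M. cmod (rep h1 x) \<le> cmod (rep w x)"
        using h1_eq by eventually_elim (simp add: q1_def)
      ultimately have "c \<le> Re (\<Phi> h1)" using h1(1) by (intro \<Phi>c)
      also have "\<dots> \<le> Re (\<Phi> (B r))"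
      proof (rule dual_cone_mono[OF \<Phi> h1(1) Br])
        show "AE x in M. cmod (rep h1 x) \<le> cmod (rep (B r) x)"
          using h1_eq q1_le by eventually_elim simp
      qed
      also have "\<dots> < c"
      proof -
        have "AE x in M. cmod (rep r x) = max 0 (cmod (rep p x) - cmod (rep v x))"
          using r_eq p(2) by eventually_elim (simp add: q_def)
        from small[OF p(1) _ r(1) this] show ?thesis using p(3) f by simp
      qed
      finally show False by simp
    qed
    moreover have "norm h2 \<le> T"
    proof (rule trunc[OF p(1)])
      show "norm p \<le> 1" using p(3) f by simp
      show "AE x in M. cmod (rep h2 x) \<le> max 0 (cmod (rep (B p) x) - cmod (rep w x))"
        using h2_eq B_rp by eventually_elim (auto simp: q2_def)
    qed
    moreover have "norm (B (f - h)) \<le> norm (h1 + h2)"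
    proof (rule norm_mono)
      show "AE x in M. cmod (rep (B (f - h)) x) \<le> cmod (rep (h1 + h2) x)"
        using B_fh cmod_rep_add[OF h1(1) h2(1)] h1_eq h2_eq
        by eventually_elim (simp add: q1_def q2_def)
    qed
    ultimately have "norm (B (f - h)) \<le> T + \<epsilon>" using norm_triangle_ineq[of h1 h2] by linarith
    then have "norm (B f - B h) \<le> T + \<epsilon>" by (simp add: blinfun.diff_right)
    moreover have "norm (B f - g) \<le> norm (B f - B h) + norm (B h - g)"
      using norm_triangle_ineq[of "B f - B h" "B h - g"] by simp
    ultimately have "norm (B f - g) \<le> T + d" using g(2) by (simp add: \<epsilon>_def)
    then show ?thesis using g(1) by blast
  qed
  then have "T + d \<in> mnc_bounds B"
    unfolding mnc_bounds_def using T \<open>d > 0\<close> G(1) by auto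
  then show "hausdorff_mnc B \<le> T + d" by (rule hausdorff_mnc_le)
qed

lemma geometric_mean_bounded_mnc_le:
  assumes oc: "order_continuous_norm pos_cone" and oc': "order_continuous_norm dual_cone"
    and gm: "geometric_mean_bounded m \<alpha> C B"
    and B: "modulus_bounded B" "complex_linear B" "order_compact B"
    and \<alpha>: "\<And>j. j < m \<Longrightarrow> \<alpha> j > 0" and sum: "(\<Sum>j<m. \<alpha> j) = 1"
  shows "hausdorff_mnc B \<le> (\<Prod>j<m. hausdorff_mnc (C j) powr \<alpha> j)"
proof (rule le_weighted_geometric_limit)
  fix t assume t: "\<And>j. j \<in> {..<m} \<Longrightarrow> hausdorff_mnc (C j) < t j"
  have t0: "0 < t j" if "j < m" for j using t[of j] hausdorff_mnc_nonneg[of "C j"] that by simp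
  have mt: "hausdorff_mnc (C j) < t j" if "j < m" for j using t that by simp
  have "\<exists>w\<in>pos_cone. \<forall>p\<in>pos_cone. norm p \<le> 1 \<longrightarrow>
    (\<forall>r. (AE x in M. cmod (rep r x) \<le> max 0 (cmod (rep (B p) x) - cmod (rep w x))) \<longrightarrow>
      norm r \<le> (\<Prod>j<m. t j powr \<alpha> j))"
    using gm \<alpha> sum mt by (rule geometric_mean_bounded_truncation)
  then obtain w where w: "w \<in> pos_cone" "\<forall>p\<in>pos_cone. norm p \<le> 1 \<longrightarrow>
    (\<forall>r. (AE x in M. cmod (rep r x) \<le> max 0 (cmod (rep (B p) x) - cmod (rep w x))) \<longrightarrow>
      norm r \<le> (\<Prod>j<m. t j powr \<alpha> j))"
    by (elim bexE) (rule that)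
  have "(\<Prod>j<m. t j powr \<alpha> j) > 0" using t0 by (intro prod_pos) force
  then show "hausdorff_mnc B \<le> (\<Prod>j<m. t j powr \<alpha> j)"
    using w(2) by (intro hausdorff_mnc_le_of_truncation[OF oc oc' B w(1)]) simp_all
qed (use \<alpha> hausdorff_mnc_nonneg in auto)

end

section \<open>Products of Hadamard means\<close>

lemma comp_list_relation:
  fixes D :: "(nat \<Rightarrow> 'l::real_normed_vector \<Rightarrow>\<^sub>L 'l) \<Rightarrow> ('l \<Rightarrow>\<^sub>L 'l) \<Rightarrow> bool"
  assumes compose: "\<And>B B' C C'. D C B \<Longrightarrow> D C' B' \<Longrightarrow> D (\<lambda>j. C j o\<^sub>L C' j) (B o\<^sub>L B')"
    and base: "\<And>i. i < n \<Longrightarrow> D (A i) (B i)" and n: "n \<ge> 1"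
  shows "D (\<lambda>j. comp_list (map (\<lambda>i. A i j) [0..<n])) (comp_list (map B [0..<n]))"
  using n base
proof (induction n rule: nat_induct_at_least)
  case base
  then show ?case by simp
next
  case (Suc n)
  have "D (\<lambda>j. comp_list (map (\<lambda>i. A i j) [0..<n]) o\<^sub>L A n j) (comp_list (map B [0..<n]) o\<^sub>L B n)"
    using Suc by (intro compose) auto
  then show ?case by simp
qed

text \<open>Both sides are ((i + j) mod m) + 1, which is symmetric in i and j.\<close>

lemma nth_rotated_upt:
  assumes "i < m" "j < m"
  shows "([Suc i..<Suc m] @ [1..<Suc i]) ! j = ([Suc j..<Suc m] @ [1..<Suc j]) ! i"
  using assms by (auto simp: nth_append simp del: upt_Suc)

text \<open>The operators form a matrix: row i has the i-th factor of B as its mean, and column j is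
  multiplied to \<open>C j\<close>. By the symmetry of the rotated indices, column j runs through
  the same rotation as row j.\<close>

lemma set_product_hadamard_relation:
  fixes D :: "(nat \<Rightarrow> 'l::complex_banach \<Rightarrow>\<^sub>L 'l) \<Rightarrow> ('l \<Rightarrow>\<^sub>L 'l) \<Rightarrow> bool"
  assumes m: "m \<ge> 1"
    and \<Sigma>: "\<And>i. i \<in> {1..m} \<Longrightarrow>
      \<Sigma> i = hadamard_set M rep \<alpha>s (map \<Psi> ([i..<Suc m] @ [1..<i]))"
    and compose: "\<And>B B' C C'. D C B \<Longrightarrow> D C' B' \<Longrightarrow> D (\<lambda>j. C j o\<^sub>L C' j) (B o\<^sub>L B')"
    and mean: "\<And>As B. length As = m \<Longrightarrow> hadamard_mean M rep \<alpha>s As B \<Longrightarrow> D (\<lambda>j. As ! j) B"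
    and B: "B \<in> set_product (map \<Sigma> [1..<Suc m])"
  shows "\<exists>C. D C B \<and> (\<forall>j<m. C j \<in> set_product (map \<Psi> ([Suc j..<Suc m] @ [1..<Suc j])))"
proof -
  obtain Bs where Bs: "Bs \<in> listset (map \<Sigma> [1..<Suc m])" "B = comp_list Bs"
    using B by (auto simp: set_product_def)
  have len: "length Bs = m" and Bs_nth: "\<And>i. i < m \<Longrightarrow> Bs ! i \<in> \<Sigma> (Suc i)"
    using Bs(1) by (auto simp: listset_conv simp del: upt_Suc)
  have "\<exists>As. i < m \<longrightarrow> As \<in> listset (map \<Psi> ([Suc i..<Suc m] @ [1..<Suc i])) \<and>
      hadamard_mean M rep \<alpha>s As (Bs ! i)" for i
    using Bs_nth[of i] \<Sigma>[of "Suc i"] by (auto simp: hadamard_set_def simp del: upt_Suc)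
  then obtain As where As: "\<And>i. i < m \<longrightarrow> As i \<in> listset (map \<Psi> ([Suc i..<Suc m] @ [1..<Suc i])) \<and>
      hadamard_mean M rep \<alpha>s (As i) (Bs ! i)"
    by metis
  have As_len: "length (As i) = m" if "i < m" for i
    using As[of i] that by (auto simp: listset_conv simp del: upt_Suc)
  have As_nth: "As i ! j \<in> \<Psi> (([Suc i..<Suc m] @ [1..<Suc i]) ! j)" if "i < m" "j < m" for i j
  proof -
    have "As i ! j \<in> map \<Psi> ([Suc i..<Suc m] @ [1..<Suc i]) ! j"
      using As[of i] that by (simp add: listset_conv del: upt_Suc map_append)
    then show ?thesis using that by (simp add: nth_map del: upt_Suc map_append)
  qed
  define C where "C j = comp_list (map (\<lambda>i. As i ! j) [0..<m])" for j
  have "D (\<lambda>j. comp_list (map (\<lambda>i. As i ! j) [0..<m])) (comp_list (map (\<lambda>i. Bs ! i) [0..<m]))"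
    using compose mean[OF As_len] As m by (intro comp_list_relation[where D = D]) auto
  moreover have "map (\<lambda>i. Bs ! i) [0..<m] = Bs" using map_nth[of Bs] len by simp
  ultimately have "D C B" unfolding C_def[abs_def] Bs(2) by simp
  moreover have "C j \<in> set_product (map \<Psi> ([Suc j..<Suc m] @ [1..<Suc j]))" if j: "j < m" for j
  proof -
    have "map (\<lambda>i. As i ! j) [0..<m] \<in> listset (map \<Psi> ([Suc j..<Suc m] @ [1..<Suc j]))"
      unfolding listset_conv
    proof (intro conjI allI impI)
      show "length (map (\<lambda>i. As i ! j) [0..<m]) = length (map \<Psi> ([Suc j..<Suc m] @ [1..<Suc j]))"
        using j by (simp del: upt_Suc)
      fix i assume "i < length (map \<Psi> ([Suc j..<Suc m] @ [1..<Suc j]))"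
      then have i: "i < m" using j by (simp del: upt_Suc)
      show "map (\<lambda>i. As i ! j) [0..<m] ! i \<in> map \<Psi> ([Suc j..<Suc m] @ [1..<Suc j]) ! i"
        using As_nth[OF i j] i j nth_rotated_upt[OF i j] by (simp add: nth_map del: upt_Suc map_append)
    qed
    then show ?thesis unfolding C_def set_product_def by (rule imageI)
  qed
  ultimately show ?thesis by blast
qed

lemma complex_linear_set_product:
  assumes "\<And>X A. X \<in> set Xs \<Longrightarrow> A \<in> X \<Longrightarrow> complex_linear A" "B \<in> set_product Xs"
  shows "complex_linear B"
  using assms
proof (induction Xs arbitrary: B)
  case Nil
  then show ?case by (simp add: complex_linear_def)
next
  case (Cons X Xs)
  obtain A B' where A: "A \<in> X" "B' \<in> set_product Xs" "B = A o\<^sub>L B'"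
    using Cons.prems(2) unfolding set_product_Cons by blast
  have "complex_linear A" using A(1) by (rule Cons.prems(1)[rotated]) simp
  moreover have "complex_linear B'"
  proof (rule Cons.IH[OF _ A(2)])
    fix Y A assume Y: "Y \<in> set Xs" "A \<in> Y"
    from Y(1) have "Y \<in> set (X # Xs)" by simp
    then show "complex_linear A" using Y(2) by (rule Cons.prems(1))
  qed
  ultimately show ?case unfolding A(3) by (rule complex_linear_compose)
qed

lemma complex_linear_set_power:
  assumes "\<And>A. A \<in> \<Sigma> \<Longrightarrow> complex_linear A" "B \<in> set_power \<Sigma> k"
  shows "complex_linear B"
  using assms(2) unfolding set_power_def
proof (rule complex_linear_set_product[rotated])
  show "complex_linear A" if "X \<in> set (replicate k \<Sigma>)" "A \<in> X" for X A
    using that assms(1) by (simp split: if_splits)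
qed

lemma positive_kernel_operator_complex_linear:
  "positive_kernel_operator M rep A \<Longrightarrow> complex_linear A"
  by (simp add: positive_kernel_operator_def positive_operator_def complex_linear_def)

lemma generalized_radius_eq:
  assumes "\<And>A. A \<in> \<Sigma> \<Longrightarrow> complex_linear A"
  shows "generalized_radius \<Sigma> =
    limsup (\<lambda>k. ereal (root k (nonneg_Sup (limit_radius norm ` set_power \<Sigma> k))))"
proof -
  have "spectral_radius ` set_power \<Sigma> k = limit_radius norm ` set_power \<Sigma> k" for k
  proof (rule image_cong[OF refl])
    fix A assume "A \<in> set_power \<Sigma> k"
    then show "spectral_radius A = limit_radius norm A"
      by (intro spectral_radius_eq_limit_radius complex_linear_set_power[OF assms])
  qed
  then show ?thesis by (simp add: generalized_radius_def)
qed

lemma ess_spectral_radius_eq: "ess_spectral_radius = limit_radius hausdorff_mnc"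
  by (rule ext) (simp add: ess_spectral_radius_def limit_radius_def)

theorem corollary2p1:
  fixes M :: "'a measure" and rep :: "'l::complex_banach \<Rightarrow> 'a \<Rightarrow> complex"
    and m :: nat and \<Psi> \<Sigma> :: "nat \<Rightarrow> ('l \<Rightarrow>\<^sub>L 'l) set" and \<alpha> :: "nat \<Rightarrow> real"
  assumes "banach_function_space M rep"
    and "m \<ge> 1"
    and "\<And>j. j \<in> {1..m} \<Longrightarrow> bounded (\<Psi> j)"
    and "\<And>j A. j \<in> {1..m} \<Longrightarrow> A \<in> \<Psi> j \<Longrightarrow> positive_kernel_operator M rep A"
    and "\<And>j. j \<in> {1..m} \<Longrightarrow> \<alpha> j > 0"
    and "(\<Sum>j=1..m. \<alpha> j) = 1"
    and "\<And>i. i \<in> {1..m} \<Longrightarrow>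
      \<Sigma> i = hadamard_set M rep (map \<alpha> [1..<Suc m]) (map \<Psi> ([i..<Suc m] @ [1..<i]))"
  shows "(\<forall>r\<in>{generalized_radius, joint_radius}.
            r (set_product (map \<Sigma> [1..<Suc m])) \<le> r (set_product (map \<Psi> [1..<Suc m]))) \<and>
         (order_continuous_norm (positive_cone M rep) \<and>
          order_continuous_norm (dual_positive_cone M rep) \<longrightarrow>
          (\<forall>r\<in>{generalized_ess_radius, joint_ess_radius}.
            r (set_product (map \<Sigma> [1..<Suc m])) \<le> r (set_product (map \<Psi> [1..<Suc m]))))"
proof -
  interpret L: banach_function_space M rep by fact
  \<comment> \<open>The weights are numbered from 1, list positions from 0.\<close>
  define \<beta> where "\<beta> j = \<alpha> (Suc j)" for j
  have \<beta>: "\<beta> j > 0" if "j < m" for j using assms(5)[of "Suc j"] that by (simp add: \<beta>_def)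
  have \<beta>_sum: "(\<Sum>j<m. \<beta> j) = 1"
    using assms(6) by (simp add: \<beta>_def sum.atLeast1_atMost_eq)
  let ?S = "set_product (map \<Sigma> [1..<Suc m])" and ?\<Phi> = "set_product (map \<Psi> [1..<Suc m])"
  have \<alpha>s: "map \<alpha> [1..<Suc m] ! j = \<beta> j" if "j < m" for j
    using that by (simp add: \<beta>_def del: upt_Suc)
  have mean: "L.geometric_mean_bounded m \<beta> (\<lambda>j. As ! j) B"
    if "length As = m" "hadamard_mean M rep (map \<alpha> [1..<Suc m]) As B" for As B
  proof -
    have "L.geometric_mean_bounded m (\<lambda>j. map \<alpha> [1..<Suc m] ! j) (\<lambda>j. As ! j) B"
      using that \<alpha>s \<beta> \<beta>_sum by (intro L.hadamard_mean_geometric_mean_bounded) auto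
    then show ?thesis unfolding L.geometric_mean_bounded_def using \<alpha>s by simp
  qed
  have \<Phi>_linear: "complex_linear A" if "A \<in> ?\<Phi>" for A
  proof (rule complex_linear_set_product[OF _ that])
    fix X A assume "X \<in> set (map \<Psi> [1..<Suc m])" "A \<in> X"
    then obtain j where "j \<in> {1..m}" "A \<in> \<Psi> j" by (auto simp: less_Suc_eq_le simp del: upt_Suc)
    then show "complex_linear A"
      by (intro positive_kernel_operator_complex_linear[of M rep] assms(4))
  qed
  have S_linear: "complex_linear A" if "A \<in> ?S" for A
  proof (rule complex_linear_set_product[OF _ that])
    fix X A assume "X \<in> set (map \<Sigma> [1..<Suc m])" "A \<in> X"
    then obtain i where "i \<in> {1..m}" "A \<in> \<Sigma> i" by (auto simp: less_Suc_eq_le simp del: upt_Suc)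
    then have "positive_kernel_operator M rep A"
      unfolding assms(7)[OF \<open>i \<in> {1..m}\<close>] hadamard_set_def hadamard_mean_def by blast
    then show "complex_linear A" by (rule positive_kernel_operator_complex_linear)
  qed

  have S1: "\<exists>C. L.geometric_mean_bounded m \<beta> C B \<and>
      (\<forall>j<m. C j \<in> set_product (map \<Psi> ([Suc j..<Suc m] @ [1..<Suc j])))" if "B \<in> ?S" for B
    using assms(2,7) L.geometric_mean_bounded_compose mean that
    by (rule set_product_hadamard_relation)
  note cmp = norm_functional.radius_product_comparison[where m = m and \<Psi> = \<Psi> and \<alpha> = \<beta> and S = ?S
      and D = "L.geometric_mean_bounded m \<beta>", OF assms(3) \<beta> \<beta>_sum L.geometric_mean_bounded_compose
      L.geometric_mean_bounded_norm_le[OF _ \<beta> \<beta>_sum] S1]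
  have "joint_radius ?S \<le> joint_radius ?\<Phi>"
    unfolding joint_radius_def by (rule cmp(1))
  moreover have "generalized_radius ?S \<le> generalized_radius ?\<Phi>"
  proof -
    have S_eq: "generalized_radius ?S =
        limsup (\<lambda>k. ereal (root k (nonneg_Sup (limit_radius norm ` set_power ?S k))))"
      using S_linear by (rule generalized_radius_eq)
    have \<Phi>_eq: "generalized_radius ?\<Phi> =
        limsup (\<lambda>k. ereal (root k (nonneg_Sup (limit_radius norm ` set_power ?\<Phi> k))))"
      using \<Phi>_linear by (rule generalized_radius_eq)
    show ?thesis unfolding S_eq \<Phi>_eq by (rule cmp(2))
  qed
  moreover have "joint_ess_radius ?S \<le> joint_ess_radius ?\<Phi> \<and> generalized_ess_radius ?S \<le> generalized_ess_radius ?\<Phi>"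
    if oc: "order_continuous_norm (positive_cone M rep)" "order_continuous_norm (dual_positive_cone M rep)"
  proof -
    \<comment> \<open>The bound on noncompactness needs, beyond the pointwise estimate, that B is
      positive, complex linear and AM-compact; carried along in \<open>D\<close>, these properties
      are available for all products.\<close>
    define D where "D C B \<longleftrightarrow> L.geometric_mean_bounded m \<beta> C B \<and> L.modulus_bounded B \<and>
      complex_linear B \<and> L.order_compact B" for C B
    have D_compose: "D (\<lambda>j. C j o\<^sub>L C' j) (B o\<^sub>L B')" if "D C B" "D C' B'" for B B' C C'
      using that unfolding D_def
      by (auto intro!: L.geometric_mean_bounded_compose L.modulus_bounded_compose
          L.order_compact_compose complex_linear_compose)
    have D_le: "hausdorff_mnc B \<le> (\<Prod>j<m. hausdorff_mnc (C j) powr \<beta> j)" if "D C B" for B C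
      using that \<beta> \<beta>_sum unfolding D_def by (intro L.geometric_mean_bounded_mnc_le[OF oc]) auto
    have D_mean: "D (\<lambda>j. As ! j) B"
      if As: "length As = m" "hadamard_mean M rep (map \<alpha> [1..<Suc m]) As B" for As B
    proof -
      \<comment> \<open>The kernel of a Hadamard mean comes as a nonnegative product, so positivity
        and AM-compactness follow from this kernel directly.\<close>
      obtain a :: "nat \<Rightarrow> 'a \<times> 'a \<Rightarrow> real" where
        b: "has_kernel M rep B (\<lambda>z. complex_of_real (\<Prod>j<length As. a j z powr (map \<alpha> [1..<Suc m] ! j)))"
        using As(2) unfolding hadamard_mean_def by blast
      have b0: "0 \<le> (\<Prod>j<length As. a j z powr (map \<alpha> [1..<Suc m] ! j))" for z
        by (intro prod_nonneg) simp
      have "positive_kernel_operator M rep B" using As(2) unfolding hadamard_mean_def by blast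
      then show ?thesis
        using mean[OF As] L.kernel_modulus_bounded[OF b b0] L.kernel_order_compact[OF oc(1) b b0]
        by (simp add: D_def positive_kernel_operator_complex_linear)
    qed
    have S2: "\<exists>C. D C B \<and> (\<forall>j<m. C j \<in> set_product (map \<Psi> ([Suc j..<Suc m] @ [1..<Suc j])))"
      if "B \<in> ?S" for B
      using assms(2,7) D_compose D_mean that by (rule set_product_hadamard_relation)
    note cmp' = mnc_functional.radius_product_comparison[where m = m and \<Psi> = \<Psi> and \<alpha> = \<beta> and S = ?S
        and D = D, OF assms(3) \<beta> \<beta>_sum D_compose D_le S2]
    show ?thesis
      unfolding joint_ess_radius_def generalized_ess_radius_def ess_spectral_radius_eq
      by (intro conjI cmp')
  qed
  ultimately show ?thesis by blast
qed

end
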